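(* Let $s\in(0,1)$, $N>2s$, let $\Omega\subset\mathbb{R}^N$ be a smooth bounded domain, and let $p,q>0$ satisfy $\frac1{p+1}+\frac1{q+1}>\frac{N-2s}{N}$. Let $u\in\mathcal{W}^{2s,1}(\Omega)$ and put $v=|(-\Delta)^su|^{\frac1q-1}(-\Delta)^su$. Then $u$ is an energy solution to $$(-\Delta)^s\Big(|(-\Delta)^su|^{\frac1q-1}(-\Delta)^su\Big)=|u|^{p-1}u\ \text{in }\Omega,\qquad u=(-\Delta)^su=0\ \text{in }\mathbb{R}^N\setminus\Omega$$ if and only if $(u,v)$ is a classical solution to $$(-\Delta)^su=|v|^{q-1}v\ \text{in }\Omega,\qquad (-\Delta)^sv=|u|^{p-1}u\ \text{in }\Omega,\qquad u=v=0\ \text{in }\mathbb{R}^N\setminus\Omega.$$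
   Context: Let $X_0^s(\Omega)$ be the space of $u\in L^2(\mathbb{R}^N)$ with $u=0$ a.e. in $\mathbb{R}^N\setminus\Omega$ and $\int_{\mathbb{R}^{2N}}\frac{|u(x)-u(y)|^2}{|x-y|^{N+2s}}dxdy<\infty$. The operator $(-\Delta)^s$ maps $X_0^s(\Omega)$ to its dual by $\langle(-\Delta)^su,v\rangle=\int_{\mathbb{R}^{2N}}\frac{(u(x)-u(y))(v(x)-v(y))}{|x-y|^{N+2s}}dxdy$; for a function $f$ on $\Omega$, $(-\Delta)^su=f$ means $\langle(-\Delta)^su,w\rangle=\int_\Omega fw\,dx$ for all $w\in X_0^s(\Omega)$. Let $\mathcal{T}_s(\Omega)=\{\varphi\in X_0^s(\Omega):(-\Delta)^s\varphi\in C_c^\infty(\Omega)\}$. For $r\ge1$, $\mathcal{W}^{2s,r}(\Omega)$ is the set of $u\in L^1(\Omega)$ for which there is $f\in L^r(\Omega)$ with $\int_\Omega u(-\Delta)^s\varphi\,dx=\int_\Omega f\varphi\,dx$ for all $\varphi\in\mathcal{T}_s(\Omega)$; one writes $(-\Delta)^su:=f$. $u$ is an energy solution of the first problem if $u\in\mathcal{W}^{2s,1+\frac1q}(\Omega)$ and $\int_\Omega|(-\Delta)^su|^{\frac1q-1}(-\Delta)^su\,(-\Delta)^s\varphi\,dx=\int_\Omega|u|^{p-1}u\varphi\,dx$ for all $\varphi\in\mathcal{W}^{2s,1+\frac1q}(\Omega)$. $(u,v)$ is a classical solution of the system if $u,v\in L^\infty(\Omega)$ and, for all $\varphi,\psi\in\mathcal{T}_s(\Omega)$,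 $\int_\Omega u(-\Delta)^s\varphi\,dx=\int_\Omega|v|^{q-1}v\varphi\,dx$ and $\int_\Omega v(-\Delta)^s\psi\,dx=\int_\Omega|u|^{p-1}u\psi\,dx$. *)

theory Defs
  imports "HOL-Analysis.Analysis"
begin

text \<open>
  Functions on \<open>\<Omega>\<close> are represented by total functions \<open>'a \<Rightarrow> real\<close> on the Euclidean space; only
  their values (up to null sets) on \<open>\<Omega>\<close> are used, except for members of \<open>X0\<close>, which live on the
  whole space.
\<close>

subsection \<open>Smooth functions and smooth domains\<close>

primrec Ck_fun :: "nat \<Rightarrow> ('a::euclidean_space \<Rightarrow> real) \<Rightarrow> bool" where
  "Ck_fun 0 f \<longleftrightarrow> continuous_on UNIV f"
| "Ck_fun (Suc k) f \<longleftrightarrow>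
     (\<forall>x. f differentiable (at x)) \<and> (\<forall>h. Ck_fun k (\<lambda>x. frechet_derivative f (at x) h))"

definition smooth_fun :: "('a::euclidean_space \<Rightarrow> real) \<Rightarrow> bool" where
  "smooth_fun f \<longleftrightarrow> (\<forall>k. Ck_fun k f)"

definition Cc_infty :: "'a::euclidean_space set \<Rightarrow> ('a \<Rightarrow> real) set" where
  "Cc_infty \<Omega> = {f. smooth_fun f \<and> compact (closure {x. f x \<noteq> 0}) \<and> closure {x. f x \<noteq> 0} \<subseteq> \<Omega>}"

text \<open>
  Near each boundary point the domain is the region above the graph of a smooth function, after a
  rotation of the axes: \<open>\<nu>\<close> is the vertical direction and \<open>x - (x \<bullet> \<nu>) *\<^sub>R \<nu>\<close> is the horizontal part of
  \<open>x\<close>, so that only the values of \<open>\<gamma>\<close> on the hyperplane orthogonal to \<open>\<nu>\<close> matter.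
\<close>

definition smooth_boundary :: "'a::euclidean_space set \<Rightarrow> bool" where
  "smooth_boundary \<Omega> \<longleftrightarrow>
     (\<forall>x0\<in>frontier \<Omega>. \<exists>r>0. \<exists>\<nu> \<gamma>. norm \<nu> = 1 \<and> smooth_fun \<gamma> \<and>
        \<Omega> \<inter> ball x0 r = {x \<in> ball x0 r. x \<bullet> \<nu> > \<gamma> (x - (x \<bullet> \<nu>) *\<^sub>R \<nu>)})"

definition smooth_bounded_domain :: "'a::euclidean_space set \<Rightarrow> bool" where
  "smooth_bounded_domain \<Omega> \<longleftrightarrow>
     open \<Omega> \<and> connected \<Omega> \<and> \<Omega> \<noteq> {} \<and> bounded \<Omega> \<and> smooth_boundary \<Omega>"

subsection \<open>Lebesgue spaces\<close>

definition Lp :: "real \<Rightarrow> 'a::euclidean_space set \<Rightarrow> ('a \<Rightarrow> real) set" where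
  "Lp r \<Omega> = {f \<in> borel_measurable (lebesgue_on \<Omega>).
     integrable (lebesgue_on \<Omega>) (\<lambda>x. \<bar>f x\<bar> powr r)}"

definition Linfty :: "'a::euclidean_space set \<Rightarrow> ('a \<Rightarrow> real) set" where
  "Linfty \<Omega> = {f \<in> borel_measurable (lebesgue_on \<Omega>).
     \<exists>C. AE x in lebesgue_on \<Omega>. \<bar>f x\<bar> \<le> C}"

subsection \<open>The fractional Laplacian\<close>

text \<open>The diagonal \<open>x = y\<close>, where the quotients below are \<open>0\<close> by convention, is a null set.\<close>

definition X0 :: "real \<Rightarrow> 'a::euclidean_space set \<Rightarrow> ('a \<Rightarrow> real) set" where
  "X0 s \<Omega> = {u \<in> Lp 2 UNIV. (AE x in lebesgue. x \<notin> \<Omega> \<longrightarrow> u x = 0) \<and>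
     integrable (lebesgue :: ('a \<times> 'a) measure)
       (\<lambda>(x, y). \<bar>u x - u y\<bar>\<^sup>2 / norm (x - y) powr (real DIM('a) + 2 * s))}"

definition frac_form :: "real \<Rightarrow> ('a::euclidean_space \<Rightarrow> real) \<Rightarrow> ('a \<Rightarrow> real) \<Rightarrow> real" where
  "frac_form s u v = integral\<^sup>L (lebesgue :: ('a \<times> 'a) measure)
     (\<lambda>(x, y). (u x - u y) * (v x - v y) / norm (x - y) powr (real DIM('a) + 2 * s))"

text \<open>\<open>has_frac_lap s \<Omega> u f\<close> means \<open>(-\<Delta>)\<^sup>s u = f\<close> in the dual of \<open>X0 s \<Omega>\<close>.\<close>

definition has_frac_lap ::
    "real \<Rightarrow> 'a::euclidean_space set \<Rightarrow> ('a \<Rightarrow> real) \<Rightarrow> ('a \<Rightarrow> real) \<Rightarrow> bool" where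
  "has_frac_lap s \<Omega> u f \<longleftrightarrow>
     u \<in> X0 s \<Omega> \<and> (\<forall>w \<in> X0 s \<Omega>. frac_form s u w = (LINT x|lebesgue_on \<Omega>. f x * w x))"

definition test_fun :: "real \<Rightarrow> 'a::euclidean_space set \<Rightarrow> ('a \<Rightarrow> real) set" where
  "test_fun s \<Omega> = {\<phi> \<in> X0 s \<Omega>. \<exists>g \<in> Cc_infty \<Omega>. has_frac_lap s \<Omega> \<phi> g}"

text \<open>
  \<open>vw_frac_lap s \<Omega> u f\<close> is the very weak form of \<open>(-\<Delta>)\<^sup>s u = f\<close>: the identity
  \<open>\<integral>\<^sub>\<Omega> u (-\<Delta>)\<^sup>s \<phi> = \<integral>\<^sub>\<Omega> f \<phi>\<close> for all test functions \<open>\<phi>\<close>, where \<open>g\<close> plays the role of \<open>(-\<Delta>)\<^sup>s \<phi>\<close>.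
\<close>

definition vw_frac_lap ::
    "real \<Rightarrow> 'a::euclidean_space set \<Rightarrow> ('a \<Rightarrow> real) \<Rightarrow> ('a \<Rightarrow> real) \<Rightarrow> bool" where
  "vw_frac_lap s \<Omega> u f \<longleftrightarrow>
     (\<forall>\<phi> \<in> test_fun s \<Omega>. \<forall>g \<in> Cc_infty \<Omega>. has_frac_lap s \<Omega> \<phi> g \<longrightarrow>
        (LINT x|lebesgue_on \<Omega>. u x * g x) = (LINT x|lebesgue_on \<Omega>. f x * \<phi> x))"

definition W2s :: "real \<Rightarrow> real \<Rightarrow> 'a::euclidean_space set \<Rightarrow> ('a \<Rightarrow> real) set" where
  "W2s s r \<Omega> = {u \<in> Lp 1 \<Omega>. \<exists>f \<in> Lp r \<Omega>. vw_frac_lap s \<Omega> u f}"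

text \<open>
  The function \<open>f\<close> is unique up to null sets, and \<open>Lp r \<Omega> \<subseteq> Lp 1 \<Omega>\<close> for bounded \<open>\<Omega>\<close> and \<open>r \<ge> 1\<close>, so
  one choice made in \<open>Lp 1 \<Omega>\<close> serves for all the spaces \<open>W2s s r \<Omega>\<close>.
\<close>

definition frac_lap ::
    "real \<Rightarrow> 'a::euclidean_space set \<Rightarrow> ('a \<Rightarrow> real) \<Rightarrow> 'a \<Rightarrow> real" where
  "frac_lap s \<Omega> u = (SOME f. f \<in> Lp 1 \<Omega> \<and> vw_frac_lap s \<Omega> u f)"

subsection \<open>Solutions\<close>

text \<open>The odd power \<open>\<bar>t\<bar>\<^sup>a\<^sup>-\<^sup>1 t\<close>, with value \<open>0\<close> at \<open>t = 0\<close> also when \<open>a \<le> 1\<close>.\<close>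

definition odd_powr :: "real \<Rightarrow> real \<Rightarrow> real" where
  "odd_powr a t = \<bar>t\<bar> powr (a - 1) * t"

definition energy_solution ::
    "real \<Rightarrow> real \<Rightarrow> real \<Rightarrow> 'a::euclidean_space set \<Rightarrow> ('a \<Rightarrow> real) \<Rightarrow> bool" where
  "energy_solution s p q \<Omega> u \<longleftrightarrow>
     u \<in> W2s s (1 + 1 / q) \<Omega> \<and>
     (\<forall>\<phi> \<in> W2s s (1 + 1 / q) \<Omega>.
        (LINT x|lebesgue_on \<Omega>. odd_powr (1 / q) (frac_lap s \<Omega> u x) * frac_lap s \<Omega> \<phi> x) =
        (LINT x|lebesgue_on \<Omega>. odd_powr p (u x) * \<phi> x))"

text \<open>The Dirichlet condition outside \<open>\<Omega>\<close> is built into the very weak formulation.\<close>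

definition classical_solution ::
    "real \<Rightarrow> real \<Rightarrow> real \<Rightarrow> 'a::euclidean_space set \<Rightarrow> ('a \<Rightarrow> real) \<Rightarrow> ('a \<Rightarrow> real) \<Rightarrow> bool" where
  "classical_solution s p q \<Omega> u v \<longleftrightarrow>
     u \<in> Linfty \<Omega> \<and> v \<in> Linfty \<Omega> \<and>
     vw_frac_lap s \<Omega> u (\<lambda>x. odd_powr q (v x)) \<and>
     vw_frac_lap s \<Omega> v (\<lambda>x. odd_powr p (u x))"

end

theory Submission
  imports Defs
begin

text \<open>
  Let \<open>G g\<close> be the variational solution of \<open>(-\<Delta>)\<^sup>s \<phi> = g\<close> in the energy space. It exists for bounded
  \<open>g\<close> by minimization, and \<open>G\<close> is symmetric. Very weak solutions are understood by duality with \<open>G\<close>: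
  bounded almost everywhere limits extend the identity \<open>\<integral> u g = \<integral> f (G g)\<close> from smooth to all bounded
  \<open>g\<close> (\<open>vw_frac_lap_bounded_test\<close>).

  Three facts carry the proof. First, the right hand side of a very weak solution is unique
  (\<open>vw_frac_lap_unique\<close>), so that \<open>frac_lap\<close> is the function that each definition means. The functions
  \<open>G g\<close> separate the points of \<open>L\<^sup>1\<close> because they contain the resolvents
  \<open>n (n + (-\<Delta>)\<^sup>s)\<^sup>-\<^sup>1 h\<close> of smooth compactly supported \<open>h\<close>, which stay bounded and converge to \<open>h\<close>
  (\<open>frac_lap_solutions_separate\<close>).

  Secondly, \<open>G\<close> improves integrability: data in \<open>L\<^sup>\<rho>\<close> give solutions in \<open>L\<^sup>\<tau>\<close> if
  \<open>1 / \<tau> > 1 / \<rho> - 2 s / N\<close>, and bounded ones if \<open>1 / \<rho> < 2 s / N\<close>. The nonlocal energy of a function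
  that lives on a set of measure \<open>m\<close> dominates \<open>m\<^sup>-\<^sup>2\<^sup>s\<^sup>/\<^sup>N\<close> times its square integral, simply because
  at least half of any ball of volume \<open>2 m\<close> lies outside the set (\<open>Faber_Krahn_inequality\<close>). Applied to
  truncations of the solution this compares the measures of two of its superlevel sets
  (\<open>level_estimate\<close>), and iteration over the levels gives both statements. Very weak solutions are
  almost everywhere limits of solutions with truncated data and inherit the gain (\<open>vw_frac_lap_Lp\<close>, \<open>vw_frac_lap_Linfty\<close>).

  Thirdly, subcriticality makes the gain of one turn through the system exceed the loss from the two
  powers, by an amount that is bounded below, so that finitely many turns take an energy solution from
  \<open>L\<^sup>p\<^sup>+\<^sup>1\<close> to \<open>L\<^sup>\<infinity>\<close> (\<open>bootstrap_to_Linfty\<close>). With boundedness at hand the two formulations are turned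
  into each other by the symmetry of \<open>G\<close>.
\<close>

section \<open>Smooth compactly supported functions\<close>

lemma Ck_fun_Suc_imp_Ck_fun: "Ck_fun (Suc k) f \<Longrightarrow> Ck_fun k f"
proof (induction k arbitrary: f)
  case 0
  then show ?case
    by (auto simp: continuous_on_eq_continuous_at intro: differentiable_imp_continuous_within)
next
  case (Suc k)
  then show ?case by (metis Ck_fun.simps(2))
qed

lemma smooth_fun_iff:
  "smooth_fun f \<longleftrightarrow> (\<forall>x. f differentiable (at x)) \<and> (\<forall>h. smooth_fun (\<lambda>x. frechet_derivative f (at x) h))"
proof
  assume f: "smooth_fun f"
  then have "Ck_fun (Suc k) f" for k unfolding smooth_fun_def by blast
  then show "(\<forall>x. f differentiable (at x)) \<and> (\<forall>h. smooth_fun (\<lambda>x. frechet_derivative f (at x) h))"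
    unfolding smooth_fun_def by (simp)
next
  assume f: "(\<forall>x. f differentiable (at x)) \<and> (\<forall>h. smooth_fun (\<lambda>x. frechet_derivative f (at x) h))"
  then have "Ck_fun (Suc k) f" for k unfolding smooth_fun_def by simp
  then show "smooth_fun f" unfolding smooth_fun_def using Ck_fun_Suc_imp_Ck_fun by blast
qed

text \<open>Smoothness is the largest property that passes from a function to its directional derivatives;
  a family of functions closed under differentiation therefore consists of smooth functions.\<close>

lemma smooth_fun_coinduct:
  assumes "f \<in> S"
    and "\<And>f. f \<in> S \<Longrightarrow> \<exists>f'. (\<forall>x. (f has_derivative f' x) (at x)) \<and> (\<forall>h. (\<lambda>x. f' x h) \<in> S)"
  shows "smooth_fun f"
proof -
  have "\<forall>f\<in>S. Ck_fun k f" for k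
  proof (induction k)
    case 0
    show ?case
      using assms(2)
      by (fastforce simp: continuous_on_eq_continuous_at dest: has_derivative_continuous)
  next
    case (Suc k)
    show ?case
    proof
      fix f assume "f \<in> S"
      then obtain f' where f': "\<And>x. (f has_derivative f' x) (at x)" "\<And>h. (\<lambda>x. f' x h) \<in> S"
        using assms(2) by blast
      have "frechet_derivative f (at x) = f' x" for x
        using f'(1) frechet_derivative_at by metis
      with f' Suc show "Ck_fun (Suc k) f"
        by (auto simp: differentiable_def)
    qed
  qed
  with \<open>f \<in> S\<close> show ?thesis unfolding smooth_fun_def by blast
qed

lemma smooth_fun_has_derivative:
  "smooth_fun f \<Longrightarrow> (f has_derivative frechet_derivative f (at x)) (at x)"
  using smooth_fun_iff frechet_derivative_works by blast

lemma smooth_fun_continuous_on: "smooth_fun f \<Longrightarrow> continuous_on A f"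
  by (metis smooth_fun_def Ck_fun.simps(1) continuous_on_subset subset_UNIV)

lemma smooth_fun_const: "smooth_fun (\<lambda>x. c)"
  by (rule smooth_fun_coinduct[where S = "range (\<lambda>c x. c)"])
     (auto intro!: exI[of _ "\<lambda>x h. 0"])

lemma smooth_fun_bounded_linear: "bounded_linear f \<Longrightarrow> smooth_fun f"
  by (subst smooth_fun_iff)
     (auto simp: bounded_linear_imp_differentiable smooth_fun_const
       simp flip: frechet_derivative_at[OF bounded_linear_imp_has_derivative])

lemma Ck_fun_add: "Ck_fun k f \<Longrightarrow> Ck_fun k g \<Longrightarrow> Ck_fun k (\<lambda>x. f x + g x)"
proof (induction k arbitrary: f g)
  case (Suc k)
  have fd: "(f has_derivative frechet_derivative f (at x)) (at x)"
    "(g has_derivative frechet_derivative g (at x)) (at x)" for x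
    using Suc.prems by (auto simp: frechet_derivative_works[symmetric])
  have "frechet_derivative (\<lambda>x. f x + g x) (at x)
      = (\<lambda>h. frechet_derivative f (at x) h + frechet_derivative g (at x) h)" for x
    using frechet_derivative_at[OF has_derivative_add[OF fd]] by metis
  then show ?case using Suc by auto
qed (auto intro: continuous_intros)

lemma Ck_fun_mult: "Ck_fun k f \<Longrightarrow> Ck_fun k g \<Longrightarrow> Ck_fun k (\<lambda>x. f x * g x)"
proof (induction k arbitrary: f g)
  case (Suc k)
  have fd: "(f has_derivative frechet_derivative f (at x)) (at x)"
    "(g has_derivative frechet_derivative g (at x)) (at x)" for x
    using Suc.prems by (auto simp: frechet_derivative_works[symmetric])
  have "(\<lambda>x. f x * g x) differentiable (at x)" for x
    using has_derivative_mult[OF fd] unfolding differentiable_def by blast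
  moreover have "frechet_derivative (\<lambda>x. f x * g x) (at x)
        = (\<lambda>h. f x * frechet_derivative g (at x) h + frechet_derivative f (at x) h * g x)" for x
    using frechet_derivative_at[OF has_derivative_mult[OF fd]] by metis
  moreover have "Ck_fun k f" "Ck_fun k g"
    using Suc.prems Ck_fun_Suc_imp_Ck_fun by blast+
  ultimately show ?case
    using Suc by (auto intro!: Ck_fun_add Suc.IH)
qed (auto intro: continuous_intros)

lemma smooth_fun_add: "smooth_fun f \<Longrightarrow> smooth_fun g \<Longrightarrow> smooth_fun (\<lambda>x. f x + g x)"
  unfolding smooth_fun_def using Ck_fun_add by blast

lemma smooth_fun_mult: "smooth_fun f \<Longrightarrow> smooth_fun g \<Longrightarrow> smooth_fun (\<lambda>x. f x * g x)"
  unfolding smooth_fun_def using Ck_fun_mult by blast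

lemma smooth_fun_prod:
  "(\<And>i. i \<in> I \<Longrightarrow> smooth_fun (f i)) \<Longrightarrow> smooth_fun (\<lambda>x. \<Prod>i\<in>I. f i x)"
  by (induction I rule: infinite_finite_induct) (auto intro: smooth_fun_const smooth_fun_mult)

lemma smooth_fun_diff:
  assumes "smooth_fun f" "smooth_fun g" shows "smooth_fun (\<lambda>x. f x - g x)"
  using smooth_fun_add[OF assms(1) smooth_fun_mult[OF smooth_fun_const[of "-1"] assms(2)]] by simp

lemma smooth_fun_real_polynomial_function: "real_polynomial_function f \<Longrightarrow> smooth_fun f"
  by (induction rule: real_polynomial_function.induct)
     (auto intro: smooth_fun_bounded_linear smooth_fun_const smooth_fun_add smooth_fun_mult)

subsection \<open>Cutoff functions\<close>

lemma poly_mult_exp_neg_tendsto_0: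
  fixes p :: "real poly"
  assumes "c > 0"
  shows "((\<lambda>y. poly p y * exp (- c * y)) \<longlongrightarrow> 0) at_top"
proof -
  have "((\<lambda>y. y ^ k * exp (- c * y)) \<longlongrightarrow> 0) at_top" for k :: nat
  proof -
    have "((\<lambda>y. (c * y) ^ k / exp (c * y)) \<longlongrightarrow> 0) at_top"
      by (rule filterlim_compose[OF tendsto_power_div_exp_0])
         (rule filterlim_tendsto_pos_mult_at_top[OF tendsto_const assms filterlim_ident])
    then have "((\<lambda>y. (1 / c ^ k) * ((c * y) ^ k / exp (c * y))) \<longlongrightarrow> (1 / c ^ k) * 0) at_top"
      by (intro tendsto_mult tendsto_const)
    then show ?thesis
      using assms by (simp add: power_mult_distrib exp_minus field_simps)
  qed
  then have "((\<lambda>y. \<Sum>i\<le>degree p. coeff p i * (y ^ i * exp (- c * y))) \<longlongrightarrow> (\<Sum>i\<le>degree p. coeff p i * 0)) at_top"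
    by (intro tendsto_sum tendsto_mult tendsto_const)
  then show ?thesis
    by (simp add: poly_altdef sum_distrib_right mult.assoc)
qed

definition exp_bump :: "real \<Rightarrow> real poly \<Rightarrow> real \<Rightarrow> real" where
  "exp_bump c p t = (if t > 0 then poly p (1 / t) * exp (- c / t) else 0)"

text \<open>The derivatives of \<open>exp (- c / t)\<close> are polynomials in \<open>1 / t\<close> times the same exponential, which
  decays faster than any power of \<open>1 / t\<close> grows, so that every one of them extends by \<open>0\<close>.\<close>

lemma exp_bump_has_derivative:
  assumes "c > 0"
  shows "(exp_bump c p has_real_derivative exp_bump c (smult c (monom 1 2 * p) - monom 1 2 * pderiv p) t) (at t)"
proof (cases t "0 :: real" rule: linorder_cases)
  case less
  have "((\<lambda>_. 0) has_real_derivative 0) (at t)" by simp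
  then have "(exp_bump c p has_real_derivative 0) (at t)"
    by (rule has_field_derivative_transform_within_open[of _ _ _ "{..<0}"])
       (use less in \<open>auto simp: exp_bump_def\<close>)
  then show ?thesis using less by (simp add: exp_bump_def)
next
  case greater
  have "((\<lambda>t. poly p (1 / t) * exp (- c / t)) has_real_derivative
      poly (smult c (monom 1 2 * p) - monom 1 2 * pderiv p) (1 / t) * exp (- c / t)) (at t)"
    using greater
    by (auto intro!: derivative_eq_intros simp: poly_monom power2_eq_square field_simps)
  then have "(exp_bump c p has_real_derivative
      poly (smult c (monom 1 2 * p) - monom 1 2 * pderiv p) (1 / t) * exp (- c / t)) (at t)"
    by (rule has_field_derivative_transform_within_open[of _ _ _ "{0<..}"])
       (use greater in \<open>auto simp: exp_bump_def\<close>)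
  then show ?thesis using greater by (simp add: exp_bump_def)
next
  case equal
  have "((\<lambda>y. poly (pCons 0 p) y * exp (- c * y)) \<longlongrightarrow> 0) at_top"
    by (rule poly_mult_exp_neg_tendsto_0[OF assms])
  then have "((\<lambda>h. poly (pCons 0 p) (inverse h) * exp (- c * inverse h)) \<longlongrightarrow> 0) (at_right 0)"
    by (rule filterlim_compose[OF _ filterlim_inverse_at_top_right])
  moreover have "\<forall>\<^sub>F h in at_right 0. poly (pCons 0 p) (inverse h) * exp (- c * inverse h)
      = (exp_bump c p h - exp_bump c p 0) / h"
    using eventually_at_right_less[of "0 :: real"]
    by eventually_elim (auto simp: exp_bump_def field_simps)
  ultimately have "((\<lambda>h. (exp_bump c p h - exp_bump c p 0) / h) \<longlongrightarrow> 0) (at_right 0)"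
    using tendsto_cong by fast
  moreover have "((\<lambda>h. (exp_bump c p h - exp_bump c p 0) / h) \<longlongrightarrow> 0) (at_left 0)"
    by (rule tendsto_eventually) (auto simp: exp_bump_def eventually_at_left_field intro: exI[of _ "-1"])
  ultimately have "((\<lambda>h. (exp_bump c p (0 + h) - exp_bump c p 0) / h) \<longlongrightarrow> 0) (at 0)"
    by (simp add: filterlim_split_at)
  then show ?thesis
    unfolding DERIV_def equal by (simp add: exp_bump_def)
qed

lemma smooth_fun_exp_bump:
  assumes "c > 0"
  shows "smooth_fun (\<lambda>x. exp_bump c p (x \<bullet> b + a))"
proof (rule smooth_fun_coinduct[where S = "range (\<lambda>p x. exp_bump c p (x \<bullet> b + a))"])
  fix f assume "f \<in> range (\<lambda>p x. exp_bump c p (x \<bullet> b + a))"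
  then obtain p where f: "f = (\<lambda>x. exp_bump c p (x \<bullet> b + a))" by blast
  define p' where "p' = smult c (monom 1 2 * p) - monom 1 2 * pderiv p"
  show "\<exists>f'. (\<forall>x. (f has_derivative f' x) (at x)) \<and> (\<forall>h. (\<lambda>x. f' x h) \<in> range (\<lambda>p x. exp_bump c p (x \<bullet> b + a)))"
  proof (intro exI conjI allI)
    fix x
    have "((\<lambda>x. exp_bump c p (x \<bullet> b + a)) has_derivative
       (\<lambda>h. exp_bump c p' (x \<bullet> b + a) * (h \<bullet> b))) (at x)"
      by (rule DERIV_compose_FDERIV[OF exp_bump_has_derivative[OF assms], folded p'_def, THEN has_derivative_eq_rhs])
         (auto intro!: derivative_eq_intros simp: p'_def mult.commute)
    then show "(f has_derivative (\<lambda>x h. exp_bump c p' (x \<bullet> b + a) * (h \<bullet> b)) x) (at x)"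
      using f by simp
  next
    fix h
    have "exp_bump c p' t * (h \<bullet> b) = exp_bump c (smult (h \<bullet> b) p') t" for t
      by (simp add: exp_bump_def)
    then show "(\<lambda>x. (\<lambda>x h. exp_bump c p' (x \<bullet> b + a) * (h \<bullet> b)) x h) \<in> range (\<lambda>p x. exp_bump c p (x \<bullet> b + a))"
      by simp
  qed
qed blast

definition box_bump :: "real \<Rightarrow> 'a::euclidean_space \<Rightarrow> 'a \<Rightarrow> 'a \<Rightarrow> real" where
  "box_bump c l u x = (\<Prod>b\<in>Basis. exp_bump c 1 (x \<bullet> b + - (l \<bullet> b)) * exp_bump c 1 (x \<bullet> (- b) + u \<bullet> b))"

lemma smooth_fun_box_bump: "c > 0 \<Longrightarrow> smooth_fun (box_bump c l u)"
  unfolding box_bump_def[abs_def]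
  by (intro smooth_fun_prod smooth_fun_mult smooth_fun_exp_bump)

lemma box_bump_bounds: assumes "c > 0" shows "0 \<le> box_bump c l u x" "box_bump c l u x \<le> 1"
proof -
  have *: "0 \<le> exp_bump c 1 t \<and> exp_bump c 1 t \<le> 1" for t
    using assms by (auto simp: exp_bump_def)
  show "0 \<le> box_bump c l u x" unfolding box_bump_def using * by (intro prod_nonneg) auto
  show "box_bump c l u x \<le> 1" unfolding box_bump_def using * by (intro prod_le_1) (auto intro: mult_le_one)
qed

lemma box_bump_outside:
  assumes "x \<notin> box l u" shows "box_bump c l u x = 0"
proof -
  obtain b where "b \<in> Basis" "\<not> (l \<bullet> b < x \<bullet> b \<and> x \<bullet> b < u \<bullet> b)"
    using assms unfolding mem_box by blast
  then show ?thesis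
    unfolding box_bump_def by (intro prod_zero bexI[of _ b]) (auto simp: exp_bump_def not_less)
qed

lemma box_bump_tendsto_1:
  assumes "x \<in> box l u"
  shows "(\<lambda>n. box_bump (1 / real (Suc n)) l u x) \<longlonglongrightarrow> 1"
proof -
  have "(\<lambda>n. exp_bump (1 / real (Suc n)) 1 t) \<longlonglongrightarrow> 1" if "t > 0" for t
  proof -
    have "(\<lambda>n. exp (- (1 / real (Suc n)) / t)) \<longlonglongrightarrow> exp (- 0 / t)"
      by (intro tendsto_intros LIMSEQ_Suc[OF lim_1_over_n]) (use that in auto)
    then show ?thesis using that by (simp add: exp_bump_def)
  qed
  note * = this
  have "(\<lambda>n. box_bump (1 / real (Suc n)) l u x) \<longlonglongrightarrow> (\<Prod>b\<in>(Basis::'a set). 1 * 1)"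
    unfolding box_bump_def by (intro tendsto_prod tendsto_mult *) (use assms in \<open>auto simp: mem_box\<close>)
  then show ?thesis by simp
qed

lemma Cc_inftyI:
  assumes "smooth_fun f" "compact K" "K \<subseteq> \<Omega>" "\<And>x. x \<notin> K \<Longrightarrow> f x = 0"
  shows "f \<in> Cc_infty \<Omega>"
proof -
  have "closure {x. f x \<noteq> 0} \<subseteq> K"
    using assms by (intro closure_minimal compact_imp_closed) auto
  then show ?thesis
    using assms unfolding Cc_infty_def
    by (auto simp: compact_eq_bounded_closed intro: bounded_subset)
qed

text \<open>With \<open>\<Omega>\<close> written as a countable union of boxes, \<open>1 - \<Prod>\<^sub>i\<^sub>\<le>\<^sub>n (1 - \<beta>\<^sub>i)\<close> with bumps \<open>\<beta>\<^sub>i\<close> on the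
  boxes that tend to their indicators exhausts \<open>\<Omega>\<close>.\<close>

lemma Cc_infty_cutoff_sequence:
  fixes \<Omega> :: "'a::euclidean_space set"
  assumes "open \<Omega>"
  obtains \<zeta> :: "nat \<Rightarrow> 'a \<Rightarrow> real" where "\<And>n. \<zeta> n \<in> Cc_infty \<Omega>" "\<And>n x. 0 \<le> \<zeta> n x \<and> \<zeta> n x \<le> 1"
    "\<And>x. x \<in> \<Omega> \<Longrightarrow> (\<lambda>n. \<zeta> n x) \<longlonglongrightarrow> 1"
proof -
  define \<F> where "\<F> = {box a b |a b :: 'a. cbox a b \<subseteq> \<Omega>}"
  have "\<Union>\<F> = \<Omega>"
  proof
    show "\<Union>\<F> \<subseteq> \<Omega>" unfolding \<F>_def using box_subset_cbox by blast
    show "\<Omega> \<subseteq> \<Union>\<F>"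
    proof
      fix x assume "x \<in> \<Omega>"
      then obtain a b where "cbox a b \<subseteq> \<Omega>" "x \<in> box a b"
        using open_contains_cbox[OF \<open>open \<Omega>\<close> \<open>x \<in> \<Omega>\<close>] by metis
      then show "x \<in> \<Union>\<F>" unfolding \<F>_def by blast
    qed
  qed
  obtain \<G> where \<G>: "\<G> \<subseteq> \<F>" "countable \<G>" "\<Union>\<G> = \<Omega>"
    using Lindelof[of \<F>] \<open>\<Union>\<F> = \<Omega>\<close> unfolding \<F>_def by (auto simp: open_box)
  have ne: "insert {} \<G> \<noteq> {}" "countable (insert {} \<G>)" using \<G> by auto
  define B where "B = from_nat_into (insert {} \<G>)"
  have rB: "range B = insert {} \<G>" unfolding B_def by (rule range_from_nat_into[OF ne])
  have "\<exists>l u. B i = box l u \<and> cbox l u \<subseteq> \<Omega>" for i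
  proof -
    have "B i \<in> insert {} \<G>" using rB by blast
    moreover have "\<exists>l u. {} = box l u \<and> cbox l u \<subseteq> \<Omega>"
      by (rule exI[of _ One], rule exI[of _ "0 :: 'a"]) (use nonempty_Basis in \<open>fastforce simp: mem_box\<close>)+
    ultimately show ?thesis using \<G>(1) unfolding \<F>_def by fast
  qed
  then obtain l u where lu: "\<And>i. B i = box (l i) (u i)" "\<And>i. cbox (l i) (u i) \<subseteq> \<Omega>" by metis
  define \<beta> where "\<beta> n i = box_bump (1 / real (Suc n)) (l i) (u i)" for n i :: nat
  have \<beta>: "0 \<le> \<beta> n i x" "\<beta> n i x \<le> 1" for n i x
    unfolding \<beta>_def by (auto intro!: box_bump_bounds)
  define \<zeta> where "\<zeta> n x = 1 - (\<Prod>i\<le>n. 1 - \<beta> n i x)" for n :: nat and x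
  have prod: "0 \<le> (\<Prod>i\<le>n. 1 - \<beta> n i x)" "(\<Prod>i\<le>n. 1 - \<beta> n i x) \<le> 1" for n x
    using \<beta> by (auto intro!: prod_nonneg prod_le_1)
  show ?thesis
  proof
    show "\<zeta> n \<in> Cc_infty \<Omega>" for n
    proof (rule Cc_inftyI[of _ "\<Union>i\<le>n. cbox (l i) (u i)"])
      show "smooth_fun (\<zeta> n)"
        unfolding \<zeta>_def \<beta>_def
        by (intro smooth_fun_diff smooth_fun_const smooth_fun_prod smooth_fun_box_bump) auto
      show "\<zeta> n x = 0" if "x \<notin> (\<Union>i\<le>n. cbox (l i) (u i))" for x
      proof -
        have "x \<notin> box (l i) (u i)" if "i \<le> n" for i
          using that \<open>x \<notin> (\<Union>i\<le>n. cbox (l i) (u i))\<close> box_subset_cbox by blast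
        then show ?thesis unfolding \<zeta>_def \<beta>_def by (auto simp: box_bump_outside)
      qed
    qed (use lu(2) in \<open>auto\<close>)
    show "0 \<le> \<zeta> n x \<and> \<zeta> n x \<le> 1" for n x using prod[where n = n] unfolding \<zeta>_def by auto
    show "(\<lambda>n. \<zeta> n x) \<longlonglongrightarrow> 1" if "x \<in> \<Omega>" for x
    proof -
      have "x \<in> \<Union>(range B)" unfolding rB using that \<G>(3) by auto
      then obtain j where j: "x \<in> box (l j) (u j)" using lu(1) by auto
      show ?thesis
      proof (rule tendsto_sandwich[OF _ _ _ tendsto_const])
        show "(\<lambda>n. \<beta> n j x) \<longlonglongrightarrow> 1" unfolding \<beta>_def by (rule box_bump_tendsto_1[OF j])
        show "\<forall>\<^sub>F n in sequentially. \<zeta> n x \<le> 1" using prod unfolding \<zeta>_def by auto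
        have "\<beta> n j x \<le> \<zeta> n x" if "j \<le> n" for n
        proof -
          have "(\<Prod>i\<le>n. 1 - \<beta> n i x) = (1 - \<beta> n j x) * (\<Prod>i\<in>{..n} - {j}. 1 - \<beta> n i x)"
            by (rule prod.remove) (use that in auto)
          also have "\<dots> \<le> (1 - \<beta> n j x) * 1"
            using \<beta> by (intro mult_left_mono prod_le_1) auto
          finally show ?thesis unfolding \<zeta>_def by simp
        qed
        then show "\<forall>\<^sub>F n in sequentially. \<beta> n j x \<le> \<zeta> n x"
          using eventually_at_top_linorder by blast
      qed
    qed
  qed
qed

text \<open>Stone--Weierstrass on the closure of \<open>\<Omega>\<close>, cut off inside \<open>\<Omega>\<close>, reaches the bounded continuous
  functions, and every measurable function is an almost everywhere limit of continuous ones.\<close>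

lemma bounded_measurable_induct_Cc_infty [consumes 4, case_names smooth limit]:
  fixes P :: "('a::euclidean_space \<Rightarrow> real) \<Rightarrow> bool"
  assumes "open \<Omega>" "bounded \<Omega>"
    and m: "m \<in> borel_measurable (lebesgue_on \<Omega>)" and mC: "AE x in lebesgue_on \<Omega>. \<bar>m x\<bar> \<le> C"
    and smooth: "\<And>g. g \<in> Cc_infty \<Omega> \<Longrightarrow> P g"
    and limit: "\<And>g g' C. (\<And>n. P (g n)) \<Longrightarrow> (\<And>n. g n \<in> borel_measurable (lebesgue_on \<Omega>)) \<Longrightarrow>
        (\<And>n. AE x in lebesgue_on \<Omega>. \<bar>g n x\<bar> \<le> C) \<Longrightarrow> g' \<in> borel_measurable (lebesgue_on \<Omega>) \<Longrightarrow>
        (AE x in lebesgue_on \<Omega>. (\<lambda>n. g n x) \<longlonglongrightarrow> g' x) \<Longrightarrow> P g'"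
  shows "P m"
proof -
  have [simp]: "\<Omega> \<in> sets lebesgue" using \<open>open \<Omega>\<close> by (simp add: lborelD)
  have cont_meas: "f \<in> borel_measurable (lebesgue_on \<Omega>)" if "continuous_on UNIV f" for f :: "'a \<Rightarrow> real"
    using that by (intro continuous_imp_measurable_on_sets_lebesgue) (auto intro: continuous_on_subset)
  have cpt: "compact (closure \<Omega>)" using \<open>bounded \<Omega>\<close> by simp
  have bdd: "\<exists>C. \<forall>x\<in>\<Omega>. \<bar>f x\<bar> \<le> C" if "continuous_on UNIV f" for f :: "'a \<Rightarrow> real"
  proof -
    have "bounded (f ` closure \<Omega>)"
      using cpt that by (intro compact_imp_bounded compact_continuous_image) (auto intro: continuous_on_subset)
    then show ?thesis unfolding bounded_iff using closure_subset by fastforce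
  qed
  have poly: "P f" if "smooth_fun f" for f
  proof -
    obtain \<zeta> :: "nat \<Rightarrow> 'a \<Rightarrow> real" where \<zeta>: "\<And>n. \<zeta> n \<in> Cc_infty \<Omega>" "\<And>n x. 0 \<le> \<zeta> n x \<and> \<zeta> n x \<le> 1"
      "\<And>x. x \<in> \<Omega> \<Longrightarrow> (\<lambda>n. \<zeta> n x) \<longlonglongrightarrow> 1"
      using Cc_infty_cutoff_sequence[OF \<open>open \<Omega>\<close>] by metis
    have f: "continuous_on UNIV f" using that by (rule smooth_fun_continuous_on)
    have *: "(\<lambda>x. \<zeta> n x * f x) \<in> Cc_infty \<Omega>" for n
      by (rule Cc_inftyI[of _ "closure {x. \<zeta> n x \<noteq> 0}"])
         (use \<zeta>(1)[of n] that closure_subset[of "{x. \<zeta> n x \<noteq> 0}"] in \<open>auto simp: Cc_infty_def intro!: smooth_fun_mult\<close>)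
    obtain C where C: "\<forall>x\<in>\<Omega>. \<bar>f x\<bar> \<le> C" using bdd[OF f] by blast
    show ?thesis
    proof (rule limit[of "\<lambda>n x. \<zeta> n x * f x" C])
      show "P (\<lambda>x. \<zeta> n x * f x)" for n by (rule smooth[OF *])
      show "(\<lambda>x. \<zeta> n x * f x) \<in> borel_measurable (lebesgue_on \<Omega>)" for n
        using * by (intro cont_meas smooth_fun_continuous_on) (auto simp: Cc_infty_def)
      show "AE x in lebesgue_on \<Omega>. \<bar>\<zeta> n x * f x\<bar> \<le> C" for n
      proof (rule AE_I2)
        fix x assume "x \<in> space (lebesgue_on \<Omega>)"
        then have "\<bar>\<zeta> n x\<bar> * \<bar>f x\<bar> \<le> 1 * C" using C \<zeta>(2) by (intro mult_mono) auto
        then show "\<bar>\<zeta> n x * f x\<bar> \<le> C" by (simp add: abs_mult)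
      qed
      show "AE x in lebesgue_on \<Omega>. (\<lambda>n. \<zeta> n x * f x) \<longlonglongrightarrow> f x"
        using \<zeta>(3) tendsto_mult[OF _ tendsto_const, where a = 1] by (intro AE_I2) fastforce
    qed (rule cont_meas[OF f])
  qed
  have cont: "P f" if f: "continuous_on UNIV f" for f
  proof -
    have "\<exists>g. real_polynomial_function g \<and> (\<forall>x\<in>closure \<Omega>. \<bar>f x - g x\<bar> < 1 / real (Suc n))" for n
      by (rule Stone_Weierstrass_real_polynomial_function[OF cpt, of f "1 / real (Suc n)"])
         (use that in \<open>auto intro: continuous_on_subset\<close>)
    then obtain g where g: "\<And>n. real_polynomial_function (g n)"
      "\<And>n x. x \<in> closure \<Omega> \<Longrightarrow> \<bar>f x - g n x\<bar> < 1 / real (Suc n)" by metis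
    obtain C where C: "\<forall>x\<in>\<Omega>. \<bar>f x\<bar> \<le> C" using bdd[OF f] by blast
    have gs: "smooth_fun (g n)" for n by (rule smooth_fun_real_polynomial_function[OF g(1)])
    have gx: "\<bar>f x - g n x\<bar> < 1 / real (Suc n)" if "x \<in> \<Omega>" for x n
      using g(2) that closure_subset by blast
    show ?thesis
    proof (rule limit[of g "C + 1"])
      show "P (g n)" for n by (rule poly[OF gs])
      show "g n \<in> borel_measurable (lebesgue_on \<Omega>)" for n
        by (intro cont_meas smooth_fun_continuous_on gs)
      show "AE x in lebesgue_on \<Omega>. \<bar>g n x\<bar> \<le> C + 1" for n
      proof (rule AE_I2)
        fix x assume x: "x \<in> space (lebesgue_on \<Omega>)"
        have "1 / real (Suc n) \<le> 1" by simp
        moreover have "\<bar>f x\<bar> \<le> C" "\<bar>f x - g n x\<bar> < 1 / real (Suc n)" using C gx x by auto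
        ultimately show "\<bar>g n x\<bar> \<le> C + 1" by linarith
      qed
      show "AE x in lebesgue_on \<Omega>. (\<lambda>n. g n x) \<longlonglongrightarrow> f x"
      proof (rule AE_I2)
        fix x assume x: "x \<in> space (lebesgue_on \<Omega>)"
        have "(\<lambda>n. f x - g n x) \<longlonglongrightarrow> 0"
          by (rule Lim_null_comparison[OF _ LIMSEQ_Suc[OF lim_1_over_n]])
             (use gx[of x] x in \<open>auto intro!: always_eventually less_imp_le\<close>)
        then have "(\<lambda>n. f x - (f x - g n x)) \<longlonglongrightarrow> f x - 0" by (intro tendsto_intros)
        then show "(\<lambda>n. g n x) \<longlonglongrightarrow> f x" by simp
      qed
    qed (rule cont_meas[OF that])
  qed
  have "m measurable_on \<Omega>" using m by (simp add: measurable_on_iff_borel_measurable)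
  then obtain N g where N: "negligible N" and g: "\<And>n. continuous_on UNIV (g n :: 'a \<Rightarrow> real)"
    "\<And>x. x \<notin> N \<Longrightarrow> (\<lambda>n. g n x) \<longlonglongrightarrow> (if x \<in> \<Omega> then m x else 0)"
    unfolding measurable_on_def by blast
  define h where "h n x = max (- C) (min C (g n x))" for n x
  have AEN: "AE x in lebesgue_on \<Omega>. x \<notin> N"
    using N by (auto simp: negligible_iff_null_sets AE_restrict_space_iff dest: AE_not_in)
  show ?thesis
  proof (rule limit[of h "\<bar>C\<bar>"])
    have h: "continuous_on UNIV (h n)" for n unfolding h_def by (intro continuous_intros g)
    then show "P (h n)" "h n \<in> borel_measurable (lebesgue_on \<Omega>)" for n
      by (rule cont, rule cont_meas)
    show "AE x in lebesgue_on \<Omega>. \<bar>h n x\<bar> \<le> \<bar>C\<bar>" for n by (rule AE_I2) (auto simp: h_def)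
    show "AE x in lebesgue_on \<Omega>. (\<lambda>n. h n x) \<longlonglongrightarrow> m x"
      using AEN mC AE_space
    proof eventually_elim
      case (elim x)
      then have "(\<lambda>n. h n x) \<longlonglongrightarrow> max (- C) (min C (m x))"
        unfolding h_def using g(2)[of x] by (intro tendsto_intros) auto
      then show ?case using elim by (simp add: abs_le_iff max_def min_def split: if_splits)
    qed
  qed (rule m)
qed

section \<open>The energy space\<close>

text \<open>With this quotient the quadratic form is the inner product of \<open>L\<^sup>2\<close> on the product space.\<close>

definition diff_quot :: "real \<Rightarrow> ('a::euclidean_space \<Rightarrow> real) \<Rightarrow> 'a \<times> 'a \<Rightarrow> real" where
  "diff_quot s u z = (u (fst z) - u (snd z)) / norm (fst z - snd z) powr ((real DIM('a) + 2 * s) / 2)"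

lemma diff_quot_mult:
  fixes u v :: "'a::euclidean_space \<Rightarrow> real"
  shows "diff_quot s u z * diff_quot s v z =
    (u (fst z) - u (snd z)) * (v (fst z) - v (snd z)) / norm (fst z - snd z) powr (real DIM('a) + 2 * s)"
proof -
  have "norm (fst z - snd z) powr (real DIM('a) + 2 * s)
      = norm (fst z - snd z) powr ((real DIM('a) + 2 * s) / 2) * norm (fst z - snd z) powr ((real DIM('a) + 2 * s) / 2)"
    by (subst powr_add[symmetric]) (simp only: field_sum_of_halves)
  then show ?thesis by (simp add: diff_quot_def)
qed

lemma frac_form_eq: "frac_form s u v = (LINT z|lebesgue. diff_quot s u z * diff_quot s v z)"
  unfolding frac_form_def by (simp add: diff_quot_mult case_prod_unfold)

lemma frac_form_sym: "frac_form s u v = frac_form s v u"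
  by (simp add: frac_form_eq mult.commute)

lemma diff_quot_lincomb:
  "diff_quot s (\<lambda>x. a * u x + b * v x) z = a * diff_quot s u z + b * diff_quot s v z"
  by (simp add: diff_quot_def add_divide_distrib[symmetric] ring_distribs)

lemma AE_lebesgue_fst:
  assumes "AE x in lebesgue. P x"
  shows "AE z in (lebesgue :: ('a::euclidean_space \<times> 'b::euclidean_space) measure). P (fst z)"
proof -
  obtain N where N: "\<And>x. x \<notin> N \<Longrightarrow> P x" "N \<in> null_sets (lborel :: 'a measure)"
    using AE_E3[OF assms[unfolded AE_completion_iff]] by auto
  have "emeasure (lborel \<Otimes>\<^sub>M (lborel :: 'b measure)) (N \<times> UNIV) = 0"
    using N(2) by (subst lborel.emeasure_pair_measure_Times) auto
  then have "N \<times> UNIV \<in> null_sets (lborel :: ('a \<times> 'b) measure)"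
    using N(2) by (auto simp: lborel_prod[symmetric] null_sets_def simp del: sets_lborel)
  then show ?thesis
    unfolding AE_completion_iff by (rule AE_I') (use N(1) in \<open>force simp: mem_Times_iff\<close>)
qed

lemma AE_lebesgue_snd:
  assumes "AE x in lebesgue. P x"
  shows "AE z in (lebesgue :: ('b::euclidean_space \<times> 'a::euclidean_space) measure). P (snd z)"
proof -
  obtain N where N: "\<And>x. x \<notin> N \<Longrightarrow> P x" "N \<in> null_sets (lborel :: 'a measure)"
    using AE_E3[OF assms[unfolded AE_completion_iff]] by auto
  have "emeasure (lborel \<Otimes>\<^sub>M lborel) ((UNIV :: 'b set) \<times> N) = 0"
    using N(2) by (subst lborel.emeasure_pair_measure_Times) auto
  then have "UNIV \<times> N \<in> null_sets (lborel :: ('b \<times> 'a) measure)"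
    using N(2) by (auto simp: lborel_prod[symmetric] null_sets_def simp del: sets_lborel)
  then show ?thesis
    unfolding AE_completion_iff by (rule AE_I') (use N(1) in \<open>force simp: mem_Times_iff\<close>)
qed

lemma borel_representative:
  fixes u :: "'a::euclidean_space \<Rightarrow> real"
  assumes "u \<in> borel_measurable lebesgue"
  obtains u' where "u' \<in> borel_measurable borel" "AE x in lebesgue. u x = u' x"
  using completion_ex_borel_measurable_real[OF assms] by (auto simp: AE_completion_iff)

lemma borel_measurable_diff_quot_borel:
  fixes u :: "'a::euclidean_space \<Rightarrow> real"
  assumes [measurable]: "u \<in> borel_measurable borel"
  shows "diff_quot s u \<in> borel_measurable borel"
  unfolding diff_quot_def[abs_def] borel_prod[symmetric] by measurable

lemma diff_quot_cong_AE:
  fixes u u' :: "'a::euclidean_space \<Rightarrow> real"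
  assumes "AE x in lebesgue. u x = u' x"
  shows "AE z in lebesgue. diff_quot s u z = diff_quot s u' z"
  using AE_lebesgue_fst[OF assms, where 'b = 'a] AE_lebesgue_snd[OF assms, where 'b = 'a]
  by eventually_elim (simp add: diff_quot_def)

lemma borel_measurable_diff_quot [measurable]:
  fixes u :: "'a::euclidean_space \<Rightarrow> real"
  assumes "u \<in> borel_measurable lebesgue"
  shows "diff_quot s u \<in> borel_measurable lebesgue"
proof -
  obtain u' where u': "u' \<in> borel_measurable borel" "AE x in lebesgue. u x = u' x"
    using borel_representative[OF assms] .
  have "diff_quot s u' \<in> borel_measurable lebesgue"
    using borel_measurable_diff_quot_borel[OF u'(1)] by (auto intro: measurable_completion)
  moreover have "AE z in lebesgue. diff_quot s u' z = diff_quot s u z"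
    using diff_quot_cong_AE[OF u'(2), of s] by eventually_elim simp
  ultimately show ?thesis by (rule borel_measurable_AE)
qed

lemma X0_iff:
  fixes u :: "'a::euclidean_space \<Rightarrow> real"
  shows "u \<in> X0 s \<Omega> \<longleftrightarrow> u \<in> borel_measurable lebesgue \<and> integrable lebesgue (\<lambda>x. (u x)\<^sup>2) \<and>
    (AE x in lebesgue. x \<notin> \<Omega> \<longrightarrow> u x = 0) \<and> integrable lebesgue (\<lambda>z. (diff_quot s u z)\<^sup>2)"
proof -
  have "(\<lambda>(x, y). \<bar>u x - u y\<bar>\<^sup>2 / norm (x - y) powr (real DIM('a) + 2 * s)) = (\<lambda>z. (diff_quot s u z)\<^sup>2)"
    by (auto simp: power2_eq_square diff_quot_mult abs_mult_self_eq)
  moreover have "\<bar>t\<bar> powr 2 = t\<^sup>2" for t :: real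
    using powr_numeral[of "\<bar>t\<bar>" "num.Bit0 num.One"] by (cases "t = 0") auto
  ultimately show ?thesis
    unfolding X0_def Lp_def by (auto simp: lebesgue_on_UNIV_eq)
qed

lemma integrable_mult_of_square_integrable:
  fixes f g :: "'a \<Rightarrow> real"
  assumes [measurable]: "f \<in> borel_measurable M" "g \<in> borel_measurable M"
    and "integrable M (\<lambda>x. (f x)\<^sup>2)" "integrable M (\<lambda>x. (g x)\<^sup>2)"
  shows "integrable M (\<lambda>x. f x * g x)"
proof (rule Bochner_Integration.integrable_bound)
  show "integrable M (\<lambda>x. (f x)\<^sup>2 + (g x)\<^sup>2)" using assms by simp
  have "\<bar>a * b\<bar> \<le> a\<^sup>2 + b\<^sup>2" for a b :: real
  proof -
    have "2 * (\<bar>a\<bar> * \<bar>b\<bar>) \<le> a\<^sup>2 + b\<^sup>2" using sum_squares_bound[of "\<bar>a\<bar>" "\<bar>b\<bar>"] by simp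
    moreover have "0 \<le> \<bar>a\<bar> * \<bar>b\<bar>" by simp
    ultimately show ?thesis unfolding abs_mult by linarith
  qed
  then show "AE x in M. norm (f x * g x) \<le> norm ((f x)\<^sup>2 + (g x)\<^sup>2)" by (intro AE_I2) (simp add: abs_of_nonneg)
qed simp

lemma square_integrable_lincomb:
  fixes f g :: "'a \<Rightarrow> real"
  assumes "f \<in> borel_measurable M" "g \<in> borel_measurable M"
    and "integrable M (\<lambda>x. (f x)\<^sup>2)" "integrable M (\<lambda>x. (g x)\<^sup>2)"
  shows "integrable M (\<lambda>x. (a * f x + b * g x)\<^sup>2)"
proof -
  have "(\<lambda>x. (a * f x + b * g x)\<^sup>2) = (\<lambda>x. a\<^sup>2 * (f x)\<^sup>2 + b\<^sup>2 * (g x)\<^sup>2 + 2 * a * b * (f x * g x))"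
    by (simp add: power2_eq_square algebra_simps)
  moreover have "integrable M (\<lambda>x. a\<^sup>2 * (f x)\<^sup>2 + b\<^sup>2 * (g x)\<^sup>2 + 2 * a * b * (f x * g x))"
    by (intro Bochner_Integration.integrable_add integrable_mult_right assms
        integrable_mult_of_square_integrable[OF assms])
  ultimately show ?thesis by (simp only:)
qed

lemma X0_measurable: "u \<in> X0 s \<Omega> \<Longrightarrow> u \<in> borel_measurable lebesgue"
  by (simp add: X0_iff)

lemma X0_lincomb:
  assumes "u \<in> X0 s \<Omega>" "v \<in> X0 s \<Omega>"
  shows "(\<lambda>x. a * u x + b * v x) \<in> X0 s \<Omega>"
proof -
  have [measurable]: "u \<in> borel_measurable lebesgue" "v \<in> borel_measurable lebesgue"
    using assms by (simp_all add: X0_iff)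
  have "AE x in lebesgue. x \<notin> \<Omega> \<longrightarrow> u x = 0" "AE x in lebesgue. x \<notin> \<Omega> \<longrightarrow> v x = 0"
    using assms by (simp_all add: X0_iff)
  then have "AE x in lebesgue. x \<notin> \<Omega> \<longrightarrow> a * u x + b * v x = 0"
    by eventually_elim simp
  moreover have "integrable lebesgue (\<lambda>x. (a * u x + b * v x)\<^sup>2)"
    by (rule square_integrable_lincomb) (use assms in \<open>simp_all add: X0_iff\<close>)
  moreover have "integrable lebesgue (\<lambda>z. (a * diff_quot s u z + b * diff_quot s v z)\<^sup>2)"
    by (rule square_integrable_lincomb) (use assms in \<open>simp_all add: X0_iff borel_measurable_diff_quot\<close>)
  ultimately show ?thesis
    unfolding X0_iff diff_quot_lincomb by simp
qed

lemma X0_diff: "u \<in> X0 s \<Omega> \<Longrightarrow> v \<in> X0 s \<Omega> \<Longrightarrow> (\<lambda>x. u x - v x) \<in> X0 s \<Omega>"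
  using X0_lincomb[of u s \<Omega> v 1 "-1"] by simp

lemma X0_cmult: "u \<in> X0 s \<Omega> \<Longrightarrow> (\<lambda>x. a * u x) \<in> X0 s \<Omega>"
  using X0_lincomb[of u s \<Omega> u a 0] by simp

lemma integrable_diff_quot_mult:
  "u \<in> X0 s \<Omega> \<Longrightarrow> v \<in> X0 s \<Omega> \<Longrightarrow> integrable lebesgue (\<lambda>z. diff_quot s u z * diff_quot s v z)"
  by (rule integrable_mult_of_square_integrable) (auto simp: X0_iff borel_measurable_diff_quot)

lemma frac_form_lincomb:
  assumes "u \<in> X0 s \<Omega>" "v \<in> X0 s \<Omega>" "w \<in> X0 s \<Omega>"
  shows "frac_form s (\<lambda>x. a * u x + b * v x) w = a * frac_form s u w + b * frac_form s v w"
proof -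
  have "frac_form s (\<lambda>x. a * u x + b * v x) w
      = (LINT z|lebesgue. a * (diff_quot s u z * diff_quot s w z) + b * (diff_quot s v z * diff_quot s w z))"
    unfolding frac_form_eq diff_quot_lincomb by (simp only: ring_distribs mult.assoc)
  also have "\<dots> = a * frac_form s u w + b * frac_form s v w"
    unfolding frac_form_eq
    using integrable_diff_quot_mult[OF assms(1,3)] integrable_diff_quot_mult[OF assms(2,3)] by simp
  finally show ?thesis .
qed

lemma frac_form_nonneg: "frac_form s u u \<ge> 0"
  unfolding frac_form_eq by (rule Bochner_Integration.integral_nonneg) simp

text \<open>A contraction of the values shrinks the difference quotients, and a monotone one keeps their
  signs.\<close>

lemma X0_contraction:
  assumes u: "u \<in> X0 s \<Omega>" and T: "T \<in> borel_measurable borel" "T 0 = 0" "\<And>a b. \<bar>T a - T b\<bar> \<le> \<bar>a - b\<bar>"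
  shows "(\<lambda>x. T (u x)) \<in> X0 s \<Omega>"
proof -
  have [measurable]: "u \<in> borel_measurable lebesgue" using u by (simp add: X0_iff)
  have m[measurable]: "(\<lambda>x. T (u x)) \<in> borel_measurable lebesgue"
    using T(1) by measurable
  have 1: "integrable lebesgue (\<lambda>x. (T (u x))\<^sup>2)"
  proof (rule Bochner_Integration.integrable_bound)
    show "integrable lebesgue (\<lambda>x. (u x)\<^sup>2)" using u by (simp add: X0_iff)
    show "AE x in lebesgue. norm ((T (u x))\<^sup>2) \<le> norm ((u x)\<^sup>2)"
      using T(3)[of _ 0] T(2) by (intro AE_I2) (simp add: abs_le_square_iff)
  qed measurable
  have "integrable lebesgue (\<lambda>z. (diff_quot s (\<lambda>x. T (u x)) z)\<^sup>2)"
  proof (rule Bochner_Integration.integrable_bound)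
    show "integrable lebesgue (\<lambda>z. (diff_quot s u z)\<^sup>2)" using u by (simp add: X0_iff)
    have "\<bar>diff_quot s (\<lambda>x. T (u x)) z\<bar> \<le> \<bar>diff_quot s u z\<bar>" for z
      unfolding diff_quot_def abs_divide by (intro divide_right_mono T(3)) auto
    then show "AE z in lebesgue. norm ((diff_quot s (\<lambda>x. T (u x)) z)\<^sup>2) \<le> norm ((diff_quot s u z)\<^sup>2)"
      by (intro AE_I2) (simp add: abs_le_square_iff)
  qed measurable
  moreover have "AE x in lebesgue. x \<notin> \<Omega> \<longrightarrow> T (u x) = 0"
    using u unfolding X0_iff by (auto elim!: eventually_mono simp: T(2))
  ultimately show ?thesis using m 1 by (simp add: X0_iff)
qed

lemma frac_form_contraction:
  assumes u: "u \<in> X0 s \<Omega>" and T: "T \<in> borel_measurable borel" "T 0 = 0" "\<And>a b. \<bar>T a - T b\<bar> \<le> \<bar>a - b\<bar>"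
    and "mono T"
  shows "frac_form s (\<lambda>x. T (u x)) (\<lambda>x. T (u x)) \<le> frac_form s u (\<lambda>x. T (u x))"
proof -
  note Tu = X0_contraction[OF u T]
  have *: "(T a - T b) * (T a - T b) \<le> (a - b) * (T a - T b)" for a b
  proof (cases "a \<le> b")
    case True
    then have "T a \<le> T b" "T b - T a \<le> b - a" using \<open>mono T\<close> T(3)[of a b] by (auto simp: mono_def)
    then show ?thesis by (intro mult_right_mono_neg) auto
  next
    case False
    then have "T b \<le> T a" "T a - T b \<le> a - b" using \<open>mono T\<close> T(3)[of a b] by (auto simp: mono_def)
    then show ?thesis by (intro mult_right_mono) auto
  qed
  show ?thesis
    unfolding frac_form_eq
  proof (rule integral_mono)
    show "diff_quot s (\<lambda>x. T (u x)) z * diff_quot s (\<lambda>x. T (u x)) z \<le> diff_quot s u z * diff_quot s (\<lambda>x. T (u x)) z" for z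
      unfolding diff_quot_mult by (intro divide_right_mono *) auto
  qed (rule integrable_diff_quot_mult[OF Tu Tu] integrable_diff_quot_mult[OF u Tu])+
qed

subsection \<open>The Faber--Krahn inequality\<close>

text \<open>Of the ball around \<open>x\<close> with twice the volume \<open>m\<close> of the set where \<open>u\<close> lives at least half lies
  outside that set, and there \<open>u x - u y = u x\<close>; so the energy dominates \<open>\<integral> u\<^sup>2\<close> times \<open>m\<close> times the
  value of the kernel at the radius of that ball.\<close>

lemma Faber_Krahn_inequality:
  fixes u :: "'a::euclidean_space \<Rightarrow> real"
  assumes u: "u \<in> X0 s \<Omega>" and "0 < s"
    and A: "A \<in> lmeasurable" "measure lebesgue A \<le> m" "0 < m" "AE x in lebesgue. x \<notin> A \<longrightarrow> u x = 0"
  shows "(unit_ball_vol (real DIM('a)) / 2) powr (1 + 2 * s / real DIM('a)) * m powr (- (2 * s / real DIM('a)))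
      * (LINT x|lebesgue. (u x)\<^sup>2) \<le> frac_form s u u"
proof -
  define N where "N = real DIM('a)"
  define \<omega> where "\<omega> = unit_ball_vol N"
  have N: "N > 0" unfolding N_def by simp
  have \<omega>: "\<omega> > 0" unfolding \<omega>_def using N by simp
  define R where "R = (2 * m / \<omega>) powr (1 / N)"
  have R: "R > 0" unfolding R_def using \<open>0 < m\<close> \<omega> by simp
  have RN: "R ^ DIM('a) = 2 * m / \<omega>"
    using R \<open>0 < m\<close> \<omega> by (simp add: powr_realpow[symmetric] R_def powr_powr N_def)
  define k where "k = R powr (- (N + 2 * s))"
  have km: "k * m = (\<omega> / 2) powr (1 + 2 * s / N) * m powr (- (2 * s / N))"
  proof -
    have "k = (2 * m / \<omega>) powr (- (1 + 2 * s / N))"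
      unfolding k_def R_def powr_powr using N by (intro arg_cong2[where f = "(powr)"]) (simp_all add: field_simps)
    also have "\<dots> = (m * inverse (\<omega> / 2)) powr (- (1 + 2 * s / N))" by (simp add: field_simps)
    also have "\<dots> = m powr (- (1 + 2 * s / N)) * inverse (\<omega> / 2) powr (- (1 + 2 * s / N))"
      by (rule powr_mult)
    also have "inverse (\<omega> / 2) powr (- (1 + 2 * s / N)) = (\<omega> / 2) powr (1 + 2 * s / N)"
      by (simp only: powr_minus inverse_powr inverse_inverse_eq)
    finally have "k * m = (\<omega> / 2) powr (1 + 2 * s / N) * (m powr (- (1 + 2 * s / N)) * m powr 1)"
      using \<open>0 < m\<close> by simp
    also have "m powr (- (1 + 2 * s / N)) * m powr 1 = m powr (- (2 * s / N))"
      by (subst powr_add[symmetric]) simp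
    finally show ?thesis .
  qed
  obtain v where v[measurable]: "v \<in> borel_measurable borel" and uv: "AE x in lebesgue. u x = v x"
    using borel_representative[OF X0_measurable[OF u]] .
  define B where "B = {x. v x \<noteq> 0}"
  have B[measurable]: "B \<in> sets borel" unfolding B_def by measurable
  have Bm: "emeasure lborel B \<le> ennreal m"
  proof -
    have "emeasure lborel B = emeasure lebesgue B" using B by simp
    also have "\<dots> \<le> emeasure lebesgue A"
    proof (rule emeasure_mono_AE)
      show "AE x in lebesgue. x \<in> B \<longrightarrow> x \<in> A" using A(4) uv by eventually_elim (auto simp: B_def)
    qed (use A in auto)
    also have "\<dots> \<le> ennreal m" using A by (simp add: emeasure_eq_measure2 ennreal_leI)
    finally show ?thesis .
  qed
  have ball_B: "ennreal m \<le> emeasure lborel (ball x R - B)" for x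
  proof -
    have "ennreal (2 * m) = emeasure lborel (ball x R)"
      using R RN \<omega> by (simp add: emeasure_ball N_def[symmetric] \<omega>_def[symmetric])
    also have "\<dots> \<le> emeasure lborel ((ball x R - B) \<union> B)" by (intro emeasure_mono) auto
    also have "\<dots> \<le> emeasure lborel (ball x R - B) + emeasure lborel B"
      by (intro emeasure_subadditive) auto
    also have "\<dots> \<le> emeasure lborel (ball x R - B) + ennreal m" using Bm by (intro add_left_mono)
    finally have "ennreal m + ennreal m \<le> ennreal m + emeasure lborel (ball x R - B)"
      using \<open>0 < m\<close> by (simp add: add.commute flip: ennreal_plus)
    then show ?thesis by (simp add: ennreal_add_left_cancel_le)
  qed
  have pt: "(v x)\<^sup>2 * (k * indicator (ball x R - B) y) \<le> (diff_quot s v (x, y))\<^sup>2" for x y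
  proof (cases "v x \<noteq> 0 \<and> y \<in> ball x R - B")
    case True
    then have y: "v y = 0" "x \<noteq> y" "norm (x - y) < R" by (auto simp: B_def dist_norm)
    have "k \<le> norm (x - y) powr (- (N + 2 * s))"
      unfolding k_def using y N \<open>0 < s\<close> by (intro powr_mono2') auto
    then have "k \<le> inverse (norm (x - y) powr (N + 2 * s))" unfolding powr_minus .
    then have "(v x)\<^sup>2 * k \<le> (v x)\<^sup>2 * inverse (norm (x - y) powr (N + 2 * s))" by (intro mult_left_mono) auto
    then show ?thesis
      using True y by (simp add: power2_eq_square diff_quot_mult N_def divide_inverse)
  qed auto
  have "ennreal (k * m * (LINT x|lebesgue. (u x)\<^sup>2)) = ennreal (k * m) * ennreal (LINT x|lebesgue. (u x)\<^sup>2)"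
    using \<open>0 < m\<close> unfolding k_def by (intro ennreal_mult) auto
  also have "ennreal (LINT x|lebesgue. (u x)\<^sup>2) = (\<integral>\<^sup>+x. ennreal ((u x)\<^sup>2) \<partial>lebesgue)"
    using u by (intro nn_integral_eq_integral[symmetric]) (auto simp: X0_iff)
  also have "\<dots> = (\<integral>\<^sup>+x. ennreal ((v x)\<^sup>2) \<partial>lebesgue)"
    using uv by (intro nn_integral_cong_AE) (auto elim!: eventually_mono)
  also have "\<dots> = (\<integral>\<^sup>+x. ennreal ((v x)\<^sup>2) \<partial>lborel)" by (rule nn_integral_completion)
  also have "ennreal (k * m) * (\<integral>\<^sup>+x. ennreal ((v x)\<^sup>2) \<partial>lborel)
      = (\<integral>\<^sup>+x. ennreal ((v x)\<^sup>2) * (ennreal k * ennreal m) \<partial>lborel)"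
    by (subst nn_integral_cmult[symmetric]) (auto simp: k_def \<open>0 < m\<close> less_imp_le ennreal_mult mult.commute)
  also have "\<dots> \<le> (\<integral>\<^sup>+x. ennreal ((v x)\<^sup>2) * (ennreal k * emeasure lborel (ball x R - B)) \<partial>lborel)"
    by (intro nn_integral_mono mult_left_mono ball_B) auto
  also have "\<dots> = (\<integral>\<^sup>+x. (\<integral>\<^sup>+y. ennreal ((v x)\<^sup>2) * (ennreal k * indicator (ball x R - B) y) \<partial>lborel) \<partial>lborel)"
  proof (rule nn_integral_cong)
    fix x
    have D: "ball x R - B \<in> sets lborel" by simp
    have "(\<integral>\<^sup>+y. ennreal ((v x)\<^sup>2) * (ennreal k * indicator (ball x R - B) y) \<partial>lborel)
        = ennreal ((v x)\<^sup>2) * (\<integral>\<^sup>+y. ennreal k * indicator (ball x R - B) y \<partial>lborel)"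
      by (rule nn_integral_cmult) (intro borel_measurable_times_ennreal borel_measurable_const borel_measurable_indicator D)
    also have "\<dots> = ennreal ((v x)\<^sup>2) * (ennreal k * emeasure lborel (ball x R - B))"
      by (subst nn_integral_cmult_indicator[OF D]) (rule refl)
    finally
    show "ennreal ((v x)\<^sup>2) * (ennreal k * emeasure lborel (ball x R - B))
        = (\<integral>\<^sup>+y. ennreal ((v x)\<^sup>2) * (ennreal k * indicator (ball x R - B) y) \<partial>lborel)" by (rule sym)
  qed
  also have "\<dots> \<le> (\<integral>\<^sup>+x. (\<integral>\<^sup>+y. ennreal ((diff_quot s v (x, y))\<^sup>2) \<partial>lborel) \<partial>lborel)"
  proof (intro nn_integral_mono)
    fix x y
    have "ennreal ((v x)\<^sup>2) * (ennreal k * indicator (ball x R - B) y) = ennreal ((v x)\<^sup>2 * (k * indicator (ball x R - B) y))"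
      by (auto simp: k_def ennreal_mult split: split_indicator)
    also have "\<dots> \<le> ennreal ((diff_quot s v (x, y))\<^sup>2)" by (intro ennreal_leI pt)
    finally show "ennreal ((v x)\<^sup>2) * (ennreal k * indicator (ball x R - B) y) \<le> ennreal ((diff_quot s v (x, y))\<^sup>2)" .
  qed
  also have "\<dots> = (\<integral>\<^sup>+z. ennreal ((diff_quot s v z)\<^sup>2) \<partial>(lborel \<Otimes>\<^sub>M lborel))"
    using borel_measurable_diff_quot_borel[OF v, of s]
    by (intro lborel.nn_integral_fst[of "\<lambda>z. ennreal ((diff_quot s v z)\<^sup>2)"]) (simp add: lborel_prod)
  also have "\<dots> = (\<integral>\<^sup>+z. ennreal ((diff_quot s v z)\<^sup>2) \<partial>lebesgue)"
    by (simp only: lborel_prod nn_integral_completion)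
  also have "\<dots> = (\<integral>\<^sup>+z. ennreal ((diff_quot s u z)\<^sup>2) \<partial>lebesgue)"
    using diff_quot_cong_AE[OF uv, of s] by (intro nn_integral_cong_AE) (auto elim!: eventually_mono)
  also have "\<dots> = ennreal (frac_form s u u)"
    using u unfolding frac_form_eq power2_eq_square[symmetric]
    by (intro nn_integral_eq_integral) (auto simp: X0_iff)
  finally have "k * m * (LINT x|lebesgue. (u x)\<^sup>2) \<le> frac_form s u u"
    by (subst (asm) ennreal_le_iff[OF frac_form_nonneg])
  then show ?thesis unfolding km \<omega>_def N_def .
qed

subsection \<open>Finite energy of smooth compactly supported functions\<close>

lemma dyadic_bracket_less_1:
  fixes t :: real assumes "0 < t" "t < 1"
  obtains j where "(1/2) ^ Suc j \<le> t" "t < (1/2) ^ j"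
proof -
  define P where "P n \<longleftrightarrow> (1/2 :: real) ^ n \<le> t" for n
  have ex: "\<exists>n. P n" using real_arch_pow_inv[OF assms(1), of "1/2"] unfolding P_def by (auto intro: less_imp_le)
  have "\<not> P 0" using assms unfolding P_def by simp
  then obtain j where "Least P = Suc j" using LeastI_ex[OF ex] by (cases "Least P") auto
  then have "P (Suc j)" "\<not> P j" using LeastI_ex[OF ex] not_less_Least[of j P] by auto
  then show thesis using that unfolding P_def by auto
qed

lemma dyadic_bracket_ge_1:
  fixes t :: real assumes "1 \<le> t"
  obtains j where "2 ^ j \<le> t" "t < 2 ^ Suc j"
proof -
  define P where "P n \<longleftrightarrow> t < 2 ^ n" for n
  have ex: "\<exists>n. P n" using real_arch_pow[of 2 t] unfolding P_def by auto
  have "\<not> P 0" using assms unfolding P_def by simp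
  then obtain j where "Least P = Suc j" using LeastI_ex[OF ex] by (cases "Least P") auto
  then have "P (Suc j)" "\<not> P j" using LeastI_ex[OF ex] not_less_Least[of j P] by auto
  then show thesis using that[of j] unfolding P_def by simp
qed

lemma ennreal_le_suminf: "f n \<le> (\<Sum>i. f i)" for f :: "nat \<Rightarrow> ennreal"
  using sum_le_suminf[of f "{n}"] by simp

definition levy_kernel :: "real \<Rightarrow> 'a::euclidean_space \<Rightarrow> real" where
  "levy_kernel s z = min ((norm z)\<^sup>2) 1 / norm z powr (real DIM('a) + 2 * s)"

lemma borel_measurable_levy_kernel [measurable]: "levy_kernel s \<in> borel_measurable borel"
  unfolding levy_kernel_def[abs_def] by measurable

lemma levy_kernel_nonneg: "levy_kernel s z \<ge> 0"
  by (simp add: levy_kernel_def)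

text \<open>On the dyadic annuli the integral is a geometric series, of ratio \<open>2\<^sup>2\<^sup>s\<^sup>-\<^sup>2\<close> near the origin and
  \<open>2\<^sup>-\<^sup>2\<^sup>s\<close> at infinity.\<close>

lemma nn_integral_levy_kernel_finite:
  assumes "0 < s" "s < 1"
  shows "(\<integral>\<^sup>+z. ennreal (levy_kernel s (z :: 'a::euclidean_space)) \<partial>lborel) < \<infinity>"
proof -
  define N where "N = real DIM('a)"
  define e where "e = N + 2 * s"
  have e: "e > 0" unfolding e_def N_def using assms by (simp add: add_nonneg_pos)
  define a where "a j = ((1/2) ^ j)\<^sup>2 * ((1/2) ^ Suc j) powr (- e)" for j :: nat
  define b where "b j = (2 ^ j :: real) powr (- e)" for j :: nat
  define \<omega> where "\<omega> = unit_ball_vol N"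
  have \<omega>: "\<omega> > 0" unfolding \<omega>_def N_def by simp
  have ab: "a j \<ge> 0" "b j \<ge> 0" for j unfolding a_def b_def by auto
  have near: "ennreal (levy_kernel s z) \<le> ennreal (a j) * indicator (ball 0 ((1/2) ^ j)) z"
    if "(1/2) ^ Suc j \<le> norm z" "norm z < (1/2) ^ j" for z :: 'a and j
  proof -
    have "min ((norm z)\<^sup>2) 1 \<le> ((1/2) ^ j)\<^sup>2"
      using that by (intro min.coboundedI1 power_mono) auto
    moreover have "1 / norm z powr e \<le> ((1/2) ^ Suc j) powr (- e)"
      using that e by (subst powr_minus_divide[symmetric], intro powr_mono2') auto
    ultimately have "min ((norm z)\<^sup>2) 1 * (1 / norm z powr e) \<le> a j"
      unfolding a_def by (intro mult_mono) auto
    then have "levy_kernel s z \<le> a j" unfolding levy_kernel_def e_def N_def by simp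
    then show ?thesis using that by (simp add: ennreal_leI)
  qed
  have far: "ennreal (levy_kernel s z) \<le> ennreal (b j) * indicator (ball 0 (2 ^ Suc j)) z"
    if "2 ^ j \<le> norm z" "norm z < 2 ^ Suc j" for z :: 'a and j
  proof -
    have "1 / norm z powr e \<le> (2 ^ j) powr (- e)"
      using that e by (subst powr_minus_divide[symmetric], intro powr_mono2') auto
    then have "min ((norm z)\<^sup>2) 1 * (1 / norm z powr e) \<le> 1 * b j"
      unfolding b_def by (intro mult_mono) auto
    then have "levy_kernel s z \<le> b j" unfolding levy_kernel_def e_def N_def by simp
    then show ?thesis using that by (simp add: ennreal_leI)
  qed
  have le: "ennreal (levy_kernel s z) \<le> (\<Sum>j. ennreal (a j) * indicator (ball 0 ((1/2) ^ j)) z)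
      + (\<Sum>j. ennreal (b j) * indicator (ball 0 (2 ^ Suc j)) z)" for z :: 'a
  proof -
    consider "z = 0" | "0 < norm z" "norm z < 1" | "1 \<le> norm z" by force
    then show ?thesis
    proof cases
      case 1 then show ?thesis by (simp add: levy_kernel_def)
    next
      case 2
      then obtain j where "(1/2) ^ Suc j \<le> norm z" "norm z < (1/2) ^ j" by (rule dyadic_bracket_less_1)
      from order_trans[OF near[OF this] ennreal_le_suminf[of "\<lambda>j. ennreal (a j) * indicator (ball 0 ((1/2) ^ j)) z" j]]
      show ?thesis by (rule add_increasing2[OF zero_le])
    next
      case 3
      then obtain j where "2 ^ j \<le> norm z" "norm z < 2 ^ Suc j" by (rule dyadic_bracket_ge_1)
      from order_trans[OF far[OF this] ennreal_le_suminf[of "\<lambda>j. ennreal (b j) * indicator (ball 0 (2 ^ Suc j)) z" j]]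
      show ?thesis by (rule add_increasing[OF zero_le])
    qed
  qed
  have ball: "ball 0 x \<in> sets (lborel :: 'a measure)" for x by simp
  have bt: "(\<lambda>z :: 'a. ennreal x * indicator (ball 0 y) z) \<in> borel_measurable lborel" for x y :: real
    by (intro borel_measurable_times_ennreal borel_measurable_const borel_measurable_indicator ball)
  have sum: "(\<lambda>z :: 'a. \<Sum>j. ennreal (c j) * indicator (ball 0 (r j)) z) \<in> borel_measurable lborel" for c r :: "nat \<Rightarrow> real"
    by (intro borel_measurable_suminf_order bt)
  have balls: "(\<integral>\<^sup>+z. (\<Sum>j. ennreal (c j) * indicator (ball 0 (r j)) z) \<partial>(lborel :: 'a measure))
      = (\<Sum>j. ennreal (c j) * emeasure lborel (ball 0 (r j) :: 'a set))" for c r :: "nat \<Rightarrow> real"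
    unfolding nn_integral_suminf[OF bt] nn_integral_cmult_indicator[OF ball] ..
  have "(\<integral>\<^sup>+z. ennreal (levy_kernel s (z :: 'a)) \<partial>lborel)
      \<le> (\<integral>\<^sup>+z. (\<Sum>j. ennreal (a j) * indicator (ball 0 ((1/2) ^ j)) z)
      + (\<Sum>j. ennreal (b j) * indicator (ball 0 (2 ^ Suc j)) z) \<partial>(lborel :: 'a measure))"
    by (intro nn_integral_mono le)
  also have "\<dots> = (\<Sum>j. ennreal (a j) * emeasure lborel (ball 0 ((1/2) ^ j) :: 'a set))
      + (\<Sum>j. ennreal (b j) * emeasure lborel (ball 0 (2 ^ Suc j) :: 'a set))"
    by (subst nn_integral_add[OF sum sum]) (simp only: balls)
  also have "\<dots> = (\<Sum>j. ennreal (a j * (\<omega> * ((1/2) ^ j) ^ DIM('a)))) + (\<Sum>j. ennreal (b j * (\<omega> * (2 ^ Suc j) ^ DIM('a))))"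
    using ab \<omega> by (simp add: emeasure_ball ennreal_mult \<omega>_def N_def)
  also have "(\<lambda>j. a j * (\<omega> * ((1/2) ^ j) ^ DIM('a))) = (\<lambda>j. \<omega> * 2 powr e * (2 powr (2 * s - 2)) ^ j)"
  proof
    fix j
    have h: "(1/2 :: real) ^ i = 2 powr (- real i)" for i
      by (simp add: powr_minus powr_realpow power_one_over inverse_eq_divide)
    have "a j = (2 powr (- j)) powr 2 * (2 powr (- real (Suc j))) powr (- e)"
      unfolding a_def h by simp
    moreover have "((1/2 :: real) ^ j) ^ DIM('a) = (2 powr (- j)) powr N"
      unfolding h N_def by (subst powr_realpow) auto
    moreover have "(2 powr (2 * s - 2)) ^ j = 2 powr ((2 * s - 2) * j)"
      by (simp add: powr_powr flip: powr_realpow)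
    ultimately show "a j * (\<omega> * ((1/2) ^ j) ^ DIM('a)) = \<omega> * 2 powr e * (2 powr (2 * s - 2)) ^ j"
      by (simp add: powr_powr e_def algebra_simps flip: powr_add)
  qed
  also have "(\<lambda>j. b j * (\<omega> * (2 ^ Suc j) ^ DIM('a))) = (\<lambda>j. \<omega> * 2 powr N * (2 powr (- 2 * s)) ^ j)"
  proof
    fix j
    have "b j = (2 powr j) powr (- e)"
      unfolding b_def by (simp add: powr_realpow)
    moreover have "((2 :: real) ^ Suc j) ^ DIM('a) = (2 powr (real (Suc j))) powr N"
      unfolding N_def by (subst powr_realpow, simp)+ simp
    moreover have "(2 powr (- 2 * s)) ^ j = 2 powr ((- 2 * s) * j)"
      by (simp add: powr_powr flip: powr_realpow)
    ultimately show "b j * (\<omega> * (2 ^ Suc j) ^ DIM('a)) = \<omega> * 2 powr N * (2 powr (- 2 * s)) ^ j"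
      by (simp add: powr_powr e_def algebra_simps flip: powr_add)
  qed
  also have "(\<Sum>j. ennreal (\<omega> * 2 powr e * (2 powr (2 * s - 2)) ^ j)) + (\<Sum>j. ennreal (\<omega> * 2 powr N * (2 powr (- 2 * s)) ^ j)) < \<infinity>"
  proof -
    have "2 powr (2 * s - 2) < 1" "2 powr (- 2 * s) < 1"
      using assms powr_less_mono[of "2 * s - 2" 0 2] powr_less_mono[of "- 2 * s" 0 2] by auto
    then have "summable (\<lambda>j. \<omega> * 2 powr e * (2 powr (2 * s - 2)) ^ j)" "summable (\<lambda>j. \<omega> * 2 powr N * (2 powr (- 2 * s)) ^ j)"
      by (intro summable_mult summable_geometric; simp)+
    then have "(\<Sum>j. ennreal (\<omega> * 2 powr e * (2 powr (2 * s - 2)) ^ j)) = ennreal (\<Sum>j. \<omega> * 2 powr e * (2 powr (2 * s - 2)) ^ j)"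
      "(\<Sum>j. ennreal (\<omega> * 2 powr N * (2 powr (- 2 * s)) ^ j)) = ennreal (\<Sum>j. \<omega> * 2 powr N * (2 powr (- 2 * s)) ^ j)"
      using \<omega> by (intro suminf_ennreal2; simp)+
    then show ?thesis by simp
  qed
  finally show ?thesis .
qed

lemma X0_lipschitz:
  fixes h :: "'a::euclidean_space \<Rightarrow> real"
  assumes s: "0 < s" "s < 1" and \<Omega>: "open \<Omega>" "bounded \<Omega>"
    and lip: "\<And>x y. \<bar>h x - h y\<bar> \<le> L * norm (x - y)" and B: "\<And>x. \<bar>h x\<bar> \<le> B"
    and off: "\<And>x. x \<notin> \<Omega> \<Longrightarrow> h x = 0"
  shows "h \<in> X0 s \<Omega>"
proof -
  have [measurable]: "\<Omega> \<in> sets borel" using \<Omega> by simp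
  have "(\<bar>L\<bar>)-lipschitz_on UNIV h"
  proof (rule lipschitz_onI)
    show "dist (h x) (h y) \<le> \<bar>L\<bar> * dist x y" for x y
      using lip[of x y] mult_right_mono[OF abs_ge_self[of L] norm_ge_zero[of "x - y"]]
      by (simp add: dist_real_def dist_norm)
  qed simp
  then have h[measurable]: "h \<in> borel_measurable borel"
    using lipschitz_on_continuous_on borel_measurable_continuous_onI by blast
  then have hl: "h \<in> borel_measurable lebesgue" by (auto intro: measurable_completion)
  have \<Omega>f: "emeasure lborel \<Omega> < \<infinity>" using \<Omega>(2) by (rule emeasure_bounded_finite)
  have "integrable lebesgue (\<lambda>x. (h x)\<^sup>2)"
  proof (rule integrableI_bounded_set[of \<Omega> _ _ "B\<^sup>2"])
    show "AE x in lebesgue. x \<in> \<Omega> \<longrightarrow> norm ((h x)\<^sup>2) \<le> B\<^sup>2"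
      using power_mono[OF B abs_ge_zero, of _ 2] by (intro AE_I2) simp
  qed (use hl \<Omega>f off in \<open>auto\<close>)
  moreover have "integrable lebesgue (\<lambda>z. (diff_quot s h z)\<^sup>2)"
  proof (rule integrableI_bounded)
    show "(\<lambda>z. (diff_quot s h z)\<^sup>2) \<in> borel_measurable lebesgue"
      using borel_measurable_diff_quot[OF hl, of s] by measurable
    define C where "C = L\<^sup>2 + 4 * B\<^sup>2"
    have C: "C \<ge> 0" unfolding C_def by simp
    let ?k = "\<lambda>x y. ennreal (C * levy_kernel s (x - y :: 'a))"
    define K where "K = (\<integral>\<^sup>+z. ennreal (C * levy_kernel s (z :: 'a)) \<partial>lborel)"
    have "K = ennreal C * (\<integral>\<^sup>+z. ennreal (levy_kernel s (z :: 'a)) \<partial>lborel)"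
      unfolding K_def by (subst nn_integral_cmult[symmetric]) (auto intro!: nn_integral_cong simp: ennreal_mult C levy_kernel_nonneg)
    also have "\<dots> < \<infinity>"
      using nn_integral_levy_kernel_finite[OF s, where 'a = 'a] by (simp add: ennreal_mult_less_top)
    finally have K: "K < \<infinity>" .
    have trans: "(\<integral>\<^sup>+y. ?k y x \<partial>lborel) = K" for x
    proof -
      have "K = (\<integral>\<^sup>+z. ennreal (C * levy_kernel s z) \<partial>(distr lborel borel ((+) (- x))))"
        unfolding K_def by (simp only: lborel_distr_plus)
      also have "\<dots> = (\<integral>\<^sup>+y. ennreal (C * levy_kernel s (- x + y)) \<partial>lborel)"
        by (rule nn_integral_distr) measurable
      finally show ?thesis by simp
    qed
    have sym: "?k x y = ?k y x" for x y by (simp add: levy_kernel_def norm_minus_commute)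
    have pt: "ennreal ((diff_quot s h (x, y))\<^sup>2) \<le> ?k x y * indicator \<Omega> x + ?k x y * indicator \<Omega> y" for x y
    proof (cases "x \<in> \<Omega> \<or> y \<in> \<Omega>")
      case True
      have "(h x - h y)\<^sup>2 \<le> C * min ((norm (x - y))\<^sup>2) 1"
      proof -
        have "(h x - h y)\<^sup>2 \<le> L\<^sup>2 * (norm (x - y))\<^sup>2"
          using power_mono[OF lip[of x y] abs_ge_zero, of 2] by (simp add: power_mult_distrib)
        also have "\<dots> \<le> C * (norm (x - y))\<^sup>2" unfolding C_def by (intro mult_right_mono) auto
        finally have "(h x - h y)\<^sup>2 \<le> C * (norm (x - y))\<^sup>2" .
        moreover have "\<bar>h x - h y\<bar> \<le> 2 * B" using B[of x] B[of y] by linarith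
        then have "(h x - h y)\<^sup>2 \<le> C"
          using power_mono[OF _ abs_ge_zero, of "h x - h y" "2 * B" 2] unfolding C_def by (simp add: power_mult_distrib add_increasing)
        ultimately show ?thesis by (auto simp: min_def)
      qed
      then have "(h x - h y)\<^sup>2 / norm (x - y) powr (real DIM('a) + 2 * s)
          \<le> C * min ((norm (x - y))\<^sup>2) 1 / norm (x - y) powr (real DIM('a) + 2 * s)"
        by (rule divide_right_mono) simp
      then have "(diff_quot s h (x, y))\<^sup>2 \<le> C * levy_kernel s (x - y)"
        by (simp add: power2_eq_square diff_quot_mult levy_kernel_def)
      then have "ennreal ((diff_quot s h (x, y))\<^sup>2) \<le> ?k x y" by (rule ennreal_leI)
      with True show ?thesis by (auto split: split_indicator intro: add_increasing2)
    qed (simp add: off diff_quot_def)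
    have meas: "(\<lambda>z. ?k (fst z) (snd z) * indicator \<Omega> (fst z)) \<in> borel_measurable (lborel \<Otimes>\<^sub>M lborel)"
      "(\<lambda>z. ?k (fst z) (snd z) * indicator \<Omega> (snd z)) \<in> borel_measurable (lborel \<Otimes>\<^sub>M lborel)"
      by measurable
    have "(\<integral>\<^sup>+z. ennreal (norm ((diff_quot s h z)\<^sup>2)) \<partial>lebesgue) = (\<integral>\<^sup>+z. ennreal ((diff_quot s h z)\<^sup>2) \<partial>(lborel \<Otimes>\<^sub>M lborel))"
      by (simp add: lborel_prod nn_integral_completion)
    also have "\<dots> \<le> (\<integral>\<^sup>+z. ?k (fst z) (snd z) * indicator \<Omega> (fst z) + ?k (fst z) (snd z) * indicator \<Omega> (snd z) \<partial>(lborel \<Otimes>\<^sub>M lborel))"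
    proof (rule nn_integral_mono)
      fix z :: "'a \<times> 'a"
      show "ennreal ((diff_quot s h z)\<^sup>2) \<le> ?k (fst z) (snd z) * indicator \<Omega> (fst z) + ?k (fst z) (snd z) * indicator \<Omega> (snd z)"
        using pt[of "fst z" "snd z"] by simp
    qed
    also have "\<dots> = (\<integral>\<^sup>+z. ?k (fst z) (snd z) * indicator \<Omega> (fst z) \<partial>(lborel \<Otimes>\<^sub>M lborel))
        + (\<integral>\<^sup>+z. ?k (fst z) (snd z) * indicator \<Omega> (snd z) \<partial>(lborel \<Otimes>\<^sub>M lborel))"
      by (rule nn_integral_add[OF meas])
    also have "\<dots> = (\<integral>\<^sup>+x. (\<integral>\<^sup>+y. ?k x y * indicator \<Omega> x \<partial>lborel) \<partial>lborel) + (\<integral>\<^sup>+y. (\<integral>\<^sup>+x. ?k x y * indicator \<Omega> y \<partial>lborel) \<partial>lborel)"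
      unfolding lborel.nn_integral_fst[OF meas(1), symmetric] lborel_pair.nn_integral_snd[OF meas(2), symmetric] by simp
    also have "\<dots> = (\<integral>\<^sup>+x. K * indicator \<Omega> x \<partial>lborel) + (\<integral>\<^sup>+x. K * indicator \<Omega> x \<partial>lborel)"
      by (subst sym) (simp add: nn_integral_multc trans)
    also have "\<dots> < \<infinity>" using K \<Omega>f by (simp add: nn_integral_cmult_indicator ennreal_mult_less_top)
    finally show "(\<integral>\<^sup>+z. ennreal (norm ((diff_quot s h z)\<^sup>2)) \<partial>lebesgue) < \<infinity>" .
  qed
  ultimately show ?thesis using hl off by (simp add: X0_iff)
qed

lemma Cc_infty_bounded:
  assumes "g \<in> Cc_infty \<Omega>"
  shows "\<exists>B. \<forall>x. \<bar>g x\<bar> \<le> B"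
proof -
  define K where "K = closure {x. g x \<noteq> 0}"
  have "smooth_fun g" "compact K" using assms by (simp_all add: K_def Cc_infty_def)
  then have "bounded (g ` K)"
    by (rule compact_imp_bounded[OF compact_continuous_image[OF smooth_fun_continuous_on]])
  then obtain B where B: "\<forall>y\<in>g ` K. norm y \<le> B" unfolding bounded_iff by blast
  have "\<bar>g x\<bar> \<le> \<bar>B\<bar>" for x
  proof (cases "g x = 0")
    case False
    then have "x \<in> K" unfolding K_def by (intro closure_subset[THEN subsetD]) simp
    then have "norm (g x) \<le> B" by (intro B[rule_format] imageI)
    then show ?thesis by (simp add: abs_le_iff)
  qed simp
  then show ?thesis by blast
qed

lemma Cc_infty_outside: "g \<in> Cc_infty \<Omega> \<Longrightarrow> x \<notin> \<Omega> \<Longrightarrow> g x = 0"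
  using closure_subset[of "{x. g x \<noteq> 0}"] unfolding Cc_infty_def by blast

lemma Cc_infty_lipschitz:
  fixes g :: "'a::euclidean_space \<Rightarrow> real"
  assumes g: "g \<in> Cc_infty \<Omega>"
  shows "\<exists>L. \<forall>x y. \<bar>g x - g y\<bar> \<le> L * norm (x - y)"
proof -
  define g' where "g' x = frechet_derivative g (at x)" for x
  have sm: "smooth_fun g" using g by (simp add: Cc_infty_def)
  then have g': "(g has_derivative g' x) (at x)" for x
    unfolding g'_def by (rule smooth_fun_has_derivative)
  have "(\<lambda>x. g' x b) \<in> Cc_infty \<Omega>" for b
  proof (rule Cc_inftyI[of _ "closure {x. g x \<noteq> 0}"])
    show "smooth_fun (\<lambda>x. g' x b)" using sm smooth_fun_iff[of g] unfolding g'_def by simp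
    fix x assume x: "x \<notin> closure {x. g x \<noteq> 0}"
    have "((\<lambda>x. 0) has_derivative (\<lambda>h. 0)) (at x)" by simp
    then have "(g has_derivative (\<lambda>h. 0)) (at x)"
    proof (rule has_derivative_transform_within_open[OF _ open_Compl[OF closed_closure[of "{x. g x \<noteq> 0}"]]])
      show "x \<in> - closure {x. g x \<noteq> 0}" using x by simp
      show "0 = g y" if "y \<in> - closure {x. g x \<noteq> 0}" for y
        using that closure_subset[of "{x. g x \<noteq> 0}"] by auto
    qed
    then have "g' x = (\<lambda>h. 0)" using g' has_derivative_unique by blast
    then show "g' x b = 0" by simp
  qed (use g in \<open>auto simp: Cc_infty_def\<close>)
  then have "\<forall>b. \<exists>M. \<forall>x. \<bar>g' x b\<bar> \<le> M" using Cc_infty_bounded by blast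
  then obtain M where M: "\<And>b x. \<bar>g' x b\<bar> \<le> M b" by metis
  have on: "onorm (g' x) \<le> (\<Sum>b\<in>Basis. M b)" for x
  proof (rule onorm_bound)
    have lin: "linear (g' x)" using g' has_derivative_linear by blast
    show "norm (g' x v) \<le> (\<Sum>b\<in>Basis. M b) * norm v" for v
    proof -
      have "g' x v = g' x (\<Sum>b\<in>Basis. (v \<bullet> b) *\<^sub>R b)" by (simp add: euclidean_representation)
      also have "\<dots> = (\<Sum>b\<in>Basis. (v \<bullet> b) * g' x b)" using lin by (simp add: linear_sum linear_cmul)
      also have "norm \<dots> \<le> (\<Sum>b\<in>Basis. norm v * M b)"
        by (rule sum_norm_le) (use M in \<open>auto simp: abs_mult intro!: mult_mono Basis_le_norm\<close>)
      finally show ?thesis by (simp add: sum_distrib_left mult.commute)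
    qed
    show "0 \<le> (\<Sum>b\<in>Basis. M b)" by (intro sum_nonneg order_trans[OF abs_ge_zero M])
  qed
  have "norm (g x - g y) \<le> (\<Sum>b\<in>Basis. M b) * norm (x - y)" for x y
    by (rule differentiable_bound[of UNIV]) (use g' on in auto)
  then show ?thesis unfolding real_norm_def by blast
qed

lemma Cc_infty_subset_X0:
  assumes "0 < s" "s < 1" "open \<Omega>" "bounded \<Omega>" "g \<in> Cc_infty \<Omega>"
  shows "g \<in> X0 s \<Omega>"
proof -
  obtain B where B: "\<And>x. \<bar>g x\<bar> \<le> B" using Cc_infty_bounded[OF assms(5)] by blast
  obtain L where L: "\<And>x y. \<bar>g x - g y\<bar> \<le> L * norm (x - y)" using Cc_infty_lipschitz[OF assms(5)] by blast
  show ?thesis by (rule X0_lipschitz[OF assms(1-4) L B Cc_infty_outside[OF assms(5)]])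
qed

section \<open>Solving the Dirichlet problem\<close>

lemma nonneg_quadratic_discriminant:
  fixes b d e :: real
  assumes q: "\<And>t. 0 \<le> e + 2 * t * d + t\<^sup>2 * b" and "0 \<le> b"
  shows "d\<^sup>2 \<le> e * b"
proof (cases "b = 0")
  case True
  have "d = 0"
  proof (rule ccontr)
    assume "d \<noteq> 0"
    then have "2 * (- (e + 1) / (2 * d)) * d = - (e + 1)" by simp
    then show False using q[of "- (e + 1) / (2 * d)"] True by simp
  qed
  then show ?thesis using True by simp
next
  case False
  have "0 \<le> e + 2 * (- d / b) * d + (- d / b)\<^sup>2 * b" by (rule q)
  also have "\<dots> = e - d\<^sup>2 / b" using False by (simp add: power2_eq_square)
  finally show ?thesis using False \<open>0 \<le> b\<close> by (simp add: pos_divide_le_eq)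
qed

lemma Cauchy_Schwarz_integral:
  fixes f g :: "'a \<Rightarrow> real"
  assumes "f \<in> borel_measurable M" "g \<in> borel_measurable M"
    and "integrable M (\<lambda>x. (f x)\<^sup>2)" "integrable M (\<lambda>x. (g x)\<^sup>2)"
  shows "(LINT x|M. f x * g x)\<^sup>2 \<le> (LINT x|M. (f x)\<^sup>2) * (LINT x|M. (g x)\<^sup>2)"
proof (rule nonneg_quadratic_discriminant)
  fix t
  have "0 \<le> (LINT x|M. (f x + t * g x)\<^sup>2)" by (rule Bochner_Integration.integral_nonneg) simp
  also have "(LINT x|M. (f x + t * g x)\<^sup>2) = (LINT x|M. (f x)\<^sup>2 + (2 * t) * (f x * g x) + t\<^sup>2 * (g x)\<^sup>2)"
    by (intro Bochner_Integration.integral_cong refl) (simp add: power2_eq_square algebra_simps)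
  also have "\<dots> = (LINT x|M. (f x)\<^sup>2) + 2 * t * (LINT x|M. f x * g x) + t\<^sup>2 * (LINT x|M. (g x)\<^sup>2)"
    using assms(3,4) integrable_mult_of_square_integrable[OF assms] by simp
  finally show "0 \<le> (LINT x|M. (f x)\<^sup>2) + 2 * t * (LINT x|M. f x * g x) + t\<^sup>2 * (LINT x|M. (g x)\<^sup>2)" .
qed (rule Bochner_Integration.integral_nonneg, simp)

text \<open>Riesz representation for a form on a space of functions, in which the functions stand for their
  classes modulo the kernel of the form. A minimizing sequence of \<open>B u u - 2 l u\<close> with defects
  \<open>4\<^sup>-\<^sup>n / 4\<close> is Cauchy at the rate for which completeness is assumed.\<close>

lemma Riesz_representation_fun:
  fixes V :: "('a \<Rightarrow> real) set" and B :: "('a \<Rightarrow> real) \<Rightarrow> ('a \<Rightarrow> real) \<Rightarrow> real" and l :: "('a \<Rightarrow> real) \<Rightarrow> real"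
  assumes V: "\<And>u v a b. u \<in> V \<Longrightarrow> v \<in> V \<Longrightarrow> (\<lambda>x. a * u x + b * v x) \<in> V" and "V \<noteq> {}"
    and B_lin: "\<And>u v w a b. u \<in> V \<Longrightarrow> v \<in> V \<Longrightarrow> w \<in> V \<Longrightarrow> B (\<lambda>x. a * u x + b * v x) w = a * B u w + b * B v w"
    and B_sym: "\<And>u v. B u v = B v u"
    and B_pos: "\<And>u. u \<in> V \<Longrightarrow> 0 \<le> B u u"
    and l_lin: "\<And>u v a b. u \<in> V \<Longrightarrow> v \<in> V \<Longrightarrow> l (\<lambda>x. a * u x + b * v x) = a * l u + b * l v"
    and l_bdd: "\<And>u. u \<in> V \<Longrightarrow> (l u)\<^sup>2 \<le> C * B u u" and "0 \<le> C"
    and complete: "\<And>u. (\<And>n. u n \<in> V) \<Longrightarrow>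
        (\<And>n. B (\<lambda>x. u (Suc n) x - u n x) (\<lambda>x. u (Suc n) x - u n x) \<le> (1/4) ^ n) \<Longrightarrow>
        \<exists>v\<in>V. (\<lambda>n. B (\<lambda>x. u n x - v x) (\<lambda>x. u n x - v x)) \<longlonglongrightarrow> 0"
  shows "\<exists>u\<in>V. \<forall>w\<in>V. B u w = l w"
proof -
  define J where "J u = B u u - 2 * l u" for u
  have B_quad: "B (\<lambda>x. a * u x + b * v x) (\<lambda>x. a * u x + b * v x) = a\<^sup>2 * B u u + 2 * a * b * B u v + b\<^sup>2 * B v v"
    if "u \<in> V" "v \<in> V" for u v a b
  proof -
    have "B (\<lambda>x. a * u x + b * v x) (\<lambda>x. a * u x + b * v x)
        = a * B u (\<lambda>x. a * u x + b * v x) + b * B v (\<lambda>x. a * u x + b * v x)"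
      using that by (intro B_lin V)
    also have "B u (\<lambda>x. a * u x + b * v x) = a * B u u + b * B v u"
      using that by (subst B_sym) (rule B_lin)
    also have "B v (\<lambda>x. a * u x + b * v x) = a * B u v + b * B v v"
      using that by (subst B_sym) (rule B_lin)
    finally show ?thesis by (simp add: B_sym[of v u] power2_eq_square algebra_simps)
  qed
  have J_ge: "- C \<le> J u" if "u \<in> V" for u
  proof -
    have "(2 * l u)\<^sup>2 \<le> 4 * (C * B u u)" using l_bdd[OF that] by (simp add: power_mult_distrib)
    also have "\<dots> \<le> (C + B u u)\<^sup>2" using sum_squares_bound[of C "B u u"] by (simp add: power2_eq_square algebra_simps)
    finally have "2 * l u \<le> C + B u u"
      by (rule power2_le_imp_le) (use B_pos[OF that] \<open>0 \<le> C\<close> in simp)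
    then show ?thesis unfolding J_def by simp
  qed
  define m where "m = Inf (J ` V)"
  have bdd: "bdd_below (J ` V)" by (rule bdd_belowI2[of _ "- C"]) (rule J_ge)
  have m_le: "m \<le> J u" if "u \<in> V" for u unfolding m_def using that bdd by (intro cInf_lower) auto
  have "\<exists>u\<in>V. J u < m + (1/4) ^ n / 4" for n :: nat
    using cInf_lessD[of "J ` V" "m + (1/4) ^ n / 4"] \<open>V \<noteq> {}\<close> unfolding m_def by auto
  then obtain u where u: "\<And>n. u n \<in> V" "\<And>n. J (u n) < m + (1/4) ^ n / 4" by metis
  have "B (\<lambda>x. u (Suc n) x - u n x) (\<lambda>x. u (Suc n) x - u n x) \<le> (1/4) ^ n" for n
  proof -
    let ?mid = "\<lambda>x. (1/2) * u (Suc n) x + (1/2) * u n x"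
    have "m \<le> J ?mid" by (intro m_le V u)
    moreover have "J ?mid = J (u (Suc n)) / 2 + J (u n) / 2 - B (\<lambda>x. 1 * u (Suc n) x + (-1) * u n x) (\<lambda>x. 1 * u (Suc n) x + (-1) * u n x) / 4"
      unfolding J_def B_quad[OF u(1) u(1)] l_lin[OF u(1) u(1)] by (simp add: power2_eq_square field_simps)
    moreover have "0 \<le> (1/4 :: real) ^ n" by simp
    ultimately have "B (\<lambda>x. 1 * u (Suc n) x + (-1) * u n x) (\<lambda>x. 1 * u (Suc n) x + (-1) * u n x) \<le> (1/4) ^ n"
      using u(2)[of n] u(2)[of "Suc n"] unfolding power_Suc by linarith
    then show ?thesis by simp
  qed
  then obtain v where v: "v \<in> V" "(\<lambda>n. B (\<lambda>x. u n x - v x) (\<lambda>x. u n x - v x)) \<longlonglongrightarrow> 0"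
    using complete[of u] u(1) by blast
  have "B v w = l w" if w: "w \<in> V" for w
  proof -
    have 1: "(B (u n) w - l w)\<^sup>2 \<le> ((1/4) ^ n / 4) * B w w" for n
    proof (rule nonneg_quadratic_discriminant[OF _ B_pos[OF w]])
      fix t
      have "m \<le> J (\<lambda>x. 1 * u n x + t * w x)" by (intro m_le V u w)
      also have "\<dots> = J (u n) + 2 * t * (B (u n) w - l w) + t\<^sup>2 * B w w"
        unfolding J_def B_quad[OF u(1) w] l_lin[OF u(1) w] by (simp add: algebra_simps)
      finally show "0 \<le> (1/4) ^ n / 4 + 2 * t * (B (u n) w - l w) + t\<^sup>2 * B w w" using u(2)[of n] by simp
    qed
    have 2: "(B (u n) w - B v w)\<^sup>2 \<le> B (\<lambda>x. u n x - v x) (\<lambda>x. u n x - v x) * B w w" for n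
    proof (rule nonneg_quadratic_discriminant[OF _ B_pos[OF w]])
      fix t
      have d: "(\<lambda>x. u n x - v x) \<in> V" using V[OF u(1) v(1), of 1 n "-1"] by simp
      have "B (\<lambda>x. u n x - v x) w = B (u n) w - B v w" using B_lin[OF u(1) v(1) w, of 1 n "-1"] by simp
      then show "0 \<le> B (\<lambda>x. u n x - v x) (\<lambda>x. u n x - v x) + 2 * t * (B (u n) w - B v w) + t\<^sup>2 * B w w"
        using B_quad[OF d w, of 1 t] B_pos[OF V[OF d w, of 1 t]] by simp
    qed
    have "(\<lambda>n. (B (u n) w - l w)\<^sup>2) \<longlonglongrightarrow> 0"
    proof (rule tendsto_sandwich[OF _ _ tendsto_const])
      have "(\<lambda>n. ((1/4) ^ n / 4) * B w w) \<longlonglongrightarrow> (0 / 4) * B w w"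
        by (intro tendsto_intros LIMSEQ_power_zero) auto
      then show "(\<lambda>n. ((1/4) ^ n / 4) * B w w) \<longlonglongrightarrow> 0" by simp
    qed (use 1 in auto)
    then have lim1: "(\<lambda>n. B (u n) w - l w) \<longlonglongrightarrow> 0" by (simp add: power_tendsto_0_iff)
    have "(\<lambda>n. (B (u n) w - B v w)\<^sup>2) \<longlonglongrightarrow> 0"
    proof (rule tendsto_sandwich[OF _ _ tendsto_const])
      show "(\<lambda>n. B (\<lambda>x. u n x - v x) (\<lambda>x. u n x - v x) * B w w) \<longlonglongrightarrow> 0"
        using tendsto_mult[OF v(2) tendsto_const] by simp
    qed (use 2 in auto)
    then have lim2: "(\<lambda>n. B (u n) w - B v w) \<longlonglongrightarrow> 0" by (simp add: power_tendsto_0_iff)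
    show ?thesis using LIMSEQ_unique[OF LIM_zero_cancel[OF lim1] LIM_zero_cancel[OF lim2]] by simp
  qed
  with v(1) show ?thesis by blast
qed

locale dirichlet_domain =
  fixes s :: real and \<Omega> :: "'a::euclidean_space set"
  assumes s_pos: "0 < s" and s_less_1: "s < 1" and open_\<Omega>: "open \<Omega>" and bounded_\<Omega>: "bounded \<Omega>"
begin

abbreviation M where "M \<equiv> lebesgue_on \<Omega>"

text \<open>One Dirichlet problem lowers the reciprocal of the integrability exponent by anything below
  this amount.\<close>

definition gain where "gain = 2 * s / real DIM('a)"

lemma gain_pos: "gain > 0"
  using s_pos by (simp add: gain_def)

lemma \<Omega>_sets [simp, measurable]: "\<Omega> \<in> sets lebesgue" "\<Omega> \<inter> space lebesgue \<in> sets lebesgue"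
  using open_\<Omega> by (auto simp: lborelD)

lemma \<Omega>_lmeasurable: "\<Omega> \<in> lmeasurable"
  using open_\<Omega> bounded_\<Omega> by (rule lmeasurable_open[rotated])

lemma finite_measure_M: "finite_measure M"
  by (rule finite_measure_lebesgue_on) (rule \<Omega>_lmeasurable)

lemma space_M: "space M = \<Omega>" by simp

lemma AE_M_iff: "(AE x in M. P x) \<longleftrightarrow> (AE x in lebesgue. x \<in> \<Omega> \<longrightarrow> P x)"
  by (rule AE_restrict_space_iff) simp

lemma measurable_M: "f \<in> borel_measurable lebesgue \<Longrightarrow> f \<in> borel_measurable M"
  by (rule measurable_restrict_space1)

lemma lebesgue_eq_M:
  fixes f :: "'a \<Rightarrow> real"
  assumes "f \<in> borel_measurable lebesgue" "AE x in lebesgue. x \<notin> \<Omega> \<longrightarrow> f x = 0"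
  shows "integrable M f \<longleftrightarrow> integrable lebesgue f" "(LINT x|M. f x) = (LINT x|lebesgue. f x)"
proof -
  have *: "AE x in lebesgue. indicator \<Omega> x *\<^sub>R f x = f x"
    using assms(2) by eventually_elim (auto split: split_indicator)
  have m: "(\<lambda>x. indicator \<Omega> x *\<^sub>R f x) \<in> borel_measurable lebesgue"
    using assms(1) by measurable
  show "integrable M f \<longleftrightarrow> integrable lebesgue f"
    by (subst integrable_restrict_space, simp) (rule integrable_cong_AE[OF m assms(1) *])
  show "(LINT x|M. f x) = (LINT x|lebesgue. f x)"
    by (subst integral_restrict_space, simp) (rule integral_cong_AE[OF m assms(1) *])
qed

lemma X0_M:
  assumes "u \<in> X0 s \<Omega>"
  shows "u \<in> borel_measurable M" "integrable M (\<lambda>x. (u x)\<^sup>2)" "integrable M u"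
    "(LINT x|M. (u x)\<^sup>2) = (LINT x|lebesgue. (u x)\<^sup>2)"
proof -
  interpret finite_measure M by (rule finite_measure_M)
  have u: "u \<in> borel_measurable lebesgue" "AE x in lebesgue. x \<notin> \<Omega> \<longrightarrow> u x = 0" "integrable lebesgue (\<lambda>x. (u x)\<^sup>2)"
    using assms by (auto simp: X0_iff)
  show m: "u \<in> borel_measurable M" by (rule measurable_M[OF u(1)])
  have 0: "AE x in lebesgue. x \<notin> \<Omega> \<longrightarrow> (u x)\<^sup>2 = 0" using u(2) by eventually_elim simp
  have m2: "(\<lambda>x. (u x)\<^sup>2) \<in> borel_measurable lebesgue" using u(1) by measurable
  show i: "integrable M (\<lambda>x. (u x)\<^sup>2)" "(LINT x|M. (u x)\<^sup>2) = (LINT x|lebesgue. (u x)\<^sup>2)"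
    using lebesgue_eq_M[OF m2 0] u(3) by auto
  show "integrable M u"
    using integrable_mult_of_square_integrable[OF m _ i(1), of "\<lambda>x. 1"] by simp
qed

lemma integrable_X0_mult_M: "u \<in> X0 s \<Omega> \<Longrightarrow> w \<in> X0 s \<Omega> \<Longrightarrow> integrable M (\<lambda>x. u x * w x)"
  by (rule integrable_mult_of_square_integrable) (auto simp: X0_M)

lemma AE_bounded_square_integrable:
  fixes g :: "'a \<Rightarrow> real"
  assumes "g \<in> borel_measurable M" "AE x in M. \<bar>g x\<bar> \<le> C"
  shows "integrable M (\<lambda>x. (g x)\<^sup>2)"
proof -
  interpret finite_measure M by (rule finite_measure_M)
  show ?thesis
  proof (rule integrable_const_bound[of _ "C\<^sup>2"])
    show "AE x in M. norm ((g x)\<^sup>2) \<le> C\<^sup>2"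
      using assms(2)
    proof eventually_elim
      case (elim x)
      then show ?case using power_mono[OF elim abs_ge_zero, of 2] by simp
    qed
  qed (use assms(1) in measurable)
qed

lemma AE_bounded_mult_integrable:
  fixes g :: "'a \<Rightarrow> real"
  assumes g: "g \<in> borel_measurable M" "AE x in M. \<bar>g x\<bar> \<le> C" and f: "integrable M f"
  shows "integrable M (\<lambda>x. g x * f x)" "integrable M (\<lambda>x. f x * g x)"
proof -
  have [measurable]: "f \<in> borel_measurable M" "g \<in> borel_measurable M" using g f by auto
  show "integrable M (\<lambda>x. g x * f x)"
  proof (rule Bochner_Integration.integrable_bound)
    show "integrable M (\<lambda>x. C * f x)" using f by simp
    show "AE x in M. norm (g x * f x) \<le> norm (C * f x)"
      using g(2) by eventually_elim (auto simp: abs_mult intro!: mult_right_mono)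
  qed measurable
  then show "integrable M (\<lambda>x. f x * g x)" by (simp add: mult.commute)
qed

lemma integral_M_nonneg: "(\<And>x. 0 \<le> f x) \<Longrightarrow> 0 \<le> (LINT x|M. f x :: real)"
  by (rule Bochner_Integration.integral_nonneg) simp

lemma Poincare_inequality:
  obtains P where "P > 0" "\<And>u. u \<in> X0 s \<Omega> \<Longrightarrow> (LINT x|M. (u x)\<^sup>2) \<le> P * frac_form s u u"
proof -
  \<comment> \<open>the summand \<open>1\<close> keeps \<open>V\<close> positive if \<open>\<Omega>\<close> is null\<close>
  define V where "V = measure lebesgue \<Omega> + 1"
  have V: "V > 0" unfolding V_def by (simp add: add_nonneg_pos)
  define c where "c = (unit_ball_vol (real DIM('a)) / 2) powr (1 + 2 * s / real DIM('a)) * V powr (- (2 * s / real DIM('a)))"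
  have c: "c > 0" unfolding c_def using V unit_ball_vol_pos[OF of_nat_0_le_iff, of "DIM('a)"]
    by (intro mult_pos_pos) (simp_all add: powr_gt_zero del: unit_ball_vol_pos)
  have "(LINT x|M. (u x)\<^sup>2) \<le> (1 / c) * frac_form s u u" if u: "u \<in> X0 s \<Omega>" for u
  proof -
    have "c * (LINT x|lebesgue. (u x)\<^sup>2) \<le> frac_form s u u"
      unfolding c_def by (rule Faber_Krahn_inequality[OF u s_pos \<Omega>_lmeasurable _ V]) (use u in \<open>auto simp: V_def X0_iff\<close>)
    then show ?thesis using c X0_M(4)[OF u] by (simp add: field_simps)
  qed
  then show thesis using that[of "1 / c"] c by simp
qed

lemma square_integral_Fatou:
  fixes f :: "nat \<Rightarrow> 'b \<Rightarrow> real"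
  assumes [measurable]: "\<And>n. f n \<in> borel_measurable N" "g \<in> borel_measurable N"
    and int: "\<And>n. integrable N (\<lambda>x. (f n x)\<^sup>2)" "\<And>n. n \<ge> n0 \<Longrightarrow> (LINT x|N. (f n x)\<^sup>2) \<le> c"
    and lim: "AE x in N. (\<lambda>n. f n x) \<longlonglongrightarrow> g x"
  shows "integrable N (\<lambda>x. (g x)\<^sup>2)" "(LINT x|N. (g x)\<^sup>2) \<le> c"
proof -
  have "0 \<le> (LINT x|N. (f n0 x)\<^sup>2)" by (rule Bochner_Integration.integral_nonneg) simp
  then have c: "c \<ge> 0" using int(2)[of n0] by linarith
  have "(\<integral>\<^sup>+x. ennreal ((g x)\<^sup>2) \<partial>N) = (\<integral>\<^sup>+x. liminf (\<lambda>n. ennreal ((f n x)\<^sup>2)) \<partial>N)"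
  proof (rule nn_integral_cong_AE)
    show "AE x in N. ennreal ((g x)\<^sup>2) = liminf (\<lambda>n. ennreal ((f n x)\<^sup>2))"
      using lim
    proof eventually_elim
      case (elim x)
      then have "(\<lambda>n. ennreal ((f n x)\<^sup>2)) \<longlonglongrightarrow> ennreal ((g x)\<^sup>2)" by (intro tendsto_ennrealI tendsto_power)
      then show ?case using lim_imp_Liminf trivial_limit_sequentially by metis
    qed
  qed
  also have "\<dots> \<le> liminf (\<lambda>n. (\<integral>\<^sup>+x. ennreal ((f n x)\<^sup>2) \<partial>N))"
    by (rule nn_integral_liminf) measurable
  also have "\<dots> \<le> ennreal c"
  proof (rule Liminf_le)
    show "\<forall>\<^sub>F n in sequentially. (\<integral>\<^sup>+x. ennreal ((f n x)\<^sup>2) \<partial>N) \<le> ennreal c"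
      using eventually_ge_at_top[of n0]
    proof eventually_elim
      case (elim n)
      then show ?case using int by (subst nn_integral_eq_integral) (auto intro!: ennreal_leI)
    qed
  qed simp
  finally have le: "(\<integral>\<^sup>+x. ennreal ((g x)\<^sup>2) \<partial>N) \<le> ennreal c" .
  show i: "integrable N (\<lambda>x. (g x)\<^sup>2)"
  proof (rule integrableI_bounded)
    show "(\<integral>\<^sup>+x. ennreal (norm ((g x)\<^sup>2)) \<partial>N) < \<infinity>"
      using le by (simp add: le_less_trans ennreal_less_top)
  qed measurable
  have "ennreal (LINT x|N. (g x)\<^sup>2) \<le> ennreal c"
    using le by (subst nn_integral_eq_integral[symmetric, OF i]) auto
  then show "(LINT x|N. (g x)\<^sup>2) \<le> c" using c by simp
qed

definition resolvent_form where
  "resolvent_form \<alpha> u w = frac_form s u w + \<alpha> * (LINT x|M. u x * w x)"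

lemma resolvent_form_lincomb:
  assumes "u \<in> X0 s \<Omega>" "v \<in> X0 s \<Omega>" "w \<in> X0 s \<Omega>"
  shows "resolvent_form \<alpha> (\<lambda>x. a * u x + b * v x) w = a * resolvent_form \<alpha> u w + b * resolvent_form \<alpha> v w"
proof -
  have "(LINT x|M. (a * u x + b * v x) * w x) = (LINT x|M. a * (u x * w x) + b * (v x * w x))"
    by (intro Bochner_Integration.integral_cong refl) (simp add: algebra_simps)
  also have "\<dots> = a * (LINT x|M. u x * w x) + b * (LINT x|M. v x * w x)"
    using assms by (simp add: integrable_X0_mult_M)
  finally show ?thesis
    using frac_form_lincomb[OF assms] by (simp add: resolvent_form_def algebra_simps)
qed

lemma resolvent_form_sym: "resolvent_form \<alpha> u v = resolvent_form \<alpha> v u"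
  by (simp add: resolvent_form_def frac_form_sym[of s u v] mult.commute)

lemma resolvent_form_self: "resolvent_form \<alpha> u u = frac_form s u u + \<alpha> * (LINT x|M. (u x)\<^sup>2)"
  by (simp add: resolvent_form_def power2_eq_square)

lemma resolvent_form_nonneg: "\<alpha> \<ge> 0 \<Longrightarrow> 0 \<le> resolvent_form \<alpha> u u"
  unfolding resolvent_form_self by (intro add_nonneg_nonneg frac_form_nonneg mult_nonneg_nonneg integral_M_nonneg) auto

lemma resolvent_form_add_le:
  assumes "\<alpha> \<ge> 0" "u \<in> X0 s \<Omega>" "v \<in> X0 s \<Omega>"
  shows "resolvent_form \<alpha> (\<lambda>x. u x + v x) (\<lambda>x. u x + v x) \<le> 2 * resolvent_form \<alpha> u u + 2 * resolvent_form \<alpha> v v"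
proof -
  let ?B = "resolvent_form \<alpha>"
  have quad: "?B (\<lambda>x. 1 * u x + b * v x) (\<lambda>x. 1 * u x + b * v x) = ?B u u + 2 * b * ?B u v + b\<^sup>2 * ?B v v" for b
  proof -
    have X: "(\<lambda>x. 1 * u x + b * v x) \<in> X0 s \<Omega>" by (rule X0_lincomb[OF assms(2,3)])
    show ?thesis
      unfolding resolvent_form_lincomb[OF assms(2,3) X]
      unfolding resolvent_form_sym[of \<alpha> u "\<lambda>x. 1 * u x + b * v x"] resolvent_form_sym[of \<alpha> v "\<lambda>x. 1 * u x + b * v x"]
      unfolding resolvent_form_lincomb[OF assms(2,3) assms(2)] resolvent_form_lincomb[OF assms(2,3) assms(3)]
      by (simp add: resolvent_form_sym[of \<alpha> v u] power2_eq_square algebra_simps)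
  qed
  show ?thesis
    using quad[of 1] quad[of "-1"] resolvent_form_nonneg[OF assms(1), of "\<lambda>x. 1 * u x + (-1) * v x"] by simp
qed

text \<open>Fast Cauchy sequences converge almost everywhere, because the \<open>L\<^sup>2\<close> norms of the increments are
  summable and \<open>\<Omega>\<close> has finite measure; Fatou's lemma, applied to the functions and to
  their difference quotients, turns pointwise convergence into convergence in the form.\<close>

lemma resolvent_form_complete:
  assumes \<alpha>: "\<alpha> \<ge> 0" and u: "\<And>n. u n \<in> X0 s \<Omega>"
    and fast: "\<And>n. resolvent_form \<alpha> (\<lambda>x. u (Suc n) x - u n x) (\<lambda>x. u (Suc n) x - u n x) \<le> (1/4) ^ n"
  shows "\<exists>v\<in>X0 s \<Omega>. (\<lambda>n. resolvent_form \<alpha> (\<lambda>x. u n x - v x) (\<lambda>x. u n x - v x)) \<longlonglongrightarrow> 0"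
proof -
  interpret finite_measure M by (rule finite_measure_M)
  let ?B = "resolvent_form \<alpha>"
  obtain P where P: "P > 0" "\<And>u. u \<in> X0 s \<Omega> \<Longrightarrow> (LINT x|M. (u x)\<^sup>2) \<le> P * frac_form s u u"
    using Poincare_inequality by blast
  have E_le: "frac_form s w w \<le> ?B w w" for w
    using \<alpha> by (simp add: resolvent_form_self integral_M_nonneg)
  have um[measurable]: "u n \<in> borel_measurable lebesgue" "u n \<in> borel_measurable M" for n
    using X0_measurable[OF u] X0_M(1)[OF u] by auto
  define d where "d n x = u (Suc n) x - u n x" for n x
  have d_eq: "d n = (\<lambda>x. u (Suc n) x - u n x)" for n by (rule ext) (simp add: d_def)
  have d: "d n \<in> X0 s \<Omega>" for n unfolding d_eq by (intro X0_diff u)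
  have d2: "(LINT x|M. (d n x)\<^sup>2) \<le> P * (1/4) ^ n" for n
  proof -
    have "(LINT x|M. (d n x)\<^sup>2) \<le> P * frac_form s (d n) (d n)" by (rule P(2)[OF d])
    also have "\<dots> \<le> P * (1/4) ^ n"
      using P(1) order_trans[OF E_le fast[of n]] by (intro mult_left_mono) (auto simp: d_eq)
    finally show ?thesis .
  qed
  define V where "V = measure M \<Omega>"
  have d1: "(LINT x|M. \<bar>d n x\<bar>) \<le> sqrt (P * V) * (1/2) ^ n" for n
  proof -
    have "(LINT x|M. \<bar>d n x\<bar> * 1)\<^sup>2 \<le> (LINT x|M. \<bar>d n x\<bar>\<^sup>2) * (LINT x|M. 1\<^sup>2)"
      by (rule Cauchy_Schwarz_integral) (use X0_M[OF d] in \<open>auto intro: borel_measurable_abs\<close>)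
    also have "\<dots> \<le> (P * (1/4) ^ n) * V" using d2 by (intro mult_mono) (auto simp: V_def P(1) less_imp_le)
    also have "\<dots> = (sqrt (P * V) * (1/2) ^ n)\<^sup>2"
    proof -
      have "(1/4 :: real) ^ n = ((1/2) ^ n)\<^sup>2"
        by (simp add: power2_eq_square flip: power_mult_distrib)
      then show ?thesis using P(1) by (simp add: power_mult_distrib V_def)
    qed
    finally have "(LINT x|M. \<bar>d n x\<bar>)\<^sup>2 \<le> (sqrt (P * V) * (1/2) ^ n)\<^sup>2" by simp
    then show ?thesis by (rule power2_le_imp_le) (use P(1) in \<open>simp add: V_def\<close>)
  qed
  have "AE x in M. summable (\<lambda>n. \<bar>d n x\<bar>)"
  proof -
    have "(\<integral>\<^sup>+x. (\<Sum>n. ennreal \<bar>d n x\<bar>) \<partial>M) = (\<Sum>n. \<integral>\<^sup>+x. ennreal \<bar>d n x\<bar> \<partial>M)"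
      using X0_M(1)[OF d] by (intro nn_integral_suminf) auto
    also have "\<dots> = (\<Sum>n. ennreal (LINT x|M. \<bar>d n x\<bar>))"
      using X0_M(3)[OF d] by (subst nn_integral_eq_integral) auto
    also have "\<dots> \<le> (\<Sum>n. ennreal (sqrt (P * V) * (1/2) ^ n))"
      by (intro suminf_le ennreal_leI d1) auto
    also have "\<dots> = ennreal (\<Sum>n. sqrt (P * V) * (1/2) ^ n)"
      using P(1) by (intro suminf_ennreal2 summable_mult summable_geometric) (auto simp: V_def)
    also have "\<dots> < \<infinity>" by simp
    finally have "AE x in M. (\<Sum>n. ennreal \<bar>d n x\<bar>) \<noteq> \<infinity>"
      using X0_M(1)[OF d] by (intro nn_integral_noteq_infinite) auto
    then show ?thesis by eventually_elim (rule summable_suminf_not_top, auto)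
  qed
  then have conv_M: "AE x in M. convergent (\<lambda>n. u n x)"
  proof eventually_elim
    case (elim x)
    have "summable (\<lambda>n. d n x)" by (rule summable_rabs_cancel[OF elim])
    then have "(\<lambda>n. \<Sum>i<n. d i x) \<longlonglongrightarrow> (\<Sum>i. d i x)" by (rule summable_LIMSEQ)
    moreover have "(\<Sum>i<n. d i x) = u n x - u 0 x" for n
      unfolding d_def by (rule sum_lessThan_telescope)
    ultimately have "(\<lambda>n. (u n x - u 0 x) + u 0 x) \<longlonglongrightarrow> (\<Sum>i. d i x) + u 0 x" by (intro tendsto_add) auto
    then show ?case by (auto simp: convergent_def)
  qed
  define v where "v x = lim (\<lambda>n. u n x)" for x
  have v[measurable]: "v \<in> borel_measurable lebesgue" unfolding v_def by measurable
  have "AE x in lebesgue. x \<notin> \<Omega> \<longrightarrow> u n x = 0" for n using u[of n] by (simp add: X0_iff)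
  then have out: "AE x in lebesgue. \<forall>n. x \<notin> \<Omega> \<longrightarrow> u n x = 0" unfolding AE_all_countable by blast
  have lim: "AE x in lebesgue. (\<lambda>n. u n x) \<longlonglongrightarrow> v x"
    using out conv_M[unfolded AE_M_iff]
    by eventually_elim (auto simp: v_def convergent_LIMSEQ_iff)
  have v0: "AE x in lebesgue. x \<notin> \<Omega> \<longrightarrow> v x = 0"
    using out by eventually_elim (auto simp: v_def)
  have limD: "AE z in lebesgue. (\<lambda>m. diff_quot s (\<lambda>x. u m x - u n x) z) \<longlonglongrightarrow> diff_quot s (\<lambda>x. v x - u n x) z" for n
    using AE_lebesgue_fst[OF lim, where 'b = 'a] AE_lebesgue_snd[OF lim, where 'b = 'a]
    unfolding diff_quot_def divide_inverse by eventually_elim (intro tendsto_intros)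
  have Bmn: "?B (\<lambda>x. u (n + k) x - u n x) (\<lambda>x. u (n + k) x - u n x) \<le> 4 * (1/4) ^ n" for n k
  proof (induction k arbitrary: n)
    case 0
    show ?case by (simp add: resolvent_form_def frac_form_eq diff_quot_def)
  next
    case (Suc k)
    have "?B (\<lambda>x. d n x + (u (Suc n + k) x - u (Suc n) x)) (\<lambda>x. d n x + (u (Suc n + k) x - u (Suc n) x))
        \<le> 2 * ?B (d n) (d n) + 2 * ?B (\<lambda>x. u (Suc n + k) x - u (Suc n) x) (\<lambda>x. u (Suc n + k) x - u (Suc n) x)"
      by (intro resolvent_form_add_le \<alpha> d X0_diff u)
    also have "\<dots> \<le> 2 * (1/4) ^ n + 2 * (4 * (1/4) ^ Suc n)"
      using fast[of n] Suc.IH[of "Suc n"] unfolding d_def by (intro add_mono mult_left_mono) auto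
    finally show ?case by (simp add: d_def)
  qed
  then have Bmn': "?B (\<lambda>x. u m x - u n x) (\<lambda>x. u m x - u n x) \<le> 4 * (1/4) ^ n" if "m \<ge> n" for m n
    using Bmn[of n "m - n"] that by simp
  have Emn: "(LINT z|lebesgue. (diff_quot s (\<lambda>x. u m x - u n x) z)\<^sup>2) \<le> 4 * (1/4) ^ n" if "m \<ge> n" for m n
    using order_trans[OF E_le Bmn'[OF that]] by (simp add: frac_form_eq power2_eq_square)
  have Lmn: "(LINT x|lebesgue. (u m x - u n x)\<^sup>2) \<le> P * (4 * (1/4) ^ n)" if "m \<ge> n" for m n
  proof -
    have X: "(\<lambda>x. u m x - u n x) \<in> X0 s \<Omega>" by (intro X0_diff u)
    have "(LINT x|lebesgue. (u m x - u n x)\<^sup>2) \<le> P * frac_form s (\<lambda>x. u m x - u n x) (\<lambda>x. u m x - u n x)"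
      using P(2)[OF X] X0_M(4)[OF X] by simp
    also have "\<dots> \<le> P * (4 * (1/4) ^ n)"
      using P(1) order_trans[OF E_le Bmn'[OF that]] by (intro mult_left_mono) auto
    finally show ?thesis .
  qed
  have Fat: "integrable lebesgue (\<lambda>z. (diff_quot s (\<lambda>x. v x - u n x) z)\<^sup>2)"
      "(LINT z|lebesgue. (diff_quot s (\<lambda>x. v x - u n x) z)\<^sup>2) \<le> 4 * (1/4) ^ n"
      "integrable lebesgue (\<lambda>x. (v x - u n x)\<^sup>2)" "(LINT x|lebesgue. (v x - u n x)\<^sup>2) \<le> P * (4 * (1/4) ^ n)" for n
  proof -
    have X: "(\<lambda>x. u m x - u n x) \<in> X0 s \<Omega>" for m by (intro X0_diff u)
    have ms: "(\<lambda>x. u m x - u n x) \<in> borel_measurable lebesgue" "(\<lambda>x. v x - u n x) \<in> borel_measurable lebesgue" for m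
      by measurable
    have li: "AE x in lebesgue. (\<lambda>m. u m x - u n x) \<longlonglongrightarrow> v x - u n x"
      using lim by eventually_elim (intro tendsto_intros)
    show "integrable lebesgue (\<lambda>z. (diff_quot s (\<lambda>x. v x - u n x) z)\<^sup>2)"
      "(LINT z|lebesgue. (diff_quot s (\<lambda>x. v x - u n x) z)\<^sup>2) \<le> 4 * (1/4) ^ n"
      using square_integral_Fatou[of "\<lambda>m. diff_quot s (\<lambda>x. u m x - u n x)" lebesgue "diff_quot s (\<lambda>x. v x - u n x)" n,
          OF borel_measurable_diff_quot[OF ms(1)] borel_measurable_diff_quot[OF ms(2)] _ Emn limD] X
      by (auto simp: X0_iff)
    show "integrable lebesgue (\<lambda>x. (v x - u n x)\<^sup>2)" "(LINT x|lebesgue. (v x - u n x)\<^sup>2) \<le> P * (4 * (1/4) ^ n)"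
      using square_integral_Fatou[of "\<lambda>m x. u m x - u n x" lebesgue "\<lambda>x. v x - u n x" n,
          OF ms _ Lmn li] X
      by (auto simp: X0_iff)
  qed
  have vu: "(\<lambda>x. v x - u n x) \<in> X0 s \<Omega>" for n
  proof -
    have "AE x in lebesgue. x \<notin> \<Omega> \<longrightarrow> v x - u n x = 0"
      using v0 out by eventually_elim auto
    then show ?thesis using Fat[of n] by (simp add: X0_iff)
  qed
  have vX: "v \<in> X0 s \<Omega>" using X0_lincomb[OF vu[of 0] u[of 0], of 1 1] by simp
  have swap: "?B (\<lambda>x. u n x - v x) (\<lambda>x. u n x - v x) = ?B (\<lambda>x. v x - u n x) (\<lambda>x. v x - u n x)" for n
    by (simp add: resolvent_form_self frac_form_eq diff_quot_def power2_commute[of "u n _" "v _"]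
        flip: power2_eq_square) (simp add: power_divide algebra_simps power2_eq_square)
  have le: "?B (\<lambda>x. v x - u n x) (\<lambda>x. v x - u n x) \<le> 4 * (1/4) ^ n + \<alpha> * (P * (4 * (1/4) ^ n))" for n
    unfolding resolvent_form_self
    using Fat(2)[of n] Fat(4)[of n] X0_M(4)[OF vu, of n] \<alpha>
    by (intro add_mono mult_left_mono) (auto simp: frac_form_eq power2_eq_square)
  have "(\<lambda>n. ?B (\<lambda>x. u n x - v x) (\<lambda>x. u n x - v x)) \<longlonglongrightarrow> 0"
  proof (rule tendsto_sandwich[OF _ _ tendsto_const])
    have "(\<lambda>n. 4 * (1/4) ^ n + \<alpha> * (P * (4 * (1/4) ^ n))) \<longlonglongrightarrow> 4 * 0 + \<alpha> * (P * (4 * 0))"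
      by (intro tendsto_intros LIMSEQ_power_zero) auto
    then show "(\<lambda>n. 4 * (1/4) ^ n + \<alpha> * (P * (4 * (1/4) ^ n))) \<longlonglongrightarrow> 0" by simp
  qed (use le swap resolvent_form_nonneg[OF \<alpha>] in auto)
  with vX show ?thesis by blast
qed

lemma ex_resolvent:
  assumes g: "g \<in> borel_measurable M" "AE x in M. \<bar>g x\<bar> \<le> C" and \<alpha>: "\<alpha> \<ge> 0"
  shows "\<exists>\<phi>\<in>X0 s \<Omega>. \<forall>w\<in>X0 s \<Omega>. frac_form s \<phi> w + \<alpha> * (LINT x|M. \<phi> x * w x) = (LINT x|M. g x * w x)"
proof -
  obtain P where P: "P > 0" "\<And>u. u \<in> X0 s \<Omega> \<Longrightarrow> (LINT x|M. (u x)\<^sup>2) \<le> P * frac_form s u u"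
    using Poincare_inequality by blast
  have g2: "integrable M (\<lambda>x. (g x)\<^sup>2)" by (rule AE_bounded_square_integrable[OF g])
  have "\<exists>\<phi>\<in>X0 s \<Omega>. \<forall>w\<in>X0 s \<Omega>. resolvent_form \<alpha> \<phi> w = (LINT x|M. g x * w x)"
  proof (rule Riesz_representation_fun[where C = "(LINT x|M. (g x)\<^sup>2) * P"])
    show "X0 s \<Omega> \<noteq> {}"
    proof -
      have "(\<lambda>x. 0) \<in> X0 s \<Omega>" by (simp add: X0_iff diff_quot_def)
      then show ?thesis by blast
    qed
    show "(LINT x|M. g x * (a * u x + b * v x)) = a * (LINT x|M. g x * u x) + b * (LINT x|M. g x * v x)"
      if "u \<in> X0 s \<Omega>" "v \<in> X0 s \<Omega>" for u v a b
    proof -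
      have "(LINT x|M. g x * (a * u x + b * v x)) = (LINT x|M. a * (g x * u x) + b * (g x * v x))"
        by (intro Bochner_Integration.integral_cong refl) (simp add: algebra_simps)
      also have "\<dots> = a * (LINT x|M. g x * u x) + b * (LINT x|M. g x * v x)"
        using AE_bounded_mult_integrable(1)[OF g X0_M(3)[OF that(1)]] AE_bounded_mult_integrable(1)[OF g X0_M(3)[OF that(2)]] by simp
      finally show ?thesis .
    qed
    show "(LINT x|M. g x * u x)\<^sup>2 \<le> (LINT x|M. (g x)\<^sup>2) * P * resolvent_form \<alpha> u u" if u: "u \<in> X0 s \<Omega>" for u
    proof -
      have "(LINT x|M. g x * u x)\<^sup>2 \<le> (LINT x|M. (g x)\<^sup>2) * (LINT x|M. (u x)\<^sup>2)"
        by (rule Cauchy_Schwarz_integral[OF g(1) X0_M(1)[OF u] g2 X0_M(2)[OF u]])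
      also have "\<dots> \<le> (LINT x|M. (g x)\<^sup>2) * (P * resolvent_form \<alpha> u u)"
      proof (rule mult_left_mono)
        have "P * frac_form s u u \<le> P * resolvent_form \<alpha> u u"
          using P(1) \<alpha> by (intro mult_left_mono) (auto simp: resolvent_form_self integral_M_nonneg)
        then show "(LINT x|M. (u x)\<^sup>2) \<le> P * resolvent_form \<alpha> u u" using P(2)[OF u] by linarith
      qed (rule integral_M_nonneg, simp)
      finally show ?thesis by (simp add: mult.assoc)
    qed
    show "0 \<le> (LINT x|M. (g x)\<^sup>2) * P" using P(1) by (simp add: integral_M_nonneg)
  qed (intro X0_lincomb resolvent_form_lincomb resolvent_form_sym resolvent_form_nonneg \<alpha> resolvent_form_complete; assumption)+
  then show ?thesis unfolding resolvent_form_def .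
qed

lemma ex_frac_lap:
  assumes "g \<in> borel_measurable M" "AE x in M. \<bar>g x\<bar> \<le> C"
  shows "\<exists>\<phi>. has_frac_lap s \<Omega> \<phi> g"
  using ex_resolvent[OF assms, of 0] unfolding has_frac_lap_def by auto

lemma has_frac_lap_symmetric:
  assumes "has_frac_lap s \<Omega> \<phi> g" "has_frac_lap s \<Omega> \<psi> m"
  shows "(LINT x|M. \<phi> x * m x) = (LINT x|M. g x * \<psi> x)"
  using assms frac_form_sym[of s \<phi> \<psi>] by (auto simp: has_frac_lap_def mult.commute)

lemma has_frac_lapD:
  assumes "has_frac_lap s \<Omega> \<phi> g"
  shows "\<phi> \<in> X0 s \<Omega>" "w \<in> X0 s \<Omega> \<Longrightarrow> frac_form s \<phi> w = (LINT x|M. g x * w x)"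
  using assms by (simp_all add: has_frac_lap_def)

lemma has_frac_lap_lincomb:
  assumes \<phi>: "has_frac_lap s \<Omega> \<phi> g" and \<psi>: "has_frac_lap s \<Omega> \<psi> m"
    and g: "g \<in> borel_measurable M" "AE x in M. \<bar>g x\<bar> \<le> C"
    and m: "m \<in> borel_measurable M" "AE x in M. \<bar>m x\<bar> \<le> D"
  shows "has_frac_lap s \<Omega> (\<lambda>x. a * \<phi> x + b * \<psi> x) (\<lambda>x. a * g x + b * m x)"
  unfolding has_frac_lap_def
proof (intro conjI ballI)
  note X = has_frac_lapD(1)[OF \<phi>] has_frac_lapD(1)[OF \<psi>]
  show "(\<lambda>x. a * \<phi> x + b * \<psi> x) \<in> X0 s \<Omega>" by (rule X0_lincomb[OF X])
  fix w assume w: "w \<in> X0 s \<Omega>"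
  have "(LINT x|M. (a * g x + b * m x) * w x) = (LINT x|M. a * (g x * w x) + b * (m x * w x))"
    by (intro Bochner_Integration.integral_cong refl) (simp add: algebra_simps)
  also have "\<dots> = a * (LINT x|M. g x * w x) + b * (LINT x|M. m x * w x)"
    using AE_bounded_mult_integrable(1)[OF g X0_M(3)[OF w]] AE_bounded_mult_integrable(1)[OF m X0_M(3)[OF w]] by simp
  also have "\<dots> = frac_form s (\<lambda>x. a * \<phi> x + b * \<psi> x) w"
    unfolding frac_form_lincomb[OF X w] has_frac_lapD(2)[OF \<phi> w] has_frac_lapD(2)[OF \<psi> w] ..
  finally show "frac_form s (\<lambda>x. a * \<phi> x + b * \<psi> x) w = (LINT x|M. (a * g x + b * m x) * w x)" by (rule sym)
qed

lemma frac_lap_L2_stability: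
  obtains P where "P > 0" "\<And>\<phi> \<psi> g m C D. has_frac_lap s \<Omega> \<phi> g \<Longrightarrow> has_frac_lap s \<Omega> \<psi> m \<Longrightarrow>
    g \<in> borel_measurable M \<Longrightarrow> (AE x in M. \<bar>g x\<bar> \<le> C) \<Longrightarrow> m \<in> borel_measurable M \<Longrightarrow> (AE x in M. \<bar>m x\<bar> \<le> D) \<Longrightarrow>
    (LINT x|M. (\<phi> x - \<psi> x)\<^sup>2) \<le> P * (LINT x|M. (g x - m x)\<^sup>2)"
proof -
  obtain P where P: "P > 0" "\<And>u. u \<in> X0 s \<Omega> \<Longrightarrow> (LINT x|M. (u x)\<^sup>2) \<le> P * frac_form s u u"
    using Poincare_inequality by blast
  have main: "(LINT x|M. (\<phi> x - \<psi> x)\<^sup>2) \<le> P\<^sup>2 * (LINT x|M. (g x - m x)\<^sup>2)"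
    if \<phi>: "has_frac_lap s \<Omega> \<phi> g" and \<psi>: "has_frac_lap s \<Omega> \<psi> m"
      and g: "g \<in> borel_measurable M" "AE x in M. \<bar>g x\<bar> \<le> C" and m: "m \<in> borel_measurable M" "AE x in M. \<bar>m x\<bar> \<le> D"
    for \<phi> \<psi> g m C D
  proof -
    define w where "w x = \<phi> x - \<psi> x" for x
    define k where "k x = g x - m x" for x
    have wk: "has_frac_lap s \<Omega> w k"
      using has_frac_lap_lincomb[OF \<phi> \<psi> g m, of 1 "-1"] by (simp add: w_def[abs_def] k_def[abs_def])
    note w = has_frac_lapD(1)[OF wk]
    note E = has_frac_lapD(2)[OF wk w]
    have k: "k \<in> borel_measurable M" unfolding k_def using g(1) m(1) by measurable
    have kb: "AE x in M. \<bar>k x\<bar> \<le> C + D" using g(2) m(2) by eventually_elim (auto simp: k_def)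
    define W where "W = (LINT x|M. (w x)\<^sup>2)"
    define K where "K = (LINT x|M. (k x)\<^sup>2)"
    have W0: "0 \<le> W" "0 \<le> K" unfolding W_def K_def by (rule integral_M_nonneg, simp)+
    have W1: "W \<le> P * (LINT x|M. k x * w x)" using P(2)[OF w] unfolding W_def E .
    have 1: "W\<^sup>2 \<le> P\<^sup>2 * (LINT x|M. k x * w x)\<^sup>2"
      using power_mono[OF W1 W0(1), of 2] by (simp only: power_mult_distrib)
    have "(LINT x|M. k x * w x)\<^sup>2 \<le> K * W"
      unfolding K_def W_def
      by (rule Cauchy_Schwarz_integral[OF k X0_M(1)[OF w] AE_bounded_square_integrable[OF k kb] X0_M(2)[OF w]])
    then have "P\<^sup>2 * (LINT x|M. k x * w x)\<^sup>2 \<le> P\<^sup>2 * (K * W)"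
      by (rule mult_left_mono) (rule zero_le_power2)
    with 1 have "W\<^sup>2 \<le> P\<^sup>2 * (K * W)" by (rule order_trans)
    then have sq: "W * W \<le> (P\<^sup>2 * K) * W" unfolding power2_eq_square[of W] mult.assoc .
    have "W \<le> P\<^sup>2 * K"
    proof (cases "W = 0")
      case False
      then have "W > 0" using W0 by linarith
      with sq show ?thesis by (rule mult_right_le_imp_le)
    qed (use W0 in simp)
    then have "(LINT x|M. (w x)\<^sup>2) \<le> P\<^sup>2 * (LINT x|M. (k x)\<^sup>2)" unfolding W_def K_def .
    then show ?thesis by (simp add: w_def k_def)
  qed
  show thesis by (rule that[of "P\<^sup>2"], use P(1) in simp) (rule main)
qed

end

section \<open>Integrability gain of the Dirichlet problem\<close>

text \<open>Stampacchia's lemma: along the levels \<open>K (1 - 2\<^sup>-\<^sup>n)\<close> the superlinear power beats the growth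
  \<open>2\<^sup>n\<close> of the factor and \<open>a\<close> decays geometrically.\<close>

lemma Stampacchia_lemma:
  fixes a :: "real \<Rightarrow> real"
  assumes a: "\<And>k. 0 \<le> a k" "\<And>k. a k \<le> V" "\<And>h k. k \<le> h \<Longrightarrow> a h \<le> a k" and "V > 0" "C > 0" "\<delta> > 0"
    and step: "\<And>k h. 0 \<le> k \<Longrightarrow> k < h \<Longrightarrow> (h - k) * a h \<le> C * a k powr (1 + \<delta>)"
  shows "a (2 * C * V powr \<delta> * 2 powr (1 / \<delta>)) = 0"
proof -
  define K where "K = 2 * C * V powr \<delta> * 2 powr (1 / \<delta>)"
  define r where "r = 2 powr (- 1 / \<delta>)"
  have K: "K > 0" unfolding K_def using \<open>C > 0\<close> \<open>V > 0\<close> by simp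
  have r: "0 < r" "r < 1" "r powr \<delta> = 1/2"
  proof -
    show "0 < r" unfolding r_def by simp
    show "r < 1" unfolding r_def using \<open>\<delta> > 0\<close> powr_less_mono[of "-1 / \<delta>" 0 2] by simp
    have "r powr \<delta> = 2 powr (-1)" unfolding r_def powr_powr using \<open>\<delta> > 0\<close> by simp
    then show "r powr \<delta> = 1/2" by (simp add: powr_minus)
  qed
  define k where "k n = K * (1 - (1/2) ^ n)" for n :: nat
  have decay: "a (k n) \<le> V * r ^ n" for n
  proof (induction n)
    case 0
    then show ?case using a(2) by simp
  next
    case (Suc n)
    have kk: "k (Suc n) - k n = K * (1/2) ^ Suc n" unfolding k_def by (simp add: algebra_simps)
    have "0 \<le> k n" unfolding k_def using K by (intro mult_nonneg_nonneg) (auto simp: power_le_one)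
    moreover have "k n < k (Suc n)" using kk mult_pos_pos[OF K, of "(1/2) ^ Suc n"] by simp
    ultimately have "K * (1/2) ^ Suc n * a (k (Suc n)) \<le> C * a (k n) powr (1 + \<delta>)"
      using step[of "k n" "k (Suc n)"] unfolding kk by simp
    also have "\<dots> \<le> C * (V * r ^ n) powr (1 + \<delta>)"
      using Suc \<open>C > 0\<close> \<open>\<delta> > 0\<close> a(1) by (intro mult_left_mono powr_mono2) auto
    also have "(V * r ^ n) powr (1 + \<delta>) = (V * r ^ n) * (V * r ^ n) powr \<delta>"
      using \<open>V > 0\<close> r(1) by (simp add: powr_add)
    also have "(V * r ^ n) powr \<delta> = V powr \<delta> * (1/2) ^ n"
      using r by (simp add: powr_mult powr_power powr_realpow[symmetric] powr_powr mult.commute) (simp add: powr_powr[symmetric] powr_realpow powr_minus r(3))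
    finally have "K * (1/2) ^ Suc n * a (k (Suc n)) \<le> (C * (V * V powr \<delta> * r ^ n)) * (1/2) ^ n"
      by (simp add: mult_ac)
    then have "(1/2) ^ n * (K * a (k (Suc n))) \<le> (1/2) ^ n * (2 * C * (V * V powr \<delta> * r ^ n))"
      by (simp add: mult_ac)
    then have "K * a (k (Suc n)) \<le> 2 * C * (V * V powr \<delta> * r ^ n)"
      by (rule mult_left_le_imp_le) simp
    also have "\<dots> = K * (V * r ^ Suc n)"
      unfolding K_def r_def by (simp add: powr_minus field_simps)
    finally show ?case using K by (rule mult_left_le_imp_le)
  qed
  have "a K \<le> V * r ^ n" for n
    using a(3)[of "k n" K] decay[of n] K unfolding k_def by (simp add: algebra_simps)
  moreover have "(\<lambda>n. V * r ^ n) \<longlonglongrightarrow> V * 0"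
    using r by (intro tendsto_intros LIMSEQ_power_zero) auto
  ultimately have "a K \<le> V * 0" by (intro LIMSEQ_le_const[of _ "V * 0" "a K"]) auto
  then show ?thesis using a(1)[of K] by (simp add: K_def)
qed

text \<open>The sublinear counterpart: a power \<open>1 - \<theta>\<close> forces the decay \<open>a k = O(k\<^sup>-\<^sup>1\<^sup>/\<^sup>\<theta>)\<close> of a function
  in weak \<open>L\<^sup>1\<^sup>/\<^sup>\<theta>\<close>.\<close>

lemma sublinear_level_decay:
  fixes a :: "real \<Rightarrow> real"
  assumes a: "\<And>k. 0 \<le> a k" "\<And>k. a k \<le> V" and "V > 0" "C > 0" "0 < \<theta>" "\<theta> < 1"
    and step: "\<And>k h. 0 \<le> k \<Longrightarrow> k < h \<Longrightarrow> (h - k) * a h \<le> C * a k powr (1 - \<theta>)"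
  shows "a (2 ^ n) \<le> max V ((C * 2 powr (1 / \<theta>)) powr (1 / \<theta>)) * (2 powr (- 1 / \<theta>)) ^ n"
proof (induction n)
  case 0
  then show ?case using a(2)[of 1] by (simp add: max.coboundedI1)
next
  case (Suc n)
  define K where "K = max V ((C * 2 powr (1 / \<theta>)) powr (1 / \<theta>))"
  define r where "r = 2 powr (- 1 / \<theta>)"
  have K: "K > 0" unfolding K_def using \<open>V > 0\<close> by (simp add: less_max_iff_disj)
  have r: "0 < r" "r powr (1 - \<theta>) = 2 * r"
  proof -
    show "0 < r" unfolding r_def by simp
    have "r powr (1 - \<theta>) = 2 powr (- 1 / \<theta> + 1)"
      unfolding r_def powr_powr using \<open>\<theta> > 0\<close> by (intro arg_cong2[where f = "(powr)"]) (simp_all add: field_simps)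
    also have "\<dots> = 2 * r" unfolding r_def powr_add by simp
    finally show "r powr (1 - \<theta>) = 2 * r" .
  qed
  have CK: "C / r \<le> K powr \<theta>"
  proof -
    have "C / r = ((C * 2 powr (1 / \<theta>)) powr (1 / \<theta>)) powr \<theta>"
      unfolding powr_powr r_def using \<open>C > 0\<close> \<open>\<theta> > 0\<close> by (simp add: powr_minus field_simps)
    also have "\<dots> \<le> K powr \<theta>" unfolding K_def using \<open>\<theta> > 0\<close> by (intro powr_mono2) auto
    finally show ?thesis .
  qed
  have "2 ^ n * a (2 ^ Suc n) \<le> C * a (2 ^ n) powr (1 - \<theta>)"
    using step[of "2 ^ n" "2 ^ Suc n"] by simp
  also have "\<dots> \<le> C * (K * r ^ n) powr (1 - \<theta>)"
    using Suc \<open>C > 0\<close> \<open>\<theta> < 1\<close> a(1) unfolding K_def r_def by (intro mult_left_mono powr_mono2) auto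
  also have "(K * r ^ n) powr (1 - \<theta>) = K powr (1 - \<theta>) * (2 * r) ^ n"
  proof -
    have "(r ^ n) powr (1 - \<theta>) = (r powr (1 - \<theta>)) ^ n"
      using r(1) by (simp add: powr_powr mult.commute flip: powr_realpow)
    then show ?thesis by (simp add: powr_mult r(2))
  qed
  also have "C * (K powr (1 - \<theta>) * (2 * r) ^ n) = 2 ^ n * ((C / r) * K powr (1 - \<theta>) * r ^ Suc n)"
    using r(1) by (simp add: power_mult_distrib field_simps)
  also have "\<dots> \<le> 2 ^ n * (K powr \<theta> * K powr (1 - \<theta>) * r ^ Suc n)"
    using CK r(1) by (intro mult_left_mono mult_right_mono) auto
  also have "K powr \<theta> * K powr (1 - \<theta>) = K" using K by (simp flip: powr_add)
  finally have "2 ^ n * a (2 ^ Suc n) \<le> 2 ^ n * (K * r ^ Suc n)" .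
  then have "a (2 ^ Suc n) \<le> K * r ^ Suc n" by (rule mult_left_le_imp_le) simp
  then show ?case unfolding K_def r_def .
qed

context dirichlet_domain
begin

definition level where "level \<phi> k = measure M {x \<in> \<Omega>. \<phi> x > (k :: real)}"

lemma level_set_sets:
  fixes \<phi> :: "'a \<Rightarrow> real"
  assumes "\<phi> \<in> borel_measurable M" shows "{x \<in> \<Omega>. \<phi> x > k} \<in> sets M"
proof -
  have "{x \<in> space M. \<phi> x > k} \<in> sets M" using assms by measurable
  then show ?thesis by simp
qed

lemma level_bounds:
  assumes "\<phi> \<in> borel_measurable M"
  shows "0 \<le> level \<phi> k" "level \<phi> k \<le> measure M \<Omega>" "k \<le> h \<Longrightarrow> level \<phi> h \<le> level \<phi> k"
proof -
  interpret finite_measure M by (rule finite_measure_M)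
  show "0 \<le> level \<phi> k" by (simp add: level_def)
  show "level \<phi> k \<le> measure M \<Omega>"
    unfolding level_def by (rule finite_measure_mono) (auto simp: sets.top[of M, simplified])
  show "level \<phi> h \<le> level \<phi> k" if "k \<le> h"
    unfolding level_def by (rule finite_measure_mono[OF _ level_set_sets[OF assms]]) (use that in auto)
qed

text \<open>The reciprocal of the constant in the Faber--Krahn inequality.\<close>

definition level_const where
  "level_const = 1 / (unit_ball_vol (real DIM('a)) / 2) powr (1 + 2 * s / real DIM('a))"

lemma level_const_pos: "level_const > 0"
  unfolding level_const_def using unit_ball_vol_pos[OF of_nat_0_le_iff, of "DIM('a)"]
  by (simp add: powr_gt_zero del: unit_ball_vol_pos)

text \<open>The truncation \<open>w\<close> of \<open>\<phi>\<close> between the levels \<open>k\<close> and \<open>h\<close> lives on \<open>{\<phi> > k}\<close> and equals \<open>h - k\<close>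
  on \<open>{\<phi> > h}\<close>. The Faber--Krahn inequality bounds its energy from below, and testing the equation
  with \<open>w\<close> bounds it from above by \<open>h - k\<close> times the integral of \<open>\<bar>g\<bar>\<close> over \<open>{\<phi> > k}\<close>. For that
  integral the linear bound \<open>\<bar>g\<bar> \<le> \<kappa> + \<kappa>\<^sup>1\<^sup>-\<^sup>\<rho> \<bar>g\<bar>\<^sup>\<rho>\<close> does the work of Hoelder's inequality.\<close>

lemma level_estimate:
  assumes \<phi>g: "has_frac_lap s \<Omega> \<phi> g" and g: "g \<in> borel_measurable M" "AE x in M. \<bar>g x\<bar> \<le> B" and "1 \<le> \<rho>"
    and I: "(LINT x|M. \<bar>g x\<bar> powr \<rho>) \<le> I" and kh: "0 \<le> k" "k < h"
  shows "(h - k) * level \<phi> h \<le> level_const * (1 + I) * level \<phi> k powr (1 - 1 / \<rho> + gain)"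
proof -
  interpret finite_measure M by (rule finite_measure_M)
  define c where "c = (unit_ball_vol (real DIM('a)) / 2) powr (1 + 2 * s / real DIM('a))"
  have lc: "level_const = 1 / c" unfolding level_const_def c_def ..
  have c: "c > 0" using level_const_pos unfolding lc by simp
    have \<phi>: "\<phi> \<in> X0 s \<Omega>" and eq: "\<And>w. w \<in> X0 s \<Omega> \<Longrightarrow> frac_form s \<phi> w = (LINT x|M. g x * w x)"
      by (rule has_frac_lapD[OF \<phi>g])+
    note \<phi>m = X0_M(1)[OF \<phi>]
    note [measurable] = g(1) \<phi>m
    define A where "A = {x \<in> \<Omega>. \<phi> x > k}"
    define A' where "A' = {x \<in> \<Omega>. \<phi> x > h}"
    have A[measurable]: "A \<in> sets M" "A' \<in> sets M" unfolding A_def A'_def by (rule level_set_sets[OF \<phi>m])+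
    define a where "a = level \<phi> k"
    define a' where "a' = level \<phi> h"
    have a: "a = measure M A" "a' = measure M A'" "0 \<le> a" "0 \<le> a'" "a' \<le> a"
    proof -
      show "a = measure M A" "a' = measure M A'" unfolding a_def a'_def A_def A'_def level_def by (rule refl)+
      show "0 \<le> a" "0 \<le> a'" unfolding a_def a'_def by (rule level_bounds(1)[OF \<phi>m])+
      show "a' \<le> a" unfolding a_def a'_def by (rule level_bounds(3)[OF \<phi>m less_imp_le[OF kh(2)]])
    qed
    have "0 \<le> (LINT x|M. \<bar>g x\<bar> powr \<rho>)" by (rule integral_M_nonneg) simp
    then have I0: "I \<ge> 0" using I by linarith
    show ?thesis
    proof (cases "a = 0")
      case True
      then have "a' = 0" using a(4,5) by linarith
      then show ?thesis using True unfolding a_def a'_def by simp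
    next
      case False
      then have a0: "a > 0" using a(3) by simp
      define T where "T t = min (max (t - k) 0) (h - k)" for t
      have T: "T \<in> borel_measurable borel" "T 0 = 0" "\<And>a b. \<bar>T a - T b\<bar> \<le> \<bar>a - b\<bar>" "mono T"
      proof -
        show "T \<in> borel_measurable borel" unfolding T_def by measurable
        show "T 0 = 0" unfolding T_def using kh by simp
        show "\<bar>T a - T b\<bar> \<le> \<bar>a - b\<bar>" for a b
          unfolding T_def using kh by (smt (verit) min_def max_def)
        show "mono T" unfolding T_def by (intro monoI min.mono max.mono diff_right_mono) simp_all
      qed
      define w where "w x = T (\<phi> x)" for x
      have w_eq: "w = (\<lambda>x. T (\<phi> x))" by (rule ext) (simp add: w_def)
      have w: "w \<in> X0 s \<Omega>" unfolding w_eq by (rule X0_contraction[OF \<phi> T(1-3)])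
      have w_range: "0 \<le> w x" "w x \<le> h - k" for x unfolding w_def T_def using kh by simp_all
      have w_A: "w x = 0" if "x \<in> \<Omega>" "x \<notin> A" for x using that kh unfolding w_def T_def A_def by simp
      have w_A': "w x = h - k" if "x \<in> A'" for x using that kh unfolding w_def T_def A'_def by simp
      have A_leb: "A \<in> sets lebesgue" using A(1) by (simp add: sets_restrict_space_iff)
      have A\<Omega>: "A \<subseteq> \<Omega>" unfolding A_def by blast
      have A_lm: "A \<in> lmeasurable" by (rule fmeasurableI2[OF \<Omega>_lmeasurable A\<Omega> A_leb])
      have ind: "integrable M (indicat_real A)" "integrable M (indicat_real A')"
        by (rule integrable_real_indicator; use A in \<open>simp add: emeasure_eq_measure\<close>)+
      have mA: "measure lebesgue A = a" unfolding a(1) by (rule measure_restrict_space[symmetric]) (use A\<Omega> in auto)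
      have FK: "c * a powr (- gain) * (LINT x|lebesgue. (w x)\<^sup>2) \<le> frac_form s w w"
        unfolding c_def gain_def
      proof (rule Faber_Krahn_inequality[OF w s_pos A_lm _ a0])
        have "AE x in lebesgue. x \<notin> \<Omega> \<longrightarrow> w x = 0" using w by (simp add: X0_iff)
        then show "AE x in lebesgue. x \<notin> A \<longrightarrow> w x = 0"
          by eventually_elim (metis w_A)
      qed (simp add: mA)
      have lower: "(h - k)\<^sup>2 * a' \<le> (LINT x|lebesgue. (w x)\<^sup>2)"
      proof -
        have "(h - k)\<^sup>2 * a' = (LINT x|M. (h - k)\<^sup>2 * indicator A' x)"
          unfolding a(2) using A'_def by (simp add: Int_absorb2)
        also have "\<dots> \<le> (LINT x|M. (w x)\<^sup>2)"
        proof (rule integral_mono)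
          show "integrable M (\<lambda>x. (h - k)\<^sup>2 * indicator A' x)" by (intro integrable_mult_right ind)
          show "(h - k)\<^sup>2 * indicator A' x \<le> (w x)\<^sup>2" for x using w_A'[of x] by (auto split: split_indicator)
        qed (rule X0_M(2)[OF w])
        finally show ?thesis unfolding X0_M(4)[OF w] .
      qed
      define \<kappa> where "\<kappa> = a powr (- 1 / \<rho>)"
      have \<kappa>: "\<kappa> > 0" unfolding \<kappa>_def using a0 by simp
      have young: "\<bar>t\<bar> \<le> \<kappa> + \<kappa> powr (1 - \<rho>) * \<bar>t\<bar> powr \<rho>" for t
      proof (cases "\<bar>t\<bar> \<le> \<kappa>")
        case False
        then have t: "\<bar>t\<bar> > \<kappa>" by simp
        have "\<bar>t\<bar> = \<bar>t\<bar> powr (1 - \<rho>) * \<bar>t\<bar> powr \<rho>" using t \<kappa> by (simp flip: powr_add)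
        also have "\<dots> \<le> \<kappa> powr (1 - \<rho>) * \<bar>t\<bar> powr \<rho>"
          using t \<kappa> \<open>1 \<le> \<rho>\<close> by (intro mult_right_mono powr_mono2') auto
        finally show ?thesis using \<kappa> by linarith
      qed (simp add: add_increasing2)
      have g\<rho>: "integrable M (\<lambda>x. \<bar>g x\<bar> powr \<rho>)"
      proof (rule integrable_const_bound[of _ "\<bar>B\<bar> powr \<rho>"])
        show "AE x in M. norm (\<bar>g x\<bar> powr \<rho>) \<le> \<bar>B\<bar> powr \<rho>"
          using g(2) by eventually_elim (use \<open>1 \<le> \<rho>\<close> in \<open>auto intro!: powr_mono2\<close>)
      qed measurable
      have "(LINT x|M. g x * w x) \<le> (LINT x|M. (h - k) * (\<kappa> * indicator A x + \<kappa> powr (1 - \<rho>) * \<bar>g x\<bar> powr \<rho>))"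
      proof (rule integral_mono)
        show "integrable M (\<lambda>x. g x * w x)" by (rule AE_bounded_mult_integrable(1)[OF g X0_M(3)[OF w]])
        show "integrable M (\<lambda>x. (h - k) * (\<kappa> * indicator A x + \<kappa> powr (1 - \<rho>) * \<bar>g x\<bar> powr \<rho>))"
          by (intro integrable_mult_right Bochner_Integration.integrable_add ind g\<rho>)
        fix x assume x: "x \<in> space M"
        show "g x * w x \<le> (h - k) * (\<kappa> * indicator A x + \<kappa> powr (1 - \<rho>) * \<bar>g x\<bar> powr \<rho>)"
        proof (cases "x \<in> A")
          case True
          have "g x * w x \<le> \<bar>g x\<bar> * (h - k)" using w_range[of x] by (intro mult_mono) auto
          also have "\<dots> \<le> (\<kappa> + \<kappa> powr (1 - \<rho>) * \<bar>g x\<bar> powr \<rho>) * (h - k)"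
            using young[of "g x"] kh by (intro mult_right_mono) auto
          finally show ?thesis using True by (simp add: mult.commute)
        next
          case False
          then show ?thesis using x w_A[of x] kh by simp
        qed
      qed
      also have "\<dots> = (h - k) * (\<kappa> * a + \<kappa> powr (1 - \<rho>) * (LINT x|M. \<bar>g x\<bar> powr \<rho>))"
        using g\<rho> A\<Omega> ind by (simp add: a(1) Int_absorb2)
      also have "\<dots> \<le> (h - k) * (\<kappa> * a + \<kappa> powr (1 - \<rho>) * I)"
        using I kh by (intro mult_left_mono add_left_mono) auto
      also have "\<kappa> * a = a powr (1 - 1 / \<rho>)"
      proof -
        have "\<kappa> * a = a powr (- 1 / \<rho>) * a powr 1" unfolding \<kappa>_def using a0 by simp
        also have "\<dots> = a powr (1 - 1 / \<rho>)" by (subst powr_add[symmetric]) simp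
        finally show ?thesis .
      qed
      also have "\<kappa> powr (1 - \<rho>) = a powr (1 - 1 / \<rho>)"
        unfolding \<kappa>_def powr_powr using \<open>1 \<le> \<rho>\<close> by (intro arg_cong2[where f = "(powr)"]) (simp_all add: field_simps)
      also have "(h - k) * (a powr (1 - 1 / \<rho>) + a powr (1 - 1 / \<rho>) * I) = (h - k) * ((1 + I) * a powr (1 - 1 / \<rho>))"
        by (simp add: algebra_simps)
      finally have upper: "(LINT x|M. g x * w x) \<le> (h - k) * ((1 + I) * a powr (1 - 1 / \<rho>))" .
      have "c * a powr (- gain) * ((h - k)\<^sup>2 * a') \<le> c * a powr (- gain) * (LINT x|lebesgue. (w x)\<^sup>2)"
        using c by (intro mult_left_mono lower) auto
      also have "\<dots> \<le> frac_form s w w" by (rule FK)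
      also have "\<dots> \<le> frac_form s \<phi> w" unfolding w_eq by (rule frac_form_contraction[OF \<phi> T])
      also have "\<dots> \<le> (h - k) * ((1 + I) * a powr (1 - 1 / \<rho>))" unfolding eq[OF w] by (rule upper)
      finally have "(h - k) * (c * a powr (- gain) * ((h - k) * a')) \<le> (h - k) * ((1 + I) * a powr (1 - 1 / \<rho>))"
        by (simp only: power2_eq_square mult_ac)
      then have "c * a powr (- gain) * ((h - k) * a') \<le> (1 + I) * a powr (1 - 1 / \<rho>)"
        by (rule mult_left_le_imp_le) (use kh in simp)
      then have 1: "a powr gain * (c * a powr (- gain) * ((h - k) * a')) \<le> a powr gain * ((1 + I) * a powr (1 - 1 / \<rho>))"
        by (intro mult_left_mono) auto
      have 2: "a powr gain * a powr (- gain) = 1" using a0 by (simp flip: powr_add)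
      have 3: "a powr gain * a powr (1 - 1 / \<rho>) = a powr (1 - 1 / \<rho> + gain)" by (simp add: powr_add)
      have "c * ((h - k) * a') = (a powr gain * a powr (- gain)) * (c * ((h - k) * a'))" unfolding 2 by simp
      also have "\<dots> = a powr gain * (c * a powr (- gain) * ((h - k) * a'))" by (simp only: mult_ac)
      also note 1
      also have "a powr gain * ((1 + I) * a powr (1 - 1 / \<rho>)) = (1 + I) * (a powr gain * a powr (1 - 1 / \<rho>))"
        by (simp only: mult_ac)
      finally have "c * ((h - k) * a') \<le> (1 + I) * a powr (1 - 1 / \<rho> + gain)" unfolding 3 .
      then have "(h - k) * a' \<le> (1 + I) * a powr (1 - 1 / \<rho> + gain) / c"
        using c by (simp add: pos_le_divide_eq mult.commute)
      then show ?thesis unfolding a_def a'_def lc by simp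
    qed
qed

lemma has_frac_lap_uminus:
  assumes "has_frac_lap s \<Omega> \<phi> g" "g \<in> borel_measurable M" "AE x in M. \<bar>g x\<bar> \<le> B"
  shows "has_frac_lap s \<Omega> (\<lambda>x. - \<phi> x) (\<lambda>x. - g x)"
  using has_frac_lap_lincomb[OF assms(1,1,2,3,2,3), of "-1" 0] by simp

lemma uniform_sup_bound:
  assumes "1 \<le> \<rho>" "1 / \<rho> < gain"
  obtains K where "\<And>\<phi> g B. has_frac_lap s \<Omega> \<phi> g \<Longrightarrow> g \<in> borel_measurable M \<Longrightarrow>
    (AE x in M. \<bar>g x\<bar> \<le> B) \<Longrightarrow> (LINT x|M. \<bar>g x\<bar> powr \<rho>) \<le> I \<Longrightarrow> AE x in M. \<bar>\<phi> x\<bar> \<le> K"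
proof -
  interpret finite_measure M by (rule finite_measure_M)
  define V where "V = measure M \<Omega> + 1"
  have V: "V > 0" unfolding V_def by (simp add: add_nonneg_pos)
  define \<delta> where "\<delta> = gain - 1 / \<rho>"
  have \<delta>: "\<delta> > 0" unfolding \<delta>_def using assms by simp
  define D where "D = level_const * (1 + \<bar>I\<bar>)"
  have D: "D > 0" unfolding D_def using level_const_pos by simp
  define K where "K = 2 * D * V powr \<delta> * 2 powr (1 / \<delta>)"
  have one_side: "AE x in M. \<phi> x \<le> K"
    if \<phi>g: "has_frac_lap s \<Omega> \<phi> g" and g: "g \<in> borel_measurable M" "AE x in M. \<bar>g x\<bar> \<le> B"
      and I: "(LINT x|M. \<bar>g x\<bar> powr \<rho>) \<le> I" for \<phi> g B
  proof -
    have \<phi>: "\<phi> \<in> borel_measurable M" by (rule X0_M(1)[OF has_frac_lapD(1)[OF \<phi>g]])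
    have "level \<phi> K = 0"
      unfolding K_def
    proof (rule Stampacchia_lemma[OF _ _ _ V D \<delta>])
      show "0 \<le> level \<phi> k" for k by (rule level_bounds[OF \<phi>])
      show "level \<phi> k \<le> V" for k using level_bounds(2)[OF \<phi>, of k] unfolding V_def by linarith
      show "level \<phi> h \<le> level \<phi> k" if "k \<le> h" for h k by (rule level_bounds(3)[OF \<phi> that])
      have e: "1 - 1 / \<rho> + gain = 1 + \<delta>" by (simp add: \<delta>_def)
      show "(h - k) * level \<phi> h \<le> D * level \<phi> k powr (1 + \<delta>)" if "0 \<le> k" "k < h" for k h
        using level_estimate[OF \<phi>g g assms(1) order_trans[OF I abs_ge_self] that] unfolding D_def e .
    qed
    then have "AE x in M. x \<notin> {x \<in> \<Omega>. \<phi> x > K}"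
      using level_set_sets[OF \<phi>, of K] unfolding level_def
      by (intro AE_not_in null_setsI) (auto simp: emeasure_eq_measure)
    then show ?thesis using AE_space by eventually_elim auto
  qed
  show thesis
  proof (rule that[of K])
    fix \<phi> g B assume *: "has_frac_lap s \<Omega> \<phi> g" "g \<in> borel_measurable M" "AE x in M. \<bar>g x\<bar> \<le> B" "(LINT x|M. \<bar>g x\<bar> powr \<rho>) \<le> I"
    have "AE x in M. - \<phi> x \<le> K"
      by (rule one_side[OF has_frac_lap_uminus[OF *(1-3)], of B]) (use * in auto)
    then show "AE x in M. \<bar>\<phi> x\<bar> \<le> K" using one_side[OF *] by eventually_elim auto
  qed
qed

lemma uniform_Lp_bound:
  assumes "1 \<le> \<rho>" "0 < \<tau>" "1 / \<rho> - gain < 1 / \<tau>"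
  obtains K where "K < \<infinity>" "\<And>\<phi> g B. has_frac_lap s \<Omega> \<phi> g \<Longrightarrow> g \<in> borel_measurable M \<Longrightarrow>
    (AE x in M. \<bar>g x\<bar> \<le> B) \<Longrightarrow> (LINT x|M. \<bar>g x\<bar> powr \<rho>) \<le> I \<Longrightarrow> (\<integral>\<^sup>+x. ennreal (\<bar>\<phi> x\<bar> powr \<tau>) \<partial>M) \<le> K"
proof -
  interpret finite_measure M by (rule finite_measure_M)
  define V where "V = measure M \<Omega> + 1"
  have V: "V > 0" unfolding V_def by (simp add: add_nonneg_pos)
  have "max (1 / \<rho> - gain) 0 < min (1 / \<tau>) 1"
  proof -
    have "1 / \<rho> \<le> 1" "0 < 1 / \<tau>" using assms(1,2) by simp_all
    then show ?thesis using assms(3) gain_pos by simp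
  qed
  then obtain \<theta> where \<theta>': "max (1 / \<rho> - gain) 0 < \<theta>" "\<theta> < min (1 / \<tau>) 1" using dense by blast
  then have \<theta>: "1 / \<rho> - gain \<le> \<theta>" "0 < \<theta>" "\<theta> < 1" "\<theta> < 1 / \<tau>" by auto
  define D where "D = level_const * (1 + \<bar>I\<bar>) * V powr (\<theta> - 1 / \<rho> + gain)"
  have D: "D > 0" unfolding D_def using level_const_pos V by simp
  define L where "L = max V ((D * 2 powr (1 / \<theta>)) powr (1 / \<theta>))"
  have L: "L > 0" unfolding L_def using V by (simp add: less_max_iff_disj)
  define q where "q = 2 powr (\<tau> - 1 / \<theta>)"
  have q: "0 < q" "q < 1"
    unfolding q_def using \<theta> \<open>0 < \<tau>\<close> powr_less_mono[of "\<tau> - 1 / \<theta>" 0 2] by (auto simp: field_simps)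
  define K1 where "K1 = V + (\<Sum>n. 2 powr \<tau> * L * q ^ n)"
  have sm: "summable (\<lambda>n. 2 powr \<tau> * L * q ^ n)" using q by (intro summable_mult summable_geometric) simp
  have one_side: "(\<integral>\<^sup>+x. ennreal ((max (\<phi> x) 0) powr \<tau>) \<partial>M) \<le> ennreal K1"
    if \<phi>g: "has_frac_lap s \<Omega> \<phi> g" and g: "g \<in> borel_measurable M" "AE x in M. \<bar>g x\<bar> \<le> B"
      and I: "(LINT x|M. \<bar>g x\<bar> powr \<rho>) \<le> I" for \<phi> g B
  proof -
    have \<phi>[measurable]: "\<phi> \<in> borel_measurable M" by (rule X0_M(1)[OF has_frac_lapD(1)[OF \<phi>g]])
    have lV: "level \<phi> k \<le> V" for k using level_bounds(2)[OF \<phi>, of k] unfolding V_def by linarith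
    have l0: "0 \<le> level \<phi> k" for k by (rule level_bounds[OF \<phi>])
    have dec: "level \<phi> (2 ^ n) \<le> L * (2 powr (- 1 / \<theta>)) ^ n" for n
      unfolding L_def
    proof (rule sublinear_level_decay[OF l0 lV V D \<theta>(2,3)])
      fix k h :: real assume kh: "0 \<le> k" "k < h"
      have "(h - k) * level \<phi> h \<le> level_const * (1 + \<bar>I\<bar>) * level \<phi> k powr (1 - 1 / \<rho> + gain)"
        by (rule level_estimate[OF \<phi>g g assms(1) order_trans[OF I abs_ge_self] kh])
      also have "level \<phi> k powr (1 - 1 / \<rho> + gain) = level \<phi> k powr (1 - \<theta>) * level \<phi> k powr (\<theta> - 1 / \<rho> + gain)"
        by (simp flip: powr_add add: algebra_simps)
      also have "level_const * (1 + \<bar>I\<bar>) * \<dots>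
          \<le> level_const * (1 + \<bar>I\<bar>) * (level \<phi> k powr (1 - \<theta>) * V powr (\<theta> - 1 / \<rho> + gain))"
        using \<theta>(1) level_const_pos by (intro mult_left_mono powr_mono2 l0 lV) auto
      also have "\<dots> = D * level \<phi> k powr (1 - \<theta>)" unfolding D_def by (simp only: mult_ac)
      finally show "(h - k) * level \<phi> h \<le> D * level \<phi> k powr (1 - \<theta>)" .
    qed
    let ?A = "\<lambda>n. {x \<in> \<Omega>. \<phi> x > 2 ^ n}"
    have A[measurable]: "?A n \<in> sets M" for n by (rule level_set_sets[OF \<phi>])
    have "(\<integral>\<^sup>+x. ennreal ((max (\<phi> x) 0) powr \<tau>) \<partial>M)
        \<le> (\<integral>\<^sup>+x. indicator \<Omega> x + (\<Sum>n. ennreal ((2 ^ Suc n) powr \<tau>) * indicator (?A n) x) \<partial>M)"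
    proof (rule nn_integral_mono)
      fix x assume x: "x \<in> space M"
      show "ennreal ((max (\<phi> x) 0) powr \<tau>) \<le> indicator \<Omega> x + (\<Sum>n. ennreal ((2 ^ Suc n) powr \<tau>) * indicator (?A n) x)"
      proof (cases "\<phi> x \<le> 1")
        case True
        have "(max (\<phi> x) 0) powr \<tau> \<le> 1 powr \<tau>" using True \<open>0 < \<tau>\<close> by (intro powr_mono2) auto
        then have "ennreal ((max (\<phi> x) 0) powr \<tau>) \<le> indicator \<Omega> x" using x by simp
        then show ?thesis by (rule add_increasing2[OF zero_le])
      next
        case False
        have ex: "\<exists>n. \<phi> x \<le> 2 ^ Suc n"
        proof -
          obtain n where "\<phi> x < 2 ^ n" using real_arch_pow[of 2 "\<phi> x"] by auto
          moreover have "(2 :: real) ^ n \<le> 2 ^ Suc n" by simp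
          ultimately show ?thesis by (intro exI[of _ n]) linarith
        qed
        define n where "n = (LEAST n. \<phi> x \<le> 2 ^ Suc n)"
        have n: "\<phi> x \<le> 2 ^ Suc n" unfolding n_def by (rule LeastI_ex[OF ex])
        have n': "2 ^ n < \<phi> x"
        proof (cases n)
          case 0 then show ?thesis using False by simp
        next
          case (Suc m)
          then have "\<not> \<phi> x \<le> 2 ^ Suc m" using not_less_Least[of m "\<lambda>n. \<phi> x \<le> 2 ^ Suc n"] unfolding n_def by simp
          then show ?thesis using Suc by simp
        qed
        have "(max (\<phi> x) 0) powr \<tau> \<le> (2 ^ Suc n) powr \<tau>" using n \<open>0 < \<tau>\<close> by (intro powr_mono2) auto
        then have "ennreal ((max (\<phi> x) 0) powr \<tau>) \<le> ennreal ((2 ^ Suc n) powr \<tau>) * indicator (?A n) x"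
          using n' x by (simp add: ennreal_leI)
        also have "\<dots> \<le> (\<Sum>n. ennreal ((2 ^ Suc n) powr \<tau>) * indicator (?A n) x)"
          by (rule ennreal_le_suminf)
        finally show ?thesis by (rule add_increasing[OF zero_le])
      qed
    qed
    also have "\<dots> = emeasure M \<Omega> + (\<Sum>n. ennreal ((2 ^ Suc n) powr \<tau>) * emeasure M (?A n))"
    proof -
      have 1: "(\<lambda>x. ennreal ((2 ^ Suc n) powr \<tau>) * indicator (?A n) x) \<in> borel_measurable M" for n
        by (intro borel_measurable_times_ennreal borel_measurable_const borel_measurable_indicator A)
      have 2: "indicator \<Omega> \<in> borel_measurable M" by (intro borel_measurable_indicator) (metis sets.top space_M)
      have 3: "\<Omega> \<in> sets M" by (metis sets.top space_M)
      show ?thesis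
        unfolding nn_integral_add[OF 2 borel_measurable_suminf_order[OF 1]] nn_integral_suminf[OF 1]
          nn_integral_cmult_indicator[OF A] nn_integral_indicator[OF 3] ..
    qed
    also have "\<dots> \<le> ennreal V + (\<Sum>n. ennreal (2 powr \<tau> * L * q ^ n))"
    proof (intro add_mono suminf_le)
      show "emeasure M \<Omega> \<le> ennreal V" unfolding emeasure_eq_measure V_def by (intro ennreal_leI) simp
      fix n
      have "(2 ^ Suc n) powr \<tau> * level \<phi> (2 ^ n) \<le> (2 ^ Suc n) powr \<tau> * (L * (2 powr (- 1 / \<theta>)) ^ n)"
        by (intro mult_left_mono dec) simp
      also have "\<dots> = 2 powr \<tau> * L * q ^ n"
      proof -
        have "((2 :: real) ^ n) powr \<tau> = (2 powr \<tau>) ^ n" by (simp add: powr_powr mult.commute flip: powr_realpow)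
        moreover have "q = 2 powr \<tau> * 2 powr (- 1 / \<theta>)" unfolding q_def by (simp flip: powr_add)
        ultimately show ?thesis by (simp add: powr_mult power_mult_distrib)
      qed
      finally show "ennreal ((2 ^ Suc n) powr \<tau>) * emeasure M (?A n) \<le> ennreal (2 powr \<tau> * L * q ^ n)"
        unfolding emeasure_eq_measure level_def[symmetric] by (subst ennreal_mult[symmetric]) (auto intro!: ennreal_leI l0)
    qed auto
    also have "(\<Sum>n. ennreal (2 powr \<tau> * L * q ^ n)) = ennreal (\<Sum>n. 2 powr \<tau> * L * q ^ n)"
      using L q by (intro suminf_ennreal2 sm) simp
    also have "ennreal V + \<dots> = ennreal K1"
      unfolding K1_def using V L q by (intro ennreal_plus[symmetric] suminf_nonneg sm) auto
    finally show ?thesis .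
  qed
  show thesis
  proof (rule that[of "ennreal K1 + ennreal K1"])
    show "ennreal K1 + ennreal K1 < \<infinity>" by simp
    fix \<phi> g B assume *: "has_frac_lap s \<Omega> \<phi> g" "g \<in> borel_measurable M" "AE x in M. \<bar>g x\<bar> \<le> B" "(LINT x|M. \<bar>g x\<bar> powr \<rho>) \<le> I"
    have [measurable]: "\<phi> \<in> borel_measurable M" by (rule X0_M(1)[OF has_frac_lapD(1)[OF *(1)]])
    have "(\<integral>\<^sup>+x. ennreal (\<bar>\<phi> x\<bar> powr \<tau>) \<partial>M)
        = (\<integral>\<^sup>+x. ennreal ((max (\<phi> x) 0) powr \<tau>) + ennreal ((max (- \<phi> x) 0) powr \<tau>) \<partial>M)"
      by (intro nn_integral_cong) (auto simp: max_def)
    also have "\<dots> = (\<integral>\<^sup>+x. ennreal ((max (\<phi> x) 0) powr \<tau>) \<partial>M) + (\<integral>\<^sup>+x. ennreal ((max (- \<phi> x) 0) powr \<tau>) \<partial>M)"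
      by (rule nn_integral_add) measurable
    also have "\<dots> \<le> ennreal K1 + ennreal K1"
    proof (rule add_mono)
      show "(\<integral>\<^sup>+x. ennreal ((max (\<phi> x) 0) powr \<tau>) \<partial>M) \<le> ennreal K1" by (rule one_side[OF *])
      show "(\<integral>\<^sup>+x. ennreal ((max (- \<phi> x) 0) powr \<tau>) \<partial>M) \<le> ennreal K1"
        by (rule one_side[OF has_frac_lap_uminus[OF *(1-3)], of B]) (use * in auto)
    qed
    finally show "(\<integral>\<^sup>+x. ennreal (\<bar>\<phi> x\<bar> powr \<tau>) \<partial>M) \<le> ennreal K1 + ennreal K1" .
  qed
qed


section \<open>Very weak solutions\<close>

lemma powr_integrable_of_bounded:
  assumes "g \<in> borel_measurable M" "AE x in M. \<bar>g x\<bar> \<le> C" "0 \<le> r"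
  shows "integrable M (\<lambda>x. \<bar>g x\<bar> powr r)" "(LINT x|M. \<bar>g x\<bar> powr r) \<le> \<bar>C\<bar> powr r * measure M \<Omega>"
proof -
  interpret finite_measure M by (rule finite_measure_M)
  note [measurable] = assms(1)
  have b: "AE x in M. \<bar>g x\<bar> powr r \<le> \<bar>C\<bar> powr r"
    using assms(2)
  proof eventually_elim
    case (elim x)
    then show ?case using assms(3) by (intro powr_mono2) auto
  qed
  show i: "integrable M (\<lambda>x. \<bar>g x\<bar> powr r)"
  proof (rule integrable_const_bound[of _ "\<bar>C\<bar> powr r"])
    show "AE x in M. norm (\<bar>g x\<bar> powr r) \<le> \<bar>C\<bar> powr r" using b by eventually_elim simp
  qed measurable
  have "(LINT x|M. \<bar>g x\<bar> powr r) \<le> (LINT x|M. \<bar>C\<bar> powr r)"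
    by (rule integral_mono_AE[OF i _ b]) simp
  then show "(LINT x|M. \<bar>g x\<bar> powr r) \<le> \<bar>C\<bar> powr r * measure M \<Omega>" by (simp add: mult.commute)
qed

lemma large_exponent: "1 \<le> max 1 (2 / gain)" "1 / max 1 (2 / gain) < gain"
proof -
  have "1 / max 1 (2 / gain) \<le> 1 / (2 / gain)"
    using gain_pos by (intro divide_left_mono) (auto intro!: mult_pos_pos simp: less_max_iff_disj)
  also have "\<dots> < gain" using gain_pos by simp
  finally show "1 / max 1 (2 / gain) < gain" .
qed simp

lemma sup_bound:
  obtains K where "\<And>\<phi> g. has_frac_lap s \<Omega> \<phi> g \<Longrightarrow> g \<in> borel_measurable M \<Longrightarrow>
    (AE x in M. \<bar>g x\<bar> \<le> C) \<Longrightarrow> AE x in M. \<bar>\<phi> x\<bar> \<le> K"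
proof -
  define \<rho> where "\<rho> = max 1 (2 / gain)"
  note \<rho> = large_exponent[folded \<rho>_def]
  obtain K where K: "\<And>\<phi> g B. has_frac_lap s \<Omega> \<phi> g \<Longrightarrow> g \<in> borel_measurable M \<Longrightarrow>
    (AE x in M. \<bar>g x\<bar> \<le> B) \<Longrightarrow> (LINT x|M. \<bar>g x\<bar> powr \<rho>) \<le> \<bar>C\<bar> powr \<rho> * measure M \<Omega> \<Longrightarrow> AE x in M. \<bar>\<phi> x\<bar> \<le> K"
    using uniform_sup_bound[OF \<rho>, of "\<bar>C\<bar> powr \<rho> * measure M \<Omega>"] by blast
  show thesis
  proof (rule that[of K])
    fix \<phi> g assume *: "has_frac_lap s \<Omega> \<phi> g" "g \<in> borel_measurable M" "AE x in M. \<bar>g x\<bar> \<le> C"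
    have "0 \<le> \<rho>" using \<rho>(1) by simp
    from K[OF * powr_integrable_of_bounded(2)[OF *(2,3) this]] show "AE x in M. \<bar>\<phi> x\<bar> \<le> K" .
  qed
qed

lemma frac_lap_bounded:
  assumes "has_frac_lap s \<Omega> \<phi> g" "g \<in> borel_measurable M" "AE x in M. \<bar>g x\<bar> \<le> C"
  shows "\<exists>K. AE x in M. \<bar>\<phi> x\<bar> \<le> K"
proof -
  obtain K where "\<And>\<phi> g. has_frac_lap s \<Omega> \<phi> g \<Longrightarrow> g \<in> borel_measurable M \<Longrightarrow>
    (AE x in M. \<bar>g x\<bar> \<le> C) \<Longrightarrow> AE x in M. \<bar>\<phi> x\<bar> \<le> K"
    using sup_bound[of C] by blast
  from this[OF assms] show ?thesis ..
qed

lemma Cc_infty_M: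
  assumes "g \<in> Cc_infty \<Omega>"
  shows "g \<in> borel_measurable M" "\<exists>C. AE x in M. \<bar>g x\<bar> \<le> C"
proof -
  show "g \<in> borel_measurable M"
    by (rule X0_M(1)[OF Cc_infty_subset_X0[OF s_pos s_less_1 open_\<Omega> bounded_\<Omega> assms]])
  show "\<exists>C. AE x in M. \<bar>g x\<bar> \<le> C" using Cc_infty_bounded[OF assms] by auto
qed

lemma L1_M: "f \<in> Lp 1 \<Omega> \<longleftrightarrow> integrable M f"
proof
  assume "f \<in> Lp 1 \<Omega>"
  then have "f \<in> borel_measurable M" "integrable M (\<lambda>x. \<bar>f x\<bar>)" by (auto simp: Lp_def)
  then show "integrable M f" using integrable_abs_cancel by blast
qed (auto simp: Lp_def)

lemma L2_subseq_AE:
  fixes f :: "nat \<Rightarrow> 'a \<Rightarrow> real"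
  assumes "\<And>n. integrable M (\<lambda>x. (f n x)\<^sup>2)" "(\<lambda>n. LINT x|M. (f n x)\<^sup>2) \<longlonglongrightarrow> 0"
  obtains r :: "nat \<Rightarrow> nat" where "strict_mono r" "AE x in M. (\<lambda>n. f (r n) x) \<longlonglongrightarrow> 0"
proof -
  have "(\<lambda>n. LINT x|M. norm ((f n x)\<^sup>2)) \<longlonglongrightarrow> 0" using assms(2) by simp
  from tendsto_L1_AE_subseq[OF assms(1) this]
  obtain r where r: "strict_mono r" "AE x in M. (\<lambda>n. (f (r n) x)\<^sup>2) \<longlonglongrightarrow> 0" by blast
  have "AE x in M. (\<lambda>n. f (r n) x) \<longlonglongrightarrow> 0"
    using r(2) by eventually_elim simp
  with r(1) show thesis by (rule that)
qed

lemma bounded_dominated_convergence: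
  fixes f :: "'a \<Rightarrow> real"
  assumes f: "integrable M f" and g: "\<And>n. g n \<in> borel_measurable M" "g' \<in> borel_measurable M"
    and C: "\<And>n. AE x in M. \<bar>g n x\<bar> \<le> C" and lim: "AE x in M. (\<lambda>n. g n x) \<longlonglongrightarrow> g' x"
  shows "(\<lambda>n. LINT x|M. f x * g n x) \<longlonglongrightarrow> (LINT x|M. f x * g' x)"
proof (rule integral_dominated_convergence[where w = "\<lambda>x. \<bar>f x\<bar> * C"])
  have [measurable]: "f \<in> borel_measurable M" using f by auto
  note [measurable] = g
  show "(\<lambda>x. f x * g' x) \<in> borel_measurable M" "(\<lambda>x. f x * g n x) \<in> borel_measurable M" for n by measurable
  show "integrable M (\<lambda>x. \<bar>f x\<bar> * C)" using f by simp
  show "AE x in M. (\<lambda>n. f x * g n x) \<longlonglongrightarrow> f x * g' x"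
    using lim by eventually_elim (intro tendsto_intros)
  show "AE x in M. norm (f x * g n x) \<le> \<bar>f x\<bar> * C" for n
    using C[of n] by eventually_elim (simp add: abs_mult mult_left_mono)
qed

text \<open>The defining identity passes from smooth to bounded right hand sides \<open>m\<close>: it is stable under
  bounded almost everywhere limits, since the solution operator is continuous in \<open>L\<^sup>2\<close> and maps bounded
  sets of \<open>L\<^sup>\<infinity>\<close> to bounded sets.\<close>

lemma vw_frac_lap_bounded_test:
  assumes u: "integrable M u" and f: "integrable M f" and vw: "vw_frac_lap s \<Omega> u f"
    and m: "m \<in> borel_measurable M" "AE x in M. \<bar>m x\<bar> \<le> C" and \<phi>: "has_frac_lap s \<Omega> \<phi> m"
  shows "(LINT x|M. u x * m x) = (LINT x|M. f x * \<phi> x)"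
proof -
  have "\<forall>\<phi>. has_frac_lap s \<Omega> \<phi> m \<longrightarrow> (LINT x|M. u x * m x) = (LINT x|M. f x * \<phi> x)"
    using open_\<Omega> bounded_\<Omega> m
  proof (induction rule: bounded_measurable_induct_Cc_infty)
    case (smooth g)
    show ?case
    proof (intro allI impI)
      fix \<phi> assume "has_frac_lap s \<Omega> \<phi> g"
      then show "(LINT x|M. u x * g x) = (LINT x|M. f x * \<phi> x)"
        using smooth vw has_frac_lapD(1) unfolding vw_frac_lap_def test_fun_def by blast
    qed
  next
    case (limit g g' C)
    interpret finite_measure M by (rule finite_measure_M)
    show ?case
    proof (intro allI impI)
      fix \<phi> assume \<phi>: "has_frac_lap s \<Omega> \<phi> g'"
      note [measurable] = limit(2,4)
      have g'C: "AE x in M. \<bar>g' x\<bar> \<le> C"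
      proof -
        have "AE x in M. \<forall>n. \<bar>g n x\<bar> \<le> C" using limit(3) by (simp add: AE_all_countable)
        with limit(5) show ?thesis
        proof eventually_elim
          case (elim x)
          show ?case by (rule LIMSEQ_le_const2[OF tendsto_rabs[OF elim(1)]]) (use elim(2) in auto)
        qed
      qed
      have "\<exists>\<psi>. has_frac_lap s \<Omega> \<psi> (g n)" for n by (rule ex_frac_lap[OF limit(2,3)])
      then obtain \<psi> where \<psi>: "\<And>n. has_frac_lap s \<Omega> (\<psi> n) (g n)" by metis
      obtain P where P: "P > 0" "\<And>\<phi> \<psi> g m C D. has_frac_lap s \<Omega> \<phi> g \<Longrightarrow> has_frac_lap s \<Omega> \<psi> m \<Longrightarrow>
        g \<in> borel_measurable M \<Longrightarrow> (AE x in M. \<bar>g x\<bar> \<le> C) \<Longrightarrow> m \<in> borel_measurable M \<Longrightarrow> (AE x in M. \<bar>m x\<bar> \<le> D) \<Longrightarrow>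
        (LINT x|M. (\<phi> x - \<psi> x)\<^sup>2) \<le> P * (LINT x|M. (g x - m x)\<^sup>2)"
        using frac_lap_L2_stability by blast
      have "(\<lambda>n. LINT x|M. (g n x - g' x)\<^sup>2) \<longlonglongrightarrow> (LINT x|M. 0)"
      proof (rule integral_dominated_convergence[where w = "\<lambda>x. (2 * C)\<^sup>2"])
        show "AE x in M. (\<lambda>n. (g n x - g' x)\<^sup>2) \<longlonglongrightarrow> 0"
          using limit(5)
        proof eventually_elim
          case (elim x)
          then have "(\<lambda>n. (g n x - g' x)\<^sup>2) \<longlonglongrightarrow> (g' x - g' x)\<^sup>2" by (intro tendsto_intros)
          then show ?case by simp
        qed
        show "AE x in M. norm ((g n x - g' x)\<^sup>2) \<le> (2 * C)\<^sup>2" for n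
          using limit(3)[of n] g'C
        proof eventually_elim
          case (elim x)
          then have "\<bar>g n x - g' x\<bar> \<le> 2 * C" by linarith
          from power_mono[OF this abs_ge_zero, of 2] show ?case by simp
        qed
      qed measurable
      then have gl: "(\<lambda>n. P * (LINT x|M. (g n x - g' x)\<^sup>2)) \<longlonglongrightarrow> P * 0" by (intro tendsto_mult tendsto_const) simp
      have "(\<lambda>n. LINT x|M. (\<psi> n x - \<phi> x)\<^sup>2) \<longlonglongrightarrow> 0"
      proof (rule tendsto_sandwich[OF _ _ tendsto_const])
        show "(\<lambda>n. P * (LINT x|M. (g n x - g' x)\<^sup>2)) \<longlonglongrightarrow> 0" using gl by simp
        show "\<forall>\<^sub>F n in sequentially. 0 \<le> (LINT x|M. (\<psi> n x - \<phi> x)\<^sup>2)" by (simp add: integral_M_nonneg)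
        show "\<forall>\<^sub>F n in sequentially. (LINT x|M. (\<psi> n x - \<phi> x)\<^sup>2) \<le> P * (LINT x|M. (g n x - g' x)\<^sup>2)"
          by (intro always_eventually allI P(2)[OF \<psi> \<phi> limit(2,3,4) g'C])
      qed
      moreover have "integrable M (\<lambda>x. (\<psi> n x - \<phi> x)\<^sup>2)" for n
        by (rule X0_M(2)[OF X0_diff[OF has_frac_lapD(1)[OF \<psi>] has_frac_lapD(1)[OF \<phi>]]])
      ultimately obtain r :: "nat \<Rightarrow> nat" where r: "strict_mono r" "AE x in M. (\<lambda>n. \<psi> (r n) x - \<phi> x) \<longlonglongrightarrow> 0"
        using L2_subseq_AE[of "\<lambda>n x. \<psi> n x - \<phi> x"] by blast
      obtain K where K: "\<And>\<phi> g. has_frac_lap s \<Omega> \<phi> g \<Longrightarrow> g \<in> borel_measurable M \<Longrightarrow>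
        (AE x in M. \<bar>g x\<bar> \<le> C) \<Longrightarrow> AE x in M. \<bar>\<phi> x\<bar> \<le> K" using sup_bound[of C] by blast
      have "(\<lambda>n. LINT x|M. f x * \<psi> (r n) x) \<longlonglongrightarrow> (LINT x|M. f x * \<phi> x)"
      proof (rule bounded_dominated_convergence[OF f])
        show "\<psi> (r n) \<in> borel_measurable M" for n by (rule X0_M(1)[OF has_frac_lapD(1)[OF \<psi>]])
        show "\<phi> \<in> borel_measurable M" by (rule X0_M(1)[OF has_frac_lapD(1)[OF \<phi>]])
        show "AE x in M. \<bar>\<psi> (r n) x\<bar> \<le> K" for n by (rule K[OF \<psi> limit(2,3)])
        show "AE x in M. (\<lambda>n. \<psi> (r n) x) \<longlonglongrightarrow> \<phi> x"
          using r(2) by eventually_elim (rule LIM_zero_cancel)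
      qed
      moreover have "(LINT x|M. f x * \<psi> (r n) x) = (LINT x|M. u x * g (r n) x)" for n
        using limit(1)[of "r n"] \<psi>[of "r n"] by simp
      moreover have "(\<lambda>n. LINT x|M. u x * g (r n) x) \<longlonglongrightarrow> (LINT x|M. u x * g' x)"
      proof (rule bounded_dominated_convergence[OF u limit(2) limit(4) limit(3)])
        show "AE x in M. (\<lambda>n. g (r n) x) \<longlonglongrightarrow> g' x"
          using limit(5)
        proof eventually_elim
          case (elim x)
          show ?case using LIMSEQ_subseq_LIMSEQ[OF elim r(1)] by (simp add: o_def)
        qed
      qed
      ultimately show "(LINT x|M. u x * g' x) = (LINT x|M. f x * \<phi> x)"
        using LIMSEQ_unique by simp
    qed
  qed
  with \<phi> show ?thesis by blast
qed

lemma sgn_bounded_measurable: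
  assumes "w \<in> borel_measurable M"
  shows "(\<lambda>x. sgn (w x) :: real) \<in> borel_measurable M" "AE x in M. \<bar>sgn (w x) :: real\<bar> \<le> 1"
proof -
  have "sgn (w x) = indicator {0<..} (w x) - indicator {..<0} (w x)" for x
    by (simp add: sgn_if)
  then show "(\<lambda>x. sgn (w x) :: real) \<in> borel_measurable M" using assms by simp
  show "AE x in M. \<bar>sgn (w x) :: real\<bar> \<le> 1" by (rule AE_I2) (simp add: sgn_if)
qed

lemma AE_zero_of_integral_abs:
  fixes f :: "'a \<Rightarrow> real"
  assumes "integrable M f" "(LINT x|M. f x * sgn (f x)) = 0"
  shows "AE x in M. f x = 0"
proof -
  have "f x * sgn (f x) = \<bar>f x\<bar>" for x by (simp add: sgn_if)
  then have "(LINT x|M. \<bar>f x\<bar>) = 0" using assms(2) by simp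
  moreover have "integrable M (\<lambda>x. \<bar>f x\<bar>)" using assms(1) by simp
  ultimately have "AE x in M. \<bar>f x\<bar> = 0" by (subst (asm) integral_nonneg_eq_0_iff_AE) auto
  then show ?thesis by eventually_elim simp
qed

text \<open>The resolvents \<open>\<phi>\<^sub>n = n (n + (-\<Delta>)\<^sup>s)\<^sup>-\<^sup>1 h\<close> of a smooth compactly supported \<open>h\<close> solve the
  Dirichlet problem with right hand side \<open>n (h - \<phi>\<^sub>n)\<close>. The maximum principle keeps them below \<open>sup \<bar>h\<bar>\<close>, and testing with
  \<open>\<phi>\<^sub>n - h\<close> bounds \<open>n \<parallel>\<phi>\<^sub>n - h\<parallel>\<^sup>2\<close> by the energy of \<open>h\<close>.\<close>

lemma resolvent_approximation:
  assumes h: "h \<in> Cc_infty \<Omega>" and B: "\<And>x. \<bar>h x\<bar> \<le> B" and n: "n > 0"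
  obtains \<phi> where "\<phi> \<in> X0 s \<Omega>" "has_frac_lap s \<Omega> \<phi> (\<lambda>x. n * (h x - \<phi> x))" "AE x in M. \<bar>\<phi> x\<bar> \<le> B"
    "n * (LINT x|M. (\<phi> x - h x)\<^sup>2) \<le> frac_form s h h"
proof -
  have B0: "B \<ge> 0" using B[of 0] by linarith
  have hX: "h \<in> X0 s \<Omega>" by (rule Cc_infty_subset_X0[OF s_pos s_less_1 open_\<Omega> bounded_\<Omega> h])
  have nh: "(\<lambda>x. n * h x) \<in> borel_measurable M" "AE x in M. \<bar>n * h x\<bar> \<le> n * B"
    using X0_M(1)[OF hX] B n by (auto simp: abs_mult)
  obtain \<phi> where \<phi>: "\<phi> \<in> X0 s \<Omega>"
    and eq: "\<And>w. w \<in> X0 s \<Omega> \<Longrightarrow> frac_form s \<phi> w + n * (LINT x|M. \<phi> x * w x) = (LINT x|M. n * h x * w x)"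
    using ex_resolvent[OF nh less_imp_le[OF n]] by blast
  have eq': "frac_form s \<phi> w = n * (LINT x|M. (h x - \<phi> x) * w x)" if w: "w \<in> X0 s \<Omega>" for w
  proof -
    have "(LINT x|M. (h x - \<phi> x) * w x) = (LINT x|M. h x * w x - \<phi> x * w x)"
      by (intro Bochner_Integration.integral_cong refl) (simp add: algebra_simps)
    also have "\<dots> = (LINT x|M. h x * w x) - (LINT x|M. \<phi> x * w x)"
      by (rule Bochner_Integration.integral_diff[OF integrable_X0_mult_M[OF hX w] integrable_X0_mult_M[OF \<phi> w]])
    finally show ?thesis using eq[OF w] by (simp add: mult.assoc right_diff_distrib)
  qed
  have lap: "has_frac_lap s \<Omega> \<phi> (\<lambda>x. n * (h x - \<phi> x))"
    unfolding has_frac_lap_def using \<phi> eq' by (simp add: mult.assoc)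
  have upper: "AE x in M. \<sigma> * \<phi> x \<le> B" if \<sigma>: "\<sigma> = 1 \<or> \<sigma> = -1" for \<sigma> :: real
  proof -
    define T where "T t = max (t - B) 0" for t :: real
    have T: "T \<in> borel_measurable borel" "T 0 = 0" "\<And>a b. \<bar>T a - T b\<bar> \<le> \<bar>a - b\<bar>" "mono T"
    proof -
      show "T \<in> borel_measurable borel" unfolding T_def by measurable
      show "T 0 = 0" unfolding T_def using B0 by simp
      show "\<bar>T a - T b\<bar> \<le> \<bar>a - b\<bar>" for a b unfolding T_def by (simp add: max_def)
      show "mono T" unfolding T_def by (intro monoI max.mono diff_right_mono) simp_all
    qed
    define w where "w = (\<lambda>x. T (\<sigma> * \<phi> x))"
    have \<sigma>\<phi>: "(\<lambda>x. \<sigma> * \<phi> x) \<in> X0 s \<Omega>" by (rule X0_cmult[OF \<phi>])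
    have w: "w \<in> X0 s \<Omega>" unfolding w_def by (rule X0_contraction[OF \<sigma>\<phi> T(1-3)])
    have w0: "w x \<ge> 0" for x unfolding w_def T_def by simp
    have "0 \<le> frac_form s w w" by (rule frac_form_nonneg)
    also have "\<dots> \<le> frac_form s (\<lambda>x. \<sigma> * \<phi> x) w" unfolding w_def by (rule frac_form_contraction[OF \<sigma>\<phi> T])
    also have "\<dots> = \<sigma> * frac_form s \<phi> w" using frac_form_lincomb[OF \<phi> \<phi> w, of \<sigma> 0] by simp
    also have "\<dots> = n * (LINT x|M. \<sigma> * ((h x - \<phi> x) * w x))" unfolding eq'[OF w] by simp
    finally have 1: "0 \<le> (LINT x|M. \<sigma> * ((h x - \<phi> x) * w x))" using n by (simp add: zero_le_mult_iff)
    have "(LINT x|M. \<sigma> * ((h x - \<phi> x) * w x)) \<le> (LINT x|M. - (w x)\<^sup>2)"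
    proof (rule integral_mono)
      show "integrable M (\<lambda>x. \<sigma> * ((h x - \<phi> x) * w x))"
        by (rule integrable_mult_right[OF integrable_X0_mult_M[OF X0_diff[OF hX \<phi>] w]])
      show "integrable M (\<lambda>x. - (w x)\<^sup>2)" using X0_M(2)[OF w] by simp
      show "\<sigma> * ((h x - \<phi> x) * w x) \<le> - (w x)\<^sup>2" for x
      proof (cases "w x = 0")
        case False
        then have "w x = \<sigma> * \<phi> x - B" unfolding w_def T_def by (simp add: max_def split: if_splits)
        moreover have "\<sigma> * h x \<le> B" using \<sigma> B[of x] by (auto simp: abs_le_iff)
        ultimately have "\<sigma> * (h x - \<phi> x) \<le> - w x" by (simp add: algebra_simps)
        from mult_right_mono[OF this w0[of x]] show ?thesis by (simp add: power2_eq_square mult.assoc)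
      qed simp
    qed
    with 1 have "(LINT x|M. (w x)\<^sup>2) \<le> 0" by simp
    moreover have "0 \<le> (LINT x|M. (w x)\<^sup>2)" by (rule integral_M_nonneg) simp
    ultimately have "(LINT x|M. (w x)\<^sup>2) = 0" by (rule order.antisym)
    then have "AE x in M. (w x)\<^sup>2 = 0" using X0_M(2)[OF w] by (subst (asm) integral_nonneg_eq_0_iff_AE) auto
    then show ?thesis by eventually_elim (simp add: w_def T_def max_def split: if_splits)
  qed
  have bd: "AE x in M. \<bar>\<phi> x\<bar> \<le> B"
    using upper[of 1, OF disjI1[OF refl]] upper[of "-1", OF disjI2[OF refl]]
    by eventually_elim (simp add: abs_le_iff)
  have "n * (LINT x|M. (\<phi> x - h x)\<^sup>2) \<le> frac_form s h h"
  proof -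
    have d: "(\<lambda>x. \<phi> x - h x) \<in> X0 s \<Omega>" by (rule X0_diff[OF \<phi> hX])
    have "(h x - \<phi> x) * (\<phi> x - h x) = - (\<phi> x - h x)\<^sup>2" for x by (simp add: power2_eq_square algebra_simps)
    then have "frac_form s \<phi> (\<lambda>x. \<phi> x - h x) = - (n * (LINT x|M. (\<phi> x - h x)\<^sup>2))"
      using eq'[OF d] by simp
    moreover have "frac_form s \<phi> (\<lambda>x. \<phi> x - h x) = frac_form s \<phi> \<phi> - frac_form s h \<phi>"
      using frac_form_lincomb[OF \<phi> hX \<phi>, of 1 "-1"] frac_form_sym[of s \<phi> "\<lambda>x. \<phi> x - h x"] by simp
    moreover have "0 \<le> frac_form s \<phi> \<phi> - 2 * frac_form s h \<phi> + frac_form s h h"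
    proof -
      have "0 \<le> frac_form s (\<lambda>x. \<phi> x - h x) (\<lambda>x. \<phi> x - h x)" by (rule frac_form_nonneg)
      also have "\<dots> = frac_form s \<phi> (\<lambda>x. \<phi> x - h x) - frac_form s h (\<lambda>x. \<phi> x - h x)"
        using frac_form_lincomb[OF \<phi> hX d, of 1 "-1"] by simp
      also have "frac_form s \<phi> (\<lambda>x. \<phi> x - h x) = frac_form s \<phi> \<phi> - frac_form s h \<phi>" by fact
      also have "frac_form s h (\<lambda>x. \<phi> x - h x) = frac_form s \<phi> h - frac_form s h h"
        using frac_form_lincomb[OF \<phi> hX hX, of 1 "-1"] frac_form_sym[of s h "\<lambda>x. \<phi> x - h x"] by simp
      finally show ?thesis by (simp add: frac_form_sym[of s \<phi> h])
    qed
    ultimately show ?thesis using frac_form_nonneg[of s \<phi>] frac_form_nonneg[of s h] by linarith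
  qed
  then show thesis by (rule that[OF \<phi> lap bd])
qed

text \<open>Smooth compactly supported functions are bounded limits of resolvents, which are solutions with bounded data; so the
  solutions with bounded data separate the points of \<open>L\<^sup>1\<close>.\<close>

lemma frac_lap_solutions_separate:
  assumes f: "integrable M f"
    and ortho: "\<And>\<phi> g C. has_frac_lap s \<Omega> \<phi> g \<Longrightarrow> g \<in> borel_measurable M \<Longrightarrow> (AE x in M. \<bar>g x\<bar> \<le> C) \<Longrightarrow>
      (LINT x|M. f x * \<phi> x) = 0"
  shows "AE x in M. f x = 0"
proof -
  have fm: "f \<in> borel_measurable M" using f by auto
  have "(LINT x|M. f x * sgn (f x)) = 0"
    using open_\<Omega> bounded_\<Omega> sgn_bounded_measurable[OF fm]
  proof (induction rule: bounded_measurable_induct_Cc_infty)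
    case (smooth h)
    obtain B where B: "\<And>x. \<bar>h x\<bar> \<le> B" using Cc_infty_bounded[OF smooth] by blast
    have hX: "h \<in> X0 s \<Omega>" by (rule Cc_infty_subset_X0[OF s_pos s_less_1 open_\<Omega> bounded_\<Omega> smooth])
    define Q where "Q n \<phi> \<longleftrightarrow> \<phi> \<in> X0 s \<Omega> \<and> has_frac_lap s \<Omega> \<phi> (\<lambda>x. real (Suc n) * (h x - \<phi> x)) \<and>
        (AE x in M. \<bar>\<phi> x\<bar> \<le> B) \<and> real (Suc n) * (LINT x|M. (\<phi> x - h x)\<^sup>2) \<le> frac_form s h h" for n :: nat and \<phi> :: "'a \<Rightarrow> real"
    have "\<exists>\<phi> :: 'a \<Rightarrow> real. Q n \<phi>" for n
    proof -
      have "0 < real (Suc n)" by simp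
      from resolvent_approximation[OF smooth B this] obtain \<phi> where
        "\<phi> \<in> X0 s \<Omega>" "has_frac_lap s \<Omega> \<phi> (\<lambda>x. real (Suc n) * (h x - \<phi> x))" "AE x in M. \<bar>\<phi> x\<bar> \<le> B"
        "real (Suc n) * (LINT x|M. (\<phi> x - h x)\<^sup>2) \<le> frac_form s h h" .
      then have "Q n \<phi>" unfolding Q_def by (intro conjI)
      then show ?thesis by (intro exI[of _ \<phi>])
    qed
    then obtain \<phi> :: "nat \<Rightarrow> 'a \<Rightarrow> real" where "\<And>n. Q n (\<phi> n)" by metis
    then have \<phi>: "\<And>n. \<phi> n \<in> X0 s \<Omega>" "\<And>n. has_frac_lap s \<Omega> (\<phi> n) (\<lambda>x. real (Suc n) * (h x - \<phi> n x))"
      "\<And>n. AE x in M. \<bar>\<phi> n x\<bar> \<le> B" "\<And>n. real (Suc n) * (LINT x|M. (\<phi> n x - h x)\<^sup>2) \<le> frac_form s h h"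
      unfolding Q_def by simp_all
    have zero: "(LINT x|M. f x * \<phi> n x) = 0" for n
    proof (rule ortho[OF \<phi>(2)])
      show "(\<lambda>x. real (Suc n) * (h x - \<phi> n x)) \<in> borel_measurable M"
        using X0_M(1)[OF hX] X0_M(1)[OF \<phi>(1)] by measurable
      show "AE x in M. \<bar>real (Suc n) * (h x - \<phi> n x)\<bar> \<le> real (Suc n) * (2 * B)"
        using \<phi>(3)[of n]
      proof eventually_elim
        case (elim x)
        have "\<bar>h x - \<phi> n x\<bar> \<le> 2 * B" using B[of x] elim by linarith
        then show ?case unfolding abs_mult by (simp add: mult_left_mono)
      qed
    qed
    have "(\<lambda>n. LINT x|M. (\<phi> n x - h x)\<^sup>2) \<longlonglongrightarrow> 0"
    proof (rule tendsto_sandwich[OF _ _ tendsto_const])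
      show "\<forall>\<^sub>F n in sequentially. 0 \<le> (LINT x|M. (\<phi> n x - h x)\<^sup>2)" by (simp add: integral_M_nonneg)
      show "\<forall>\<^sub>F n in sequentially. (LINT x|M. (\<phi> n x - h x)\<^sup>2) \<le> frac_form s h h * (1 / real (Suc n))"
        using \<phi>(4) by (intro always_eventually allI) (simp add: pos_le_divide_eq mult.commute)
      show "(\<lambda>n. frac_form s h h * (1 / real (Suc n))) \<longlonglongrightarrow> 0"
        using tendsto_mult[OF tendsto_const LIMSEQ_Suc[OF lim_1_over_n], of "frac_form s h h"] by simp
    qed
    moreover have "integrable M (\<lambda>x. (\<phi> n x - h x)\<^sup>2)" for n by (rule X0_M(2)[OF X0_diff[OF \<phi>(1) hX]])
    ultimately obtain r :: "nat \<Rightarrow> nat" where r: "AE x in M. (\<lambda>n. \<phi> (r n) x - h x) \<longlonglongrightarrow> 0"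
      using L2_subseq_AE[of "\<lambda>n x. \<phi> n x - h x"] by blast
    have "(\<lambda>n. LINT x|M. f x * \<phi> (r n) x) \<longlonglongrightarrow> (LINT x|M. f x * h x)"
    proof (rule bounded_dominated_convergence[OF f X0_M(1)[OF \<phi>(1)] X0_M(1)[OF hX] \<phi>(3)])
      show "AE x in M. (\<lambda>n. \<phi> (r n) x) \<longlonglongrightarrow> h x" using r by eventually_elim (rule LIM_zero_cancel)
    qed
    then show ?case unfolding zero by (simp add: LIMSEQ_const_iff)
  next
    case (limit g g' C)
    have "(\<lambda>n. LINT x|M. f x * g n x) \<longlonglongrightarrow> (LINT x|M. f x * g' x)"
      by (rule bounded_dominated_convergence[OF f limit(2,4,3,5)])
    then show ?case unfolding limit(1) by (simp add: LIMSEQ_const_iff)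
  qed
  then show ?thesis by (rule AE_zero_of_integral_abs[OF f])
qed

lemma vw_frac_lap_unique:
  assumes u: "integrable M u" and f: "integrable M f" "integrable M g"
    and vw: "vw_frac_lap s \<Omega> u f" "vw_frac_lap s \<Omega> u g"
  shows "AE x in M. f x = g x"
proof -
  have "AE x in M. f x - g x = 0"
  proof (rule frac_lap_solutions_separate)
    show "integrable M (\<lambda>x. f x - g x)" using f by simp
    fix \<phi> m C assume *: "has_frac_lap s \<Omega> \<phi> m" "m \<in> borel_measurable M" "AE x in M. \<bar>m x\<bar> \<le> C"
    obtain K where K: "AE x in M. \<bar>\<phi> x\<bar> \<le> K" using frac_lap_bounded[OF *] by blast
    note i = AE_bounded_mult_integrable(2)[OF X0_M(1)[OF has_frac_lapD(1)[OF *(1)]] K]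
    have "(LINT x|M. (f x - g x) * \<phi> x) = (LINT x|M. f x * \<phi> x - g x * \<phi> x)"
      by (intro Bochner_Integration.integral_cong refl) (simp add: algebra_simps)
    also have "\<dots> = (LINT x|M. f x * \<phi> x) - (LINT x|M. g x * \<phi> x)"
      by (rule Bochner_Integration.integral_diff[OF i[OF f(1)] i[OF f(2)]])
    also have "\<dots> = 0"
      using vw_frac_lap_bounded_test[OF u f(1) vw(1) *(2,3,1)] vw_frac_lap_bounded_test[OF u f(2) vw(2) *(2,3,1)] by simp
    finally show "(LINT x|M. (f x - g x) * \<phi> x) = 0" .
  qed
  then show ?thesis by eventually_elim simp
qed

lemma has_frac_lap_imp_vw:
  assumes "has_frac_lap s \<Omega> \<psi> m"
  shows "vw_frac_lap s \<Omega> \<psi> m"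
  unfolding vw_frac_lap_def using has_frac_lap_symmetric[OF assms] by simp

text \<open>The solutions with truncated data converge in \<open>L\<^sup>1\<close>, by duality with the uniform bound for bounded
  data; so a very weak solution inherits from them any property that is stable under almost
  everywhere limits of subsequences.\<close>

lemma vw_frac_lap_approximation:
  assumes u: "integrable M u" and f: "integrable M f" and vw: "vw_frac_lap s \<Omega> u f"
  obtains w k where "\<And>n. has_frac_lap s \<Omega> (w n) (k n)" "\<And>n. k n \<in> borel_measurable M"
    "\<And>n :: nat. \<exists>C. AE x in M. \<bar>k n x\<bar> \<le> C" "\<And>n x. \<bar>k n x\<bar> \<le> \<bar>f x\<bar>" "AE x in M. (\<lambda>n. w n x) \<longlonglongrightarrow> u x"
proof -
  have [measurable]: "f \<in> borel_measurable M" "u \<in> borel_measurable M" using f u by auto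
  define k where "k n x = max (- real n) (min (real n) (f x))" for n x
  have k: "k n \<in> borel_measurable M" "\<bar>k n x\<bar> \<le> real n" "\<bar>k n x\<bar> \<le> \<bar>f x\<bar>" for n x
  proof -
    show "k n \<in> borel_measurable M" unfolding k_def by measurable
    show "\<bar>k n x\<bar> \<le> real n" "\<bar>k n x\<bar> \<le> \<bar>f x\<bar>" unfolding k_def by (auto simp: max_def min_def)
  qed
  have kn: "AE x in M. \<bar>k n x\<bar> \<le> real n" for n using k(2) by simp
  have kC: "\<exists>C. AE x in M. \<bar>k n x\<bar> \<le> C" for n by (intro exI[of _ "real n"] kn)
  have "\<exists>w. has_frac_lap s \<Omega> w (k n)" for n by (rule ex_frac_lap[OF k(1) kn])
  then obtain w where w: "\<And>n. has_frac_lap s \<Omega> (w n) (k n)" by metis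
  have wm[measurable]: "w n \<in> borel_measurable M" for n by (rule X0_M(1)[OF has_frac_lapD(1)[OF w]])
  have wi: "integrable M (w n)" for n by (rule X0_M(3)[OF has_frac_lapD(1)[OF w]])
  have ki: "integrable M (k n)" for n
    by (rule Bochner_Integration.integrable_bound[OF f k(1)]) (use k(3) in simp)
  obtain K where K: "\<And>\<phi> g. has_frac_lap s \<Omega> \<phi> g \<Longrightarrow> g \<in> borel_measurable M \<Longrightarrow>
        (AE x in M. \<bar>g x\<bar> \<le> 1) \<Longrightarrow> AE x in M. \<bar>\<phi> x\<bar> \<le> K" using sup_bound[of 1] by blast
  have L1: "(LINT x|M. \<bar>u x - w n x\<bar>) \<le> (LINT x|M. \<bar>f x - k n x\<bar> * K)" for n
  proof -
    define m where "m x = sgn (u x - w n x)" for x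
    have m: "m \<in> borel_measurable M" "AE x in M. \<bar>m x\<bar> \<le> 1"
      unfolding m_def[abs_def] by (rule sgn_bounded_measurable; measurable)+
    obtain \<phi> where \<phi>: "has_frac_lap s \<Omega> \<phi> m" using ex_frac_lap[OF m] by blast
    have \<phi>m: "\<phi> \<in> borel_measurable M" by (rule X0_M(1)[OF has_frac_lapD(1)[OF \<phi>]])
    note \<phi>K = K[OF \<phi> m]
    have fi: "integrable M (\<lambda>x. f x * \<phi> x)" "integrable M (\<lambda>x. k n x * \<phi> x)"
      by (rule AE_bounded_mult_integrable(2)[OF \<phi>m \<phi>K f] AE_bounded_mult_integrable(2)[OF \<phi>m \<phi>K ki])+
    have ui: "integrable M (\<lambda>x. u x * m x)" "integrable M (\<lambda>x. w n x * m x)"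
      by (rule AE_bounded_mult_integrable(2)[OF m u] AE_bounded_mult_integrable(2)[OF m wi])+
    have "(LINT x|M. \<bar>u x - w n x\<bar>) = (LINT x|M. u x * m x - w n x * m x)"
      by (intro Bochner_Integration.integral_cong refl) (simp add: m_def sgn_if)
    also have "\<dots> = (LINT x|M. u x * m x) - (LINT x|M. w n x * m x)"
      by (rule Bochner_Integration.integral_diff[OF ui])
    also have "(LINT x|M. u x * m x) = (LINT x|M. f x * \<phi> x)" by (rule vw_frac_lap_bounded_test[OF u f vw m \<phi>])
    also have "(LINT x|M. w n x * m x) = (LINT x|M. k n x * \<phi> x)" by (rule has_frac_lap_symmetric[OF w \<phi>])
    also have "(LINT x|M. f x * \<phi> x) - (LINT x|M. k n x * \<phi> x) = (LINT x|M. f x * \<phi> x - k n x * \<phi> x)"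
      by (rule Bochner_Integration.integral_diff[OF fi, symmetric])
    also have "\<dots> \<le> (LINT x|M. \<bar>f x - k n x\<bar> * K)"
    proof (rule integral_mono_AE)
      show "integrable M (\<lambda>x. f x * \<phi> x - k n x * \<phi> x)" using fi by simp
      show "integrable M (\<lambda>x. \<bar>f x - k n x\<bar> * K)" using f ki by simp
      show "AE x in M. f x * \<phi> x - k n x * \<phi> x \<le> \<bar>f x - k n x\<bar> * K"
        using \<phi>K
      proof eventually_elim
        case (elim x)
        have "f x * \<phi> x - k n x * \<phi> x \<le> \<bar>(f x - k n x) * \<phi> x\<bar>" by (simp add: left_diff_distrib)
        also have "\<dots> \<le> \<bar>f x - k n x\<bar> * K" unfolding abs_mult using elim by (intro mult_left_mono) auto
        finally show ?case .
      qed
    qed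
    finally show ?thesis .
  qed
  have "(\<lambda>n. LINT x|M. \<bar>f x - k n x\<bar> * K) \<longlonglongrightarrow> (LINT x|M. 0)"
  proof (rule integral_dominated_convergence[where w = "\<lambda>x. 2 * \<bar>f x\<bar> * \<bar>K\<bar>"])
    show "(\<lambda>x. \<bar>f x - k n x\<bar> * K) \<in> borel_measurable M" for n using k(1)[of n] by measurable
    show "integrable M (\<lambda>x. 2 * \<bar>f x\<bar> * \<bar>K\<bar>)" using f by simp
    show "AE x in M. (\<lambda>n. \<bar>f x - k n x\<bar> * K) \<longlonglongrightarrow> 0"
    proof (rule AE_I2)
      fix x
      obtain N :: nat where N: "\<bar>f x\<bar> \<le> real N" using real_arch_simple by blast
      have "\<bar>f x - k n x\<bar> * K = 0" if "n \<ge> N" for n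
      proof -
        have "\<bar>f x\<bar> \<le> real n" using N that by linarith
        then have "k n x = f x" unfolding k_def by (auto simp: abs_le_iff)
        then show ?thesis by simp
      qed
      then have "\<forall>\<^sub>F n in sequentially. \<bar>f x - k n x\<bar> * K = 0" by (rule eventually_sequentiallyI[of N])
      then show "(\<lambda>n. \<bar>f x - k n x\<bar> * K) \<longlonglongrightarrow> 0" by (rule tendsto_eventually)
    qed
    show "AE x in M. norm (\<bar>f x - k n x\<bar> * K) \<le> 2 * \<bar>f x\<bar> * \<bar>K\<bar>" for n
    proof (rule AE_I2)
      fix x
      have "\<bar>f x - k n x\<bar> \<le> 2 * \<bar>f x\<bar>" using k(3)[of n x] by linarith
      then show "norm (\<bar>f x - k n x\<bar> * K) \<le> 2 * \<bar>f x\<bar> * \<bar>K\<bar>" by (simp add: abs_mult mult_right_mono)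
    qed
  qed simp
  then have lim0: "(\<lambda>n. LINT x|M. \<bar>f x - k n x\<bar> * K) \<longlonglongrightarrow> 0" by simp
  have "(\<lambda>n. LINT x|M. norm (w n x - u x)) \<longlonglongrightarrow> 0"
  proof (rule tendsto_sandwich[OF _ _ tendsto_const lim0])
    show "\<forall>\<^sub>F n in sequentially. 0 \<le> (LINT x|M. norm (w n x - u x))" by (simp add: integral_M_nonneg)
    show "\<forall>\<^sub>F n in sequentially. (LINT x|M. norm (w n x - u x)) \<le> (LINT x|M. \<bar>f x - k n x\<bar> * K)"
      using L1 by (intro always_eventually allI) (simp add: abs_minus_commute)
  qed
  moreover have "integrable M (\<lambda>x. w n x - u x)" for n using wi u by simp
  ultimately obtain r :: "nat \<Rightarrow> nat" where r: "AE x in M. (\<lambda>n. w (r n) x - u x) \<longlonglongrightarrow> 0"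
    using tendsto_L1_AE_subseq[of M "\<lambda>n x. w n x - u x"] by blast
  have "AE x in M. (\<lambda>n. w (r n) x) \<longlonglongrightarrow> u x" using r by eventually_elim (rule LIM_zero_cancel)
  then show thesis
    by (intro that[of "\<lambda>n. w (r n)" "\<lambda>n. k (r n)"] w k(1,3) kC)
qed

lemma Lp_truncation_bound:
  assumes "f \<in> Lp \<rho> \<Omega>" "0 \<le> \<rho>" "k \<in> borel_measurable M" "\<And>x. \<bar>k x\<bar> \<le> \<bar>f x\<bar>"
  shows "(LINT x|M. \<bar>k x\<bar> powr \<rho>) \<le> (LINT x|M. \<bar>f x\<bar> powr \<rho>)"
proof -
  have le: "\<bar>k x\<bar> powr \<rho> \<le> \<bar>f x\<bar> powr \<rho>" for x using assms by (intro powr_mono2) auto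
  have f: "integrable M (\<lambda>x. \<bar>f x\<bar> powr \<rho>)" using assms(1) by (simp add: Lp_def)
  note [measurable] = assms(3)
  have "integrable M (\<lambda>x. \<bar>k x\<bar> powr \<rho>)"
  proof (rule Bochner_Integration.integrable_bound[OF f])
    show "AE x in M. norm (\<bar>k x\<bar> powr \<rho>) \<le> norm (\<bar>f x\<bar> powr \<rho>)" using le by simp
  qed measurable
  then show ?thesis using f le by (rule integral_mono)
qed

lemma vw_frac_lap_Linfty:
  assumes u: "integrable M u" and f: "integrable M f" and vw: "vw_frac_lap s \<Omega> u f"
    and \<rho>: "f \<in> Lp \<rho> \<Omega>" "1 \<le> \<rho>" "1 / \<rho> < gain"
  shows "u \<in> Linfty \<Omega>"
proof -
  obtain w k where wk: "\<And>n. has_frac_lap s \<Omega> (w n) (k n)" "\<And>n. k n \<in> borel_measurable M"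
    "\<And>n :: nat. \<exists>C. AE x in M. \<bar>k n x\<bar> \<le> C" "\<And>n x. \<bar>k n x\<bar> \<le> \<bar>f x\<bar>" "AE x in M. (\<lambda>n. w n x) \<longlonglongrightarrow> u x"
    using vw_frac_lap_approximation[OF u f vw] by blast
  obtain K where K: "\<And>\<phi> g B. has_frac_lap s \<Omega> \<phi> g \<Longrightarrow> g \<in> borel_measurable M \<Longrightarrow>
    (AE x in M. \<bar>g x\<bar> \<le> B) \<Longrightarrow> (LINT x|M. \<bar>g x\<bar> powr \<rho>) \<le> (LINT x|M. \<bar>f x\<bar> powr \<rho>) \<Longrightarrow> AE x in M. \<bar>\<phi> x\<bar> \<le> K"
    using uniform_sup_bound[OF \<rho>(2,3), of "LINT x|M. \<bar>f x\<bar> powr \<rho>"] by blast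
  have "AE x in M. \<bar>w n x\<bar> \<le> K" for n
  proof -
    obtain C where C: "AE x in M. \<bar>k n x\<bar> \<le> C" using wk(3) by blast
    show ?thesis by (rule K[OF wk(1) wk(2) C Lp_truncation_bound[OF \<rho>(1) _ wk(2) wk(4)]]) (use \<rho>(2) in simp)
  qed
  then have "AE x in M. \<forall>n. \<bar>w n x\<bar> \<le> K" by (simp add: AE_all_countable)
  with wk(5) have "AE x in M. \<bar>u x\<bar> \<le> K"
  proof eventually_elim
    case (elim x)
    show ?case by (rule LIMSEQ_le_const2[OF tendsto_rabs[OF elim(1)]]) (use elim(2) in auto)
  qed
  then show ?thesis using u by (auto simp: Linfty_def)
qed

lemma vw_frac_lap_Lp:
  assumes u: "integrable M u" and f: "integrable M f" and vw: "vw_frac_lap s \<Omega> u f"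
    and \<rho>: "f \<in> Lp \<rho> \<Omega>" "1 \<le> \<rho>" and \<tau>: "0 < \<tau>" "1 / \<rho> - gain < 1 / \<tau>"
  shows "u \<in> Lp \<tau> \<Omega>"
proof -
  have um[measurable]: "u \<in> borel_measurable M" using u by auto
  obtain w k where wk: "\<And>n. has_frac_lap s \<Omega> (w n) (k n)" "\<And>n. k n \<in> borel_measurable M"
    "\<And>n :: nat. \<exists>C. AE x in M. \<bar>k n x\<bar> \<le> C" "\<And>n x. \<bar>k n x\<bar> \<le> \<bar>f x\<bar>" "AE x in M. (\<lambda>n. w n x) \<longlonglongrightarrow> u x"
    using vw_frac_lap_approximation[OF u f vw] by blast
  have wm[measurable]: "w n \<in> borel_measurable M" for n by (rule X0_M(1)[OF has_frac_lapD(1)[OF wk(1)]])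
  obtain K where K: "K < \<infinity>" "\<And>\<phi> g B. has_frac_lap s \<Omega> \<phi> g \<Longrightarrow> g \<in> borel_measurable M \<Longrightarrow>
    (AE x in M. \<bar>g x\<bar> \<le> B) \<Longrightarrow> (LINT x|M. \<bar>g x\<bar> powr \<rho>) \<le> (LINT x|M. \<bar>f x\<bar> powr \<rho>) \<Longrightarrow>
    (\<integral>\<^sup>+x. ennreal (\<bar>\<phi> x\<bar> powr \<tau>) \<partial>M) \<le> K"
    using uniform_Lp_bound[OF \<rho>(2) \<tau>, of "LINT x|M. \<bar>f x\<bar> powr \<rho>"] by blast
  have wK: "(\<integral>\<^sup>+x. ennreal (\<bar>w n x\<bar> powr \<tau>) \<partial>M) \<le> K" for n
  proof -
    obtain C where C: "AE x in M. \<bar>k n x\<bar> \<le> C" using wk(3) by blast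
    show ?thesis by (rule K(2)[OF wk(1) wk(2) C Lp_truncation_bound[OF \<rho>(1) _ wk(2) wk(4)]]) (use \<rho>(2) in simp)
  qed
  have "(\<integral>\<^sup>+x. ennreal (\<bar>u x\<bar> powr \<tau>) \<partial>M) = (\<integral>\<^sup>+x. liminf (\<lambda>n. ennreal (\<bar>w n x\<bar> powr \<tau>)) \<partial>M)"
  proof (rule nn_integral_cong_AE)
    show "AE x in M. ennreal (\<bar>u x\<bar> powr \<tau>) = liminf (\<lambda>n. ennreal (\<bar>w n x\<bar> powr \<tau>))"
      using wk(5)
    proof eventually_elim
      case (elim x)
      have "(\<lambda>n. \<bar>w n x\<bar> powr \<tau>) \<longlonglongrightarrow> \<bar>u x\<bar> powr \<tau>"
        by (rule tendsto_powr2[OF tendsto_rabs[OF elim] tendsto_const]) (use \<tau>(1) in auto)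
      then have "(\<lambda>n. ennreal (\<bar>w n x\<bar> powr \<tau>)) \<longlonglongrightarrow> ennreal (\<bar>u x\<bar> powr \<tau>)" by (rule tendsto_ennrealI)
      then show ?case using lim_imp_Liminf trivial_limit_sequentially by metis
    qed
  qed
  also have "\<dots> \<le> liminf (\<lambda>n. (\<integral>\<^sup>+x. ennreal (\<bar>w n x\<bar> powr \<tau>) \<partial>M))"
    by (rule nn_integral_liminf) measurable
  also have "\<dots> \<le> K" by (rule Liminf_le) (use wK in auto)
  finally have "(\<integral>\<^sup>+x. ennreal (\<bar>u x\<bar> powr \<tau>) \<partial>M) < \<infinity>" using K(1) by (rule le_less_trans)
  then have "integrable M (\<lambda>x. \<bar>u x\<bar> powr \<tau>)"
    by (intro integrableI_bounded) simp_all
  then show ?thesis using um by (simp add: Lp_def)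
qed

end

section \<open>Energy solutions and classical solutions\<close>

lemma odd_powr_inverse:
  assumes "q > 0"
  shows "odd_powr q (odd_powr (1 / q) t) = t" "odd_powr (1 / q) (odd_powr q t) = t"
proof -
  have "odd_powr r (odd_powr (1 / r) t) = t" if "r > 0" for r
  proof (cases "t = 0")
    case False
    have "\<bar>\<bar>t\<bar> powr (1 / r - 1) * t\<bar> = \<bar>t\<bar> powr (1 / r)"
      using False powr_mult_base[of "\<bar>t\<bar>" "1 / r - 1"] by (simp add: abs_mult mult.commute)
    then have "odd_powr r (odd_powr (1 / r) t) = (\<bar>t\<bar> powr (1 / r)) powr (r - 1) * (\<bar>t\<bar> powr (1 / r - 1) * t)"
      unfolding odd_powr_def by simp
    also have "\<dots> = \<bar>t\<bar> powr (1 / r * (r - 1)) * (\<bar>t\<bar> powr (1 / r - 1) * t)" by (simp only: powr_powr)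
    also have "\<dots> = \<bar>t\<bar> powr (1 / r * (r - 1) + (1 / r - 1)) * t" by (simp only: powr_add mult.assoc)
    also have "1 / r * (r - 1) + (1 / r - 1) = 0" using that by (simp add: field_simps)
    finally show ?thesis using False by simp
  qed (simp add: odd_powr_def)
  from this[of q] this[of "1 / q"] assms
  show "odd_powr q (odd_powr (1 / q) t) = t" "odd_powr (1 / q) (odd_powr q t) = t" by simp_all
qed

lemma abs_odd_powr: "r > 0 \<Longrightarrow> \<bar>odd_powr r t\<bar> = \<bar>t\<bar> powr r"
  using powr_mult_base[of "\<bar>t\<bar>" "r - 1"] by (simp add: odd_powr_def abs_mult mult.commute)

lemma borel_measurable_odd_powr [measurable]:
  "f \<in> borel_measurable N \<Longrightarrow> (\<lambda>x. odd_powr r (f x)) \<in> borel_measurable N"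
  unfolding odd_powr_def by measurable

context dirichlet_domain
begin

lemma Linfty_M: "f \<in> Linfty \<Omega> \<longleftrightarrow> f \<in> borel_measurable M \<and> (\<exists>C. AE x in M. \<bar>f x\<bar> \<le> C)"
  by (simp add: Linfty_def)

lemma Linfty_odd_powr:
  assumes "f \<in> Linfty \<Omega>" "r > 0"
  shows "(\<lambda>x. odd_powr r (f x)) \<in> Linfty \<Omega>"
proof -
  obtain C where f: "f \<in> borel_measurable M" and C: "AE x in M. \<bar>f x\<bar> \<le> C" using assms(1) by (auto simp: Linfty_M)
  have "AE x in M. \<bar>odd_powr r (f x)\<bar> \<le> \<bar>C\<bar> powr r"
    using C
  proof eventually_elim
    case (elim x)
    then show ?case unfolding abs_odd_powr[OF assms(2)] using assms(2) by (intro powr_mono2) auto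
  qed
  then show ?thesis using f by (auto simp: Linfty_M)
qed

lemma Linfty_subset_Lp:
  assumes "f \<in> Linfty \<Omega>" "0 \<le> r"
  shows "f \<in> Lp r \<Omega>"
proof -
  obtain C where "f \<in> borel_measurable M" "AE x in M. \<bar>f x\<bar> \<le> C" using assms(1) by (auto simp: Linfty_M)
  then show ?thesis using powr_integrable_of_bounded(1)[OF _ _ assms(2)] by (simp add: Lp_def)
qed

lemma Lp_antimono:
  assumes f: "f \<in> Lp r \<Omega>" and "0 \<le> t" "t \<le> r"
  shows "f \<in> Lp t \<Omega>"
proof -
  interpret finite_measure M by (rule finite_measure_M)
  have [measurable]: "f \<in> borel_measurable M" and i: "integrable M (\<lambda>x. \<bar>f x\<bar> powr r)" using f by (auto simp: Lp_def)
  have "integrable M (\<lambda>x. \<bar>f x\<bar> powr t)"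
  proof (rule Bochner_Integration.integrable_bound)
    show "integrable M (\<lambda>x. 1 + \<bar>f x\<bar> powr r)" using i by simp
    have "\<bar>y\<bar> powr t \<le> 1 + \<bar>y\<bar> powr r" for y :: real
    proof (cases "\<bar>y\<bar> \<le> 1")
      case True
      then have "\<bar>y\<bar> powr t \<le> 1 powr t" using assms(2) by (intro powr_mono2) auto
      then show ?thesis by (simp add: add_increasing2)
    next
      case False
      then have "\<bar>y\<bar> powr t \<le> \<bar>y\<bar> powr r" using assms(3) by (intro powr_mono) auto
      then show ?thesis by simp
    qed
    then show "AE x in M. norm (\<bar>f x\<bar> powr t) \<le> norm (1 + \<bar>f x\<bar> powr r)" by (intro AE_I2) simp
  qed measurable
  then show ?thesis by (simp add: Lp_def)
qed

lemma Lp_odd_powr: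
  assumes "f \<in> Lp r \<Omega>" "t > 0"
  shows "(\<lambda>x. odd_powr t (f x)) \<in> Lp (r / t) \<Omega>"
  using assms by (auto simp: Lp_def abs_odd_powr powr_powr)

lemma frac_lap_W2s:
  assumes "u \<in> W2s s 1 \<Omega>"
  shows "frac_lap s \<Omega> u \<in> Lp 1 \<Omega>" "vw_frac_lap s \<Omega> u (frac_lap s \<Omega> u)"
proof -
  have "\<exists>f. f \<in> Lp 1 \<Omega> \<and> vw_frac_lap s \<Omega> u f" using assms by (auto simp: W2s_def)
  from someI_ex[OF this] show "frac_lap s \<Omega> u \<in> Lp 1 \<Omega>" "vw_frac_lap s \<Omega> u (frac_lap s \<Omega> u)"
    unfolding frac_lap_def by blast+
qed

lemma W2s_antimono: "1 \<le> r \<Longrightarrow> u \<in> W2s s r \<Omega> \<Longrightarrow> u \<in> W2s s 1 \<Omega>"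
  unfolding W2s_def using Lp_antimono[of _ r 1] by auto

lemma frac_lap_AE_eq:
  assumes "u \<in> Lp 1 \<Omega>" "f \<in> Lp 1 \<Omega>" "vw_frac_lap s \<Omega> u f"
  shows "AE x in M. frac_lap s \<Omega> u x = f x"
proof -
  have "u \<in> W2s s 1 \<Omega>" using assms by (auto simp: W2s_def)
  note F = frac_lap_W2s[OF this]
  show ?thesis by (rule vw_frac_lap_unique[OF _ _ _ F(2) assms(3)]) (use F(1) assms in \<open>simp_all add: L1_M\<close>)
qed

lemma Lp_cong_AE:
  assumes "f \<in> Lp r \<Omega>" "g \<in> borel_measurable M" "AE x in M. g x = f x"
  shows "g \<in> Lp r \<Omega>"
proof -
  have f: "f \<in> borel_measurable M" "integrable M (\<lambda>x. \<bar>f x\<bar> powr r)" using assms(1) by (auto simp: Lp_def)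
  have "integrable M (\<lambda>x. \<bar>g x\<bar> powr r)"
  proof (rule integrable_cong_AE_imp[OF f(2)])
    show "(\<lambda>x. \<bar>g x\<bar> powr r) \<in> borel_measurable M" using assms(2) by measurable
    show "AE x in M. \<bar>f x\<bar> powr r = \<bar>g x\<bar> powr r" using assms(3) by eventually_elim simp
  qed
  then show ?thesis using assms(2) by (simp add: Lp_def)
qed

lemma frac_lap_in_Lp:
  assumes "u \<in> W2s s r \<Omega>" "1 \<le> r"
  shows "frac_lap s \<Omega> u \<in> Lp r \<Omega>"
proof -
  obtain f where f: "u \<in> Lp 1 \<Omega>" "f \<in> Lp r \<Omega>" "vw_frac_lap s \<Omega> u f" using assms(1) by (auto simp: W2s_def)
  have f1: "f \<in> Lp 1 \<Omega>" by (rule Lp_antimono[OF f(2)]) (use assms(2) in auto)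
  have "frac_lap s \<Omega> u \<in> borel_measurable M"
    using frac_lap_W2s(1)[OF W2s_antimono[OF assms(2,1)]] by (simp add: Lp_def)
  then show ?thesis by (rule Lp_cong_AE[OF f(2) _ frac_lap_AE_eq[OF f(1) f1 f(3)]])
qed

lemma vw_frac_lap_Linfty_data:
  assumes u: "integrable M u" and vw: "vw_frac_lap s \<Omega> u f" and f: "f \<in> Linfty \<Omega>"
  shows "u \<in> Linfty \<Omega>"
proof (rule vw_frac_lap_Linfty[OF u _ vw])
  show "integrable M f" using Linfty_subset_Lp[OF f, of 1] by (simp add: L1_M)
  show "f \<in> Lp (max 1 (2 / gain)) \<Omega>" by (rule Linfty_subset_Lp[OF f]) simp
qed (rule large_exponent)+

text \<open>With \<open>a\<close> and \<open>b\<close> the reciprocals of the integrability exponents of \<open>u\<close> and \<open>v\<close>, one turn through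
  the system replaces \<open>a\<close> by \<open>q (p a - d) - d\<close> up to an arbitrarily small loss, where \<open>d\<close> is the gain
  of one Dirichlet problem. The decrease \<open>a - q (p a - d) + d\<close> is affine in \<open>a\<close>, and positive at
  \<open>a = 0\<close> and, by subcriticality, at \<open>a = 1 / (p + 1)\<close>; so it is bounded away from zero between, and
  finitely many turns reach boundedness.\<close>

lemma bootstrap_to_Linfty:
  assumes "p > 0" "q > 0" and sub: "1 / (p + 1) + 1 / (q + 1) > 1 - gain"
    and u: "u \<in> Lp (p + 1) \<Omega>" and v: "v \<in> Lp (q + 1) \<Omega>"
    and vw_u: "vw_frac_lap s \<Omega> u (\<lambda>x. odd_powr q (v x))" and vw_v: "vw_frac_lap s \<Omega> v (\<lambda>x. odd_powr p (u x))"
  shows "u \<in> Linfty \<Omega>" "v \<in> Linfty \<Omega>"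
proof -
  define A where "A = 1 / (p + 1)"
  define B where "B = 1 / (q + 1)"
  have AB: "0 < A" "A < 1" "0 < B" "B < 1" "p * A = 1 - A" "q * B = 1 - B" "A + B > 1 - gain"
    using assms(1-3) unfolding A_def B_def by (auto simp: field_simps)
  have u1: "integrable M u" using Lp_antimono[OF u, of 1] \<open>p > 0\<close> by (simp add: L1_M)
  have v1: "integrable M v" using Lp_antimono[OF v, of 1] \<open>q > 0\<close> by (simp add: L1_M)
  have pu: "integrable M (\<lambda>x. odd_powr p (u x))"
    using Lp_antimono[OF Lp_odd_powr[OF u \<open>p > 0\<close>], of 1] \<open>p > 0\<close> by (simp add: L1_M)
  have qv: "integrable M (\<lambda>x. odd_powr q (v x))"
    using Lp_antimono[OF Lp_odd_powr[OF v \<open>q > 0\<close>], of 1] \<open>q > 0\<close> by (simp add: L1_M)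
  have v_of_u: "v \<in> Linfty \<Omega>" if "u \<in> Linfty \<Omega>"
    by (rule vw_frac_lap_Linfty_data[OF v1 vw_v Linfty_odd_powr[OF that \<open>p > 0\<close>]])
  have u_of_v: "u \<in> Linfty \<Omega>" if "v \<in> Linfty \<Omega>"
    by (rule vw_frac_lap_Linfty_data[OF u1 vw_u Linfty_odd_powr[OF that \<open>q > 0\<close>]])
  define \<delta> where "\<delta> = min (gain * (q + 1)) ((1 + q) * (A + B - 1 + gain)) / 2"
  have \<delta>: "\<delta> > 0" unfolding \<delta>_def using gain_pos \<open>q > 0\<close> AB by simp
  have decrease: "2 * \<delta> \<le> a - (q * (p * a - gain) - gain)" if a: "0 \<le> a" "a \<le> A" for a
  proof -
    define t where "t = a / A"
    have t: "0 \<le> t" "t \<le> 1" "a = t * A" unfolding t_def using a AB by simp_all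
    have end_A: "A - (q * (p * A - gain) - gain) = (1 + q) * (A + B - 1 + gain)"
    proof -
      have "A - (q * (p * A - gain) - gain) = A - q * (1 - A - gain) + gain" using AB(5) by simp
      also have "\<dots> = A - q + q * A + q * gain + gain" by (simp add: algebra_simps)
      also have "\<dots> = (1 + q) * (A + B - 1 + gain)" using AB(6) by (simp add: algebra_simps)
      finally show ?thesis .
    qed
    have "2 * \<delta> \<le> gain * (q + 1)" "2 * \<delta> \<le> (1 + q) * (A + B - 1 + gain)" unfolding \<delta>_def by simp_all
    then have "(1 - t) * (2 * \<delta>) + t * (2 * \<delta>) \<le> (1 - t) * (gain * (q + 1)) + t * (A - (q * (p * A - gain) - gain))"
      unfolding end_A using t by (intro add_mono mult_left_mono) auto
    also have "\<dots> = a - (q * (p * a - gain) - gain)" unfolding t(3) by (simp add: algebra_simps)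
    finally show ?thesis by (simp add: algebra_simps)
  qed
  have turn: "u \<in> Linfty \<Omega> \<or> \<delta> < a \<and> u \<in> Lp (1 / (a - \<delta>)) \<Omega>"
    if ua: "u \<in> Lp (1 / a) \<Omega>" and a: "0 < a" "a \<le> A" for a
  proof -
    have pa: "0 < p * a" "p * a \<le> 1 - A" using a \<open>p > 0\<close> AB(5) mult_left_mono[of a A p] by simp_all
    have f: "(\<lambda>x. odd_powr p (u x)) \<in> Lp (1 / (p * a)) \<Omega>"
      using Lp_odd_powr[OF ua \<open>p > 0\<close>] by (simp add: mult.commute)
    have pa1: "1 \<le> 1 / (p * a)" using pa AB(1) by (simp add: le_divide_eq)
    show ?thesis
    proof (cases "p * a < gain")
      case True
      then have "v \<in> Linfty \<Omega>" by (intro vw_frac_lap_Linfty[OF v1 pu vw_v f pa1]) simp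
      then show ?thesis using u_of_v by blast
    next
      case False
      \<comment> \<open>the loss \<open>\<delta> / (2 q)\<close> pays for the strict inequality between the exponents\<close>
      define b where "b = min B (p * a - gain + \<delta> / (2 * q))"
      have loss: "0 < \<delta> / (2 * q)" using \<delta> \<open>q > 0\<close> by simp
      then have b: "0 < b" "b \<le> B" "p * a - gain < b" unfolding b_def using AB False pa by auto
      have vb: "v \<in> Lp (1 / b) \<Omega>"
        by (rule vw_frac_lap_Lp[OF v1 pu vw_v f pa1]) (use b in simp_all)
      have qb: "0 < q * b" "q * b \<le> 1 - B" using b \<open>q > 0\<close> AB(6) mult_left_mono[of b B q] by simp_all
      have g: "(\<lambda>x. odd_powr q (v x)) \<in> Lp (1 / (q * b)) \<Omega>"
        using Lp_odd_powr[OF vb \<open>q > 0\<close>] by (simp add: mult.commute)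
      have qb1: "1 \<le> 1 / (q * b)" using qb AB(3) by (simp add: le_divide_eq)
      show ?thesis
      proof (cases "q * b < gain")
        case True
        then have "u \<in> Linfty \<Omega>" by (intro vw_frac_lap_Linfty[OF u1 qv vw_u g qb1]) simp
        then show ?thesis ..
      next
        case False
        have "q * b \<le> q * (p * a - gain + \<delta> / (2 * q))" unfolding b_def using \<open>q > 0\<close> by (intro mult_left_mono) auto
        also have "\<dots> = q * (p * a - gain) + \<delta> / 2" using \<open>q > 0\<close> by (simp add: distrib_left)
        finally have lt: "q * b - gain < a - \<delta>" using decrease[of a] a \<delta> by simp
        with False have "\<delta> < a" by simp
        moreover have "u \<in> Lp (1 / (a - \<delta>)) \<Omega>"
          by (rule vw_frac_lap_Lp[OF u1 qv vw_u g qb1]) (use lt \<open>\<delta> < a\<close> in simp_all)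
        ultimately show ?thesis by blast
      qed
    qed
  qed
  have iterate: "u \<in> Linfty \<Omega> \<or> real n * \<delta> < A \<and> u \<in> Lp (1 / (A - real n * \<delta>)) \<Omega>" for n
  proof (induction n)
    case 0
    then show ?case using u AB(1) by (simp add: A_def)
  next
    case (Suc n)
    then show ?case
    proof
      assume n: "real n * \<delta> < A \<and> u \<in> Lp (1 / (A - real n * \<delta>)) \<Omega>"
      have "u \<in> Linfty \<Omega> \<or> \<delta> < A - real n * \<delta> \<and> u \<in> Lp (1 / (A - real n * \<delta> - \<delta>)) \<Omega>"
        by (rule turn) (use n \<delta> in auto)
      moreover have "A - real n * \<delta> - \<delta> = A - real (Suc n) * \<delta>" by (simp add: algebra_simps)
      ultimately show ?thesis by (metis diff_gt_0_iff_gt)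
    qed blast
  qed
  obtain n :: nat where "A < real n * \<delta>" using reals_Archimedean3[OF \<delta>] by blast
  with iterate[of n] show "u \<in> Linfty \<Omega>" by auto
  then show "v \<in> Linfty \<Omega>" by (rule v_of_u)
qed

lemma vw_frac_lap_AE_eq_solution:
  assumes v: "integrable M v" and vw: "vw_frac_lap s \<Omega> v m" and m: "m \<in> Linfty \<Omega>" and \<psi>: "has_frac_lap s \<Omega> \<psi> m"
  shows "AE x in M. v x = \<psi> x"
proof -
  have m1: "integrable M m" using Linfty_subset_Lp[OF m, of 1] by (simp add: L1_M)
  have \<psi>1: "integrable M \<psi>" by (rule X0_M(3)[OF has_frac_lapD(1)[OF \<psi>]])
  have d: "integrable M (\<lambda>x. v x - \<psi> x)" using v \<psi>1 by simp
  then have "(\<lambda>x. v x - \<psi> x) \<in> borel_measurable M" by auto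
  note g = sgn_bounded_measurable[OF this]
  obtain \<phi> where \<phi>: "has_frac_lap s \<Omega> \<phi> (\<lambda>x. sgn (v x - \<psi> x))" using ex_frac_lap[OF g] by blast
  have "(LINT x|M. (v x - \<psi> x) * sgn (v x - \<psi> x)) = (LINT x|M. v x * sgn (v x - \<psi> x) - \<psi> x * sgn (v x - \<psi> x))"
    by (simp add: left_diff_distrib)
  also have "\<dots> = (LINT x|M. v x * sgn (v x - \<psi> x)) - (LINT x|M. \<psi> x * sgn (v x - \<psi> x))"
    by (rule Bochner_Integration.integral_diff[OF AE_bounded_mult_integrable(2)[OF g v] AE_bounded_mult_integrable(2)[OF g \<psi>1]])
  also have "\<dots> = 0"
    using vw_frac_lap_bounded_test[OF v m1 vw g \<phi>] has_frac_lap_symmetric[OF \<psi> \<phi>] by simp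
  finally have "AE x in M. v x - \<psi> x = 0" by (rule AE_zero_of_integral_abs[OF d])
  then show ?thesis by eventually_elim simp
qed

text \<open>Taken at the test functions, the energy identity is the second equation of the system. The first
  holds by the choice of \<open>v\<close>, and the bootstrap starts from the exponents \<open>p + 1\<close> and \<open>q + 1\<close>, the
  former being the one that subcriticality gives to a solution with data in \<open>L\<^sup>r\<close>, \<open>r = 1 + 1 / q\<close>.\<close>

lemma energy_imp_classical:
  assumes "p > 0" "q > 0" and sub: "1 / (p + 1) + 1 / (q + 1) > 1 - gain"
    and energy: "energy_solution s p q \<Omega> u"
  shows "classical_solution s p q \<Omega> u (\<lambda>x. odd_powr (1 / q) (frac_lap s \<Omega> u x))"
proof -
  define r where "r = 1 + 1 / q"
  have r: "1 \<le> r" unfolding r_def using \<open>q > 0\<close> by simp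
  have uW: "u \<in> W2s s r \<Omega>" using energy by (simp add: energy_solution_def r_def)
  define F where "F = frac_lap s \<Omega> u"
  define v where "v x = odd_powr (1 / q) (F x)" for x
  have F: "F \<in> Lp r \<Omega>" unfolding F_def by (rule frac_lap_in_Lp[OF uW r])
  have F1: "integrable M F" using Lp_antimono[OF F _ r] by (simp add: L1_M)
  have u1: "integrable M u" using uW by (simp add: W2s_def L1_M)
  have vwF: "vw_frac_lap s \<Omega> u F" unfolding F_def by (rule frac_lap_W2s(2)[OF W2s_antimono[OF r uW]])
  have v: "v \<in> Lp (q + 1) \<Omega>"
  proof -
    have "r / (1 / q) = q + 1" unfolding r_def using \<open>q > 0\<close> by (simp add: field_simps)
    then show ?thesis using Lp_odd_powr[OF F, of "1 / q"] \<open>q > 0\<close> unfolding v_def[abs_def] by simp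
  qed
  have u: "u \<in> Lp (p + 1) \<Omega>"
  proof (rule vw_frac_lap_Lp[OF u1 F1 vwF F r])
    have "1 / r = 1 - 1 / (q + 1)" unfolding r_def using \<open>q > 0\<close> by (simp add: field_simps)
    then show "1 / r - gain < 1 / (p + 1)" using sub by simp
  qed (use \<open>p > 0\<close> in simp)
  have vw_u: "vw_frac_lap s \<Omega> u (\<lambda>x. odd_powr q (v x))"
    using vwF unfolding v_def odd_powr_inverse[OF \<open>q > 0\<close>] by simp
  have vw_v: "vw_frac_lap s \<Omega> v (\<lambda>x. odd_powr p (u x))"
    unfolding vw_frac_lap_def
  proof (intro ballI impI)
    fix \<phi> g assume g: "g \<in> Cc_infty \<Omega>" and \<phi>: "has_frac_lap s \<Omega> \<phi> g"
    have gL: "g \<in> Linfty \<Omega>" using Cc_infty_M[OF g] by (auto simp: Linfty_M)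
    have \<phi>1: "\<phi> \<in> Lp 1 \<Omega>" using X0_M(3)[OF has_frac_lapD(1)[OF \<phi>]] by (simp add: L1_M)
    note vw\<phi> = has_frac_lap_imp_vw[OF \<phi>]
    have "g \<in> Lp r \<Omega>" by (rule Linfty_subset_Lp[OF gL]) (use r in simp)
    then have \<phi>W: "\<phi> \<in> W2s s r \<Omega>" using \<phi>1 vw\<phi> by (auto simp: W2s_def)
    have g1: "g \<in> Lp 1 \<Omega>" by (rule Linfty_subset_Lp[OF gL]) simp
    have eq: "AE x in M. frac_lap s \<Omega> \<phi> x = g x" by (rule frac_lap_AE_eq[OF \<phi>1 g1 vw\<phi>])
    have fm: "frac_lap s \<Omega> \<phi> \<in> borel_measurable M" "g \<in> borel_measurable M" "v \<in> borel_measurable M"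
      using frac_lap_in_Lp[OF \<phi>W r] g1 v by (auto simp: Lp_def)
    have "(LINT x|M. v x * g x) = (LINT x|M. v x * frac_lap s \<Omega> \<phi> x)"
    proof (rule integral_cong_AE)
      show "AE x in M. v x * g x = v x * frac_lap s \<Omega> \<phi> x" using eq by eventually_elim simp
    qed (use fm in measurable)
    also have "\<dots> = (LINT x|M. odd_powr p (u x) * \<phi> x)"
      using energy \<phi>W unfolding energy_solution_def r_def v_def F_def by simp
    finally show "(LINT x|M. v x * g x) = (LINT x|M. odd_powr p (u x) * \<phi> x)" .
  qed
  show ?thesis
    using bootstrap_to_Linfty[OF assms(1-3) u v vw_u vw_v] vw_u vw_v
    unfolding classical_solution_def v_def[abs_def] F_def by simp
qed

text \<open>For bounded \<open>u\<close> the function \<open>v\<close> is the variational solution with datum \<open>\<bar>u\<bar>\<^sup>p\<^sup>-\<^sup>1 u\<close>; this pair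
  may be inserted into the very weak identity of any competitor \<open>\<phi>\<close>, which then reads as the energy
  identity.\<close>

lemma classical_imp_energy:
  assumes "p > 0" "q > 0" and uW: "u \<in> W2s s 1 \<Omega>"
    and classical: "classical_solution s p q \<Omega> u (\<lambda>x. odd_powr (1 / q) (frac_lap s \<Omega> u x))"
  shows "energy_solution s p q \<Omega> u"
proof -
  define r where "r = 1 + 1 / q"
  have r: "1 \<le> r" unfolding r_def using \<open>q > 0\<close> by simp
  define F where "F = frac_lap s \<Omega> u"
  define v where "v x = odd_powr (1 / q) (F x)" for x
  have cl: "u \<in> Linfty \<Omega>" "v \<in> Linfty \<Omega>" "vw_frac_lap s \<Omega> u F" "vw_frac_lap s \<Omega> v (\<lambda>x. odd_powr p (u x))"
    using classical unfolding classical_solution_def v_def[abs_def] F_def odd_powr_inverse[OF \<open>q > 0\<close>] by simp_all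
  have "F = (\<lambda>x. odd_powr q (v x))" unfolding v_def odd_powr_inverse[OF \<open>q > 0\<close>] by simp
  then have "F \<in> Linfty \<Omega>" using Linfty_odd_powr[OF cl(2) \<open>q > 0\<close>] by simp
  then have "F \<in> Lp r \<Omega>" using r by (intro Linfty_subset_Lp) simp_all
  then have uWr: "u \<in> W2s s r \<Omega>" using uW cl(3) by (auto simp: W2s_def)
  define m where "m x = odd_powr p (u x)" for x
  have m: "m \<in> Linfty \<Omega>" unfolding m_def by (rule Linfty_odd_powr[OF cl(1) \<open>p > 0\<close>])
  then obtain C where mC: "m \<in> borel_measurable M" "AE x in M. \<bar>m x\<bar> \<le> C" by (auto simp: Linfty_M)
  obtain \<psi> where \<psi>: "has_frac_lap s \<Omega> \<psi> m" using ex_frac_lap[OF mC] by blast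
  have v1: "integrable M v" using Linfty_subset_Lp[OF cl(2), of 1] by (simp add: L1_M)
  have v\<psi>: "AE x in M. v x = \<psi> x"
    by (rule vw_frac_lap_AE_eq_solution[OF v1 _ m \<psi>]) (use cl(4) in \<open>simp add: m_def[abs_def]\<close>)
  have "(LINT x|M. v x * frac_lap s \<Omega> \<phi> x) = (LINT x|M. m x * \<phi> x)" if \<phi>: "\<phi> \<in> W2s s r \<Omega>" for \<phi>
  proof -
    note \<phi>W = W2s_antimono[OF r \<phi>]
    note f = frac_lap_W2s[OF \<phi>W]
    have \<phi>1: "integrable M \<phi>" using \<phi>W by (simp add: W2s_def L1_M)
    have f1: "integrable M (frac_lap s \<Omega> \<phi>)" using f(1) by (simp add: L1_M)
    have ms: "v \<in> borel_measurable M" "\<psi> \<in> borel_measurable M" "frac_lap s \<Omega> \<phi> \<in> borel_measurable M"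
      using v1 f1 X0_M(1)[OF has_frac_lapD(1)[OF \<psi>]] by auto
    have "(LINT x|M. v x * frac_lap s \<Omega> \<phi> x) = (LINT x|M. frac_lap s \<Omega> \<phi> x * \<psi> x)"
    proof (rule integral_cong_AE)
      show "AE x in M. v x * frac_lap s \<Omega> \<phi> x = frac_lap s \<Omega> \<phi> x * \<psi> x" using v\<psi> by eventually_elim simp
    qed (use ms in measurable)
    also have "\<dots> = (LINT x|M. \<phi> x * m x)"
      by (rule vw_frac_lap_bounded_test[OF \<phi>1 f1 f(2) mC \<psi>, symmetric])
    finally show ?thesis by (simp add: mult.commute)
  qed
  then show ?thesis
    using uWr unfolding energy_solution_def r_def v_def F_def m_def by simp
qed

end

theorem proposition5p1:
  fixes s p q :: real
    and \<Omega> :: "'a::euclidean_space set"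
    and u v :: "'a \<Rightarrow> real"
  assumes "0 < s" and "s < 1"
    and "real DIM('a) > 2 * s"
    and "smooth_bounded_domain \<Omega>"
    and "p > 0" and "q > 0"
    and "1 / (p + 1) + 1 / (q + 1) > (real DIM('a) - 2 * s) / real DIM('a)"
    and "u \<in> W2s s 1 \<Omega>"
    and "v = (\<lambda>x. odd_powr (1 / q) (frac_lap s \<Omega> u x))"
  shows "energy_solution s p q \<Omega> u \<longleftrightarrow> classical_solution s p q \<Omega> u v"
proof -
  interpret dirichlet_domain s \<Omega>
    using assms(1,2,4) by unfold_locales (auto simp: smooth_bounded_domain_def)
  have "(real DIM('a) - 2 * s) / real DIM('a) = 1 - gain"
    by (simp add: gain_def diff_divide_distrib)
  then show ?thesis
    using energy_imp_classical[OF assms(5,6)] classical_imp_energy[OF assms(5,6,8)] assms(7,9) by auto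
qed

end
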